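(* Let $A$ be a finite nonempty subset of $\mathbb{R}\setminus\{0\}$. Then \[ \max\{|A-A|,|AA|\}\gtrsim |A|^{1+105/347},\qquad \max\{|A-A|,|A/A|\}\gtrsim |A|^{1+15/49}. \]
   Context: $A-A=\{a-b:a,b\in A\}$, $AA=\{ab:a,b\in A\}$, $A/A=\{a/b:a,b\in A\}$. Notation: $X\gtrsim Y$ means $Y\le C\,X(\log(2+|A|))^{c}$ for absolute constants $C,c>0$. *)

theory Defs
  imports Complex_Main
begin

definition diffset :: "real set \<Rightarrow> real set" where
  "diffset A = {a - b | a b. a \<in> A \<and> b \<in> A}"

definition prodset :: "real set \<Rightarrow> real set" where
  "prodset A = {a * b | a b. a \<in> A \<and> b \<in> A}"

definition quotset :: "real set \<Rightarrow> real set" where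
  "quotset A = {a / b | a b. a \<in> A \<and> b \<in> A}"

end

(*
  Write n = |A|, D = A - A, and q for the number of products (or quotients). Counting triples (a, b, c)
  with b - c a popular difference gives n^8 << |D| E3(A) E(A, D), where E3(A) is the third moment of the
  representation function of A - A and E(A, D) the additive energy.

  All incidence geometry takes place on grids X x Y, where the Szemeredi-Trotter bound follows from a
  cutting by axis-parallel lines.

  E3(A): if S is the dominant level set of differences, then a = s + b with s in S for many (s, b). A
  solution of a1 a4 = a2 a3 becomes a collinear triple, one point in a translate-parameter grid and two in
  the other grid. Bounding collinear triples from above and multiplicative energies from below by q gives
  E3(A)^4 << q^3 n^10.

  E(A, D): a set with large energy with D contains a nonempty subset which is multiplicatively spread out
  like a random set. Remove a maximal such subset C from A. If |C| >= n/2, the same difference-set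
  argument, or its sum-set analogue, applied to ln C bounds q from below; otherwise A - C has small energy
  with D. The threshold for "large" is chosen to balance the two cases.
*)
theory Submission
  imports Defs "HOL-Analysis.Analysis"
begin

section \<open>Fibres and dyadic pigeonholing\<close>

text \<open>The inequality defining \<open>spread\<close> is, for fixed \<open>h\<close>, linear in
  the size of the set. Disjoint unions therefore stay spread, which is what turns maximality of C
  into information on the complement. Write d = |A - A|. If no half of \<open>A\<close> is spread,
  then n^20 << q^3 h^12 d^10. A spread half of size at least h^3 gives n^2 h^18 << q^5 for quotients
  and n^6 h^48 << q^14 for products. Eliminating h yields n^64 << q^19 d^30 and n^86 << q^26 d^40.
  The exponents are 64/49 = 1 + 15/49 and 86/66 = 43/33, the latter slightly above the required 1 +
  105/347. Products come out weaker because a triple (a, b, c) naturally produces differences. With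
  sums, both a + b and a + c must be made popular, and the differences b - c need a level set of
  their own. Cube roots of cardinalities are carried as parameters and all estimates compare integer
  powers; real exponents enter only at the end. \<open>J\<close> bounds the number of dyadic levels
  and is the only source of logarithms.\<close>

definition fib :: "('a \<Rightarrow> 'b) \<Rightarrow> 'a set \<Rightarrow> 'b \<Rightarrow> nat" where
  "fib f S y = card {p \<in> S. f p = y}"

lemma card_eq_sum_fib:
  assumes "finite S"
  shows "card S = (\<Sum>y\<in>f ` S. fib f S y)"
proof -
  have "card S = card (\<Union>y\<in>f ` S. {p \<in> S. f p = y})"
    by (rule arg_cong[where f = card]) auto
  also have "\<dots> = (\<Sum>y\<in>f ` S. card {p \<in> S. f p = y})"
    using assms by (intro card_UN_disjoint) auto
  finally show ?thesis by (simp add: fib_def)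
qed

lemma card_collisions:
  assumes "finite S"
  shows "card {(p, q). p \<in> S \<and> q \<in> S \<and> f p = f q} = (\<Sum>y\<in>f ` S. (fib f S y)\<^sup>2)"
proof -
  have "{(p, q). p \<in> S \<and> q \<in> S \<and> f p = f q} =
      (\<Union>y\<in>f ` S. {p \<in> S. f p = y} \<times> {p \<in> S. f p = y})" by auto
  moreover have "card \<dots> = (\<Sum>y\<in>f ` S. card ({p \<in> S. f p = y} \<times> {p \<in> S. f p = y}))"
    using assms by (intro card_UN_disjoint) auto
  ultimately show ?thesis by (simp add: fib_def card_cartesian_product power2_eq_square)
qed

lemma fib_pos: "finite S \<Longrightarrow> y \<in> f ` S \<Longrightarrow> 1 \<le> fib f S y"
  unfolding fib_def by (auto simp: Suc_le_eq card_gt_0_iff)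

text \<open>Cauchy-Schwarz over the fibre sizes. With few values there must be many collisions, and
  collisions are then recognised as energies.\<close>

lemma card_square_le_image_times_collisions:
  assumes "finite S"
  shows "(real (card S))\<^sup>2 \<le> real (card (f ` S)) * real (card {(p, q). p \<in> S \<and> q \<in> S \<and> f p = f q})"
proof -
  have "(\<Sum>y\<in>f ` S. real (fib f S y))\<^sup>2 \<le> (\<Sum>y\<in>f ` S. 1\<^sup>2) * (\<Sum>y\<in>f ` S. (real (fib f S y))\<^sup>2)"
    using Cauchy_Schwarz_ineq_sum[of "\<lambda>_. 1" "\<lambda>y. real (fib f S y)" "f ` S"] by simp
  then show ?thesis
    by (simp add: card_collisions[OF assms] card_eq_sum_fib[OF assms, of f])
qed

lemma dyadic_level:
  fixes v :: nat
  assumes "1 \<le> v" "v < 2 ^ J"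
  obtains i where "i < J" "2 ^ i \<le> v" "v < 2 ^ Suc i"
proof -
  obtain i where i: "2 ^ i \<le> v" "v < 2 ^ Suc i"
    using ex_power_ivl1[of 2 v] assms(1) by fastforce
  then have "(2::nat) ^ i < 2 ^ J" using assms(2) by linarith
  then have "i < J" by simp
  with i that show thesis by blast
qed

text \<open>One of the \<open>J\<close> levels carries at least the average. The weight
  \<open>F\<close> and the quantity \<open>v\<close> that defines the levels are kept apart, since
  \<open>F\<close> is often a power of \<open>v\<close>.\<close>

lemma dyadic_pigeonhole:
  fixes F :: "'a \<Rightarrow> real" and v :: "'a \<Rightarrow> nat"
  assumes "finite X" "\<And>x. x \<in> X \<Longrightarrow> 0 \<le> F x"
    and "\<And>x. x \<in> X \<Longrightarrow> 1 \<le> v x" "\<And>x. x \<in> X \<Longrightarrow> v x < 2 ^ J" and "0 < J"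
  obtains i where "i < J" "sum F X \<le> real J * sum F {x \<in> X. 2 ^ i \<le> v x \<and> v x < 2 * 2 ^ i}"
proof -
  let ?X = "\<lambda>i. {x \<in> X. 2 ^ i \<le> v x \<and> v x < 2 * 2 ^ i}"
  have "sum F X \<le> (\<Sum>x\<in>X. \<Sum>i<J. if 2 ^ i \<le> v x \<and> v x < 2 * 2 ^ i then F x else 0)"
  proof (rule sum_mono)
    fix x assume x: "x \<in> X"
    obtain i where i: "i < J" "2 ^ i \<le> v x" "v x < 2 ^ Suc i"
      using dyadic_level[OF assms(3)[OF x] assms(4)[OF x]] .
    have "F x = (\<Sum>i\<in>{i}. if 2 ^ i \<le> v x \<and> v x < 2 * 2 ^ i then F x else 0)"
      using i by simp
    also have "\<dots> \<le> (\<Sum>i<J. if 2 ^ i \<le> v x \<and> v x < 2 * 2 ^ i then F x else 0)"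
      using i x assms(2) by (intro sum_mono2) auto
    finally show "F x \<le> (\<Sum>i<J. if 2 ^ i \<le> v x \<and> v x < 2 * 2 ^ i then F x else 0)" .
  qed
  also have "\<dots> = (\<Sum>i<J. sum F (?X i))"
    by (subst sum.swap) (simp only: sum.inter_filter[OF assms(1)])
  finally have le: "sum F X \<le> (\<Sum>i<J. sum F (?X i))" .
  show thesis
  proof (rule ccontr)
    assume "\<not> thesis"
    then have "\<forall>i<J. real J * sum F (?X i) < sum F X" using that by (meson not_le)
    then have "(\<Sum>i<J. real J * sum F (?X i)) < (\<Sum>i<J. sum F X)"
      using assms(5) by (intro sum_strict_mono) auto
    then have "real J * (\<Sum>i<J. sum F (?X i)) < real J * sum F X"
      by (simp add: sum_distrib_left)
    then show False using le assms(5) by simp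
  qed
qed

section \<open>Incidences on grids\<close>

text \<open>A line is the pair of its slope and intercept. Vertical lines are thus excluded by the
  encoding, horizontal ones by the hypothesis \<open>fst l \<noteq> 0\<close> where needed.\<close>

definition on_line :: "real \<times> real \<Rightarrow> real \<times> real \<Rightarrow> bool" where
  "on_line l p \<longleftrightarrow> snd p = fst l * fst p + snd l"

definition incidences :: "(real \<times> real) set \<Rightarrow> (real \<times> real) set \<Rightarrow> nat" where
  "incidences L P = card {(l, p). l \<in> L \<and> p \<in> P \<and> on_line l p}"

text \<open>Cutting by rank in \<open>X\<close>, not by position on the axis, gives every block at
  most \<open>b\<close> points however unevenly \<open>X\<close> is distributed.\<close>

definition block :: "nat \<Rightarrow> real set \<Rightarrow> real \<Rightarrow> nat" where
  "block b X x = card {x' \<in> X. x' < x} div b"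

lemma block_mono: "finite X \<Longrightarrow> x \<le> y \<Longrightarrow> block b X x \<le> block b X y"
  unfolding block_def by (intro div_le_mono card_mono) auto

lemma block_less:
  assumes "finite X" "x \<in> X" "card X \<le> b * s"
  shows "block b X x < s"
proof -
  have "card {x' \<in> X. x' < x} < card X"
    using assms by (intro psubset_card_mono) auto
  then have "card {x' \<in> X. x' < x} < s * b" using assms by (simp add: mult.commute)
  then show ?thesis unfolding block_def by (simp add: less_mult_imp_div_less)
qed

lemma card_block:
  assumes "finite X" "0 < b"
  shows "card {x \<in> X. block b X x = j} \<le> b"
proof -
  let ?r = "\<lambda>x. card {x' \<in> X. x' < x}"
  have mono: "?r x < ?r y" if "x \<in> X" "x < y" for x y
    using assms that by (intro psubset_card_mono) auto
  have "inj_on ?r X"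
  proof (rule inj_onI)
    fix x y assume "x \<in> X" "y \<in> X" "?r x = ?r y"
    then show "x = y" using mono[of x y] mono[of y x] by (cases x y rule: linorder_cases) auto
  qed
  then have "card {x \<in> X. block b X x = j} = card (?r ` {x \<in> X. block b X x = j})"
    by (intro card_image[symmetric]) (auto intro: inj_on_subset)
  also have "\<dots> \<le> card {j * b..<j * b + b}"
  proof (rule card_mono)
    show "?r ` {x \<in> X. block b X x = j} \<subseteq> {j * b..<j * b + b}"
    proof clarify
      fix x assume "x \<in> X"
      have "?r x = ?r x div b * b + ?r x mod b" by simp
      moreover have "?r x mod b < b" using assms(2) by simp
      ultimately show "?r x \<in> {block b X x * b..<block b X x * b + b}"
        unfolding block_def atLeastLessThan_iff by linarith
    qed
  qed simp
  finally show ?thesis by simp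
qed

text \<open>Along a line of nonzero slope both block indices are monotone, so the cells that it
  meets form a staircase.\<close>

lemma card_cells_on_line:
  assumes X: "finite X" and Y: "finite Y" and m: "fst l \<noteq> 0"
    and f: "\<And>x. x \<in> X \<Longrightarrow> block a X x < s" and g: "\<And>y. y \<in> Y \<Longrightarrow> block b Y y < s"
  shows "card ((\<lambda>(x, y). (block a X x, block b Y y)) ` {p \<in> X \<times> Y. on_line l p}) \<le> 2 * s"
proof -
  let ?h = "\<lambda>(x, y). (block a X x, block b Y y)" and ?P = "{p \<in> X \<times> Y. on_line l p}"
  \<comment> \<open>A height along the staircase that separates its cells. For negative slope the
    second index is reversed; as j < s, the truncated subtraction loses nothing and the value stays
    below 2 s.\<close>
  define \<phi> where "\<phi> = (\<lambda>(i::nat, j). if 0 < fst l then i + j else i + (s - j))"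
  have key: "?h (x, y) = ?h (x', y')"
    if "(x, y) \<in> ?P" "(x', y') \<in> ?P" "\<phi> (?h (x, y)) = \<phi> (?h (x', y'))" "x \<le> x'" for x y x' y'
  proof (cases "0 < fst l")
    case True
    then have "y \<le> y'" using that by (auto simp: on_line_def intro: mult_left_mono)
    then have "block a X x \<le> block a X x'" "block b Y y \<le> block b Y y'"
      using that X Y by (auto intro: block_mono)
    then show ?thesis using that True by (auto simp: \<phi>_def)
  next
    case False
    then have "y' \<le> y" using that m by (auto simp: on_line_def intro: mult_left_mono_neg)
    then have "block a X x \<le> block a X x'" "block b Y y' \<le> block b Y y"
      using that X Y by (auto intro: block_mono)
    moreover have "block b Y y < s" "block b Y y' < s" using that g by auto
    ultimately show ?thesis using that False by (auto simp: \<phi>_def)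
  qed
  have "inj_on \<phi> (?h ` ?P)"
  proof (rule inj_onI, elim imageE)
    fix u w p q assume *: "\<phi> u = \<phi> w" "u = ?h p" "w = ?h q" "p \<in> ?P" "q \<in> ?P"
    obtain x y x' y' where "p = (x, y)" "q = (x', y')" by fastforce
    then have p: "(x, y) \<in> ?P" "(x', y') \<in> ?P" "\<phi> (?h (x, y)) = \<phi> (?h (x', y'))" using * by simp_all
    have "?h (x, y) = ?h (x', y')"
    proof (cases "x \<le> x'")
      case True
      then show ?thesis using key[OF p] by simp
    next
      case False
      then show ?thesis using key[OF p(2,1) p(3)[symmetric]] by simp
    qed
    then show "u = w" using * \<open>p = (x, y)\<close> \<open>q = (x', y')\<close> by simp
  qed
  then have "card (?h ` ?P) = card (\<phi> ` ?h ` ?P)" by (simp add: card_image)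
  also have "\<dots> \<le> card {..<2 * s}"
  proof (rule card_mono)
    show "\<phi> ` ?h ` ?P \<subseteq> {..<2 * s}"
    proof clarify
      fix x y assume "x \<in> X" "y \<in> Y"
      then have "block a X x < s" "block b Y y < s" using f g by auto
      then show "\<phi> (block a X x, block b Y y) < 2 * s" by (auto simp: \<phi>_def)
    qed
  qed simp
  finally show ?thesis by simp
qed

lemma incidences_eq_sum:
  assumes "finite L" "finite P"
  shows "incidences L P = (\<Sum>l\<in>L. card {p \<in> P. on_line l p})"
proof -
  have "{(l, p). l \<in> L \<and> p \<in> P \<and> on_line l p} = (SIGMA l:L. {p \<in> P. on_line l p})" by auto
  then show ?thesis using assms by (simp add: incidences_def)
qed

lemma on_line_unique:
  assumes "on_line l p" "on_line l q" "on_line l' p" "on_line l' q" "p \<noteq> q"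
  shows "l = l'"
proof -
  have ne: "fst p \<noteq> fst q" using assms by (auto simp: on_line_def prod_eq_iff)
  have "(fst l - fst l') * (fst p - fst q) = 0"
    using assms by (simp add: on_line_def algebra_simps)
  then have "fst l = fst l'" using ne by simp
  then show ?thesis using assms by (auto simp: on_line_def prod_eq_iff)
qed

text \<open>A grid can be cut into \<open>s \<times> s\<close> cells by axis-parallel lines, and a line of nonzero slope is
  monotone, so it meets at most \<open>2 s\<close> cells; inside a cell, two points determine the line.\<close>

lemma grid_incidences_parameter:
  assumes X: "finite X" and Y: "finite Y" and L: "finite L" "\<And>l. l \<in> L \<Longrightarrow> fst l \<noteq> 0" and s: "0 < s"
  shows "real (incidences L (X \<times> Y)) \<le> 2 * real s * card L + 4 * (real (card X) * real (card Y))\<^sup>2 / (real s)\<^sup>2"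
proof -
  let ?P = "\<lambda>l. {p \<in> X \<times> Y. on_line l p}"
  have fP: "finite (?P l)" for l using X Y by auto
  have weaken: ?thesis if "incidences L (X \<times> Y) \<le> s * card L"
  proof -
    have "real (incidences L (X \<times> Y)) \<le> real s * card L"
      using of_nat_mono[OF that, where ?'a = real] by simp
    also have "\<dots> \<le> 2 * real s * card L" by (simp add: mult_right_mono)
    also have "\<dots> \<le> 2 * real s * card L + 4 * (real (card X) * real (card Y))\<^sup>2 / (real s)\<^sup>2" by simp
    finally show ?thesis .
  qed
  \<comment> \<open>If one side of the grid is shorter than s, projecting to it shows that every
    line has fewer than s points. Only otherwise are cells needed.\<close>
  consider "card X < s" | "card Y < s" | "s \<le> card X" "s \<le> card Y" by linarith
  then show ?thesis
  proof cases
    case 1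
    have "card (?P l) \<le> s" for l
    proof -
      have "inj_on fst (?P l)" by (rule inj_onI) (auto simp: on_line_def)
      then have "card (?P l) \<le> card X"
        using X by (intro card_inj_on_le[of _ _ X]) auto
      then show ?thesis using 1 by simp
    qed
    then have "(\<Sum>l\<in>L. card (?P l)) \<le> (\<Sum>l\<in>L. s)" by (intro sum_mono)
    then have "incidences L (X \<times> Y) \<le> s * card L"
      unfolding incidences_eq_sum[OF L(1) finite_cartesian_product[OF X Y]] by (simp add: mult.commute)
    then show ?thesis by (rule weaken)
  next
    case 2
    have "card (?P l) \<le> s" if "l \<in> L" for l
    proof -
      have "inj_on snd (?P l)" using L(2)[OF that] by (intro inj_onI) (auto simp: on_line_def)
      then have "card (?P l) \<le> card Y"
        using Y by (intro card_inj_on_le[of _ _ Y]) auto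
      then show ?thesis using 2 by simp
    qed
    then have "(\<Sum>l\<in>L. card (?P l)) \<le> (\<Sum>l\<in>L. s)" by (intro sum_mono)
    then have "incidences L (X \<times> Y) \<le> s * card L"
      unfolding incidences_eq_sum[OF L(1) finite_cartesian_product[OF X Y]] by (simp add: mult.commute)
    then show ?thesis by (rule weaken)
  next
    case 3
    define a where "a = card X div s + 1"
    define b where "b = card Y div s + 1"
    \<comment> \<open>Rounding up costs at most a factor 2 because s <= N; this is the origin of the
      constant 4 = 2 * 2 in the statement.\<close>
    have bound: "N \<le> (N div s + 1) * s \<and> real (N div s + 1) \<le> 2 * real N / real s" if "s \<le> N" for N
    proof
      show "N \<le> (N div s + 1) * s"
        using s by (metis add.commute dividend_less_times_div less_imp_le mult.commute mult_Suc_right plus_1_eq_Suc)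
      have "1 \<le> N div s" using that s by (simp add: Suc_leI div_greater_zero_iff)
      then have "real (N div s + 1) \<le> 2 * real (N div s)" by simp
      also have "\<dots> \<le> 2 * (real N / real s)" using floor_divide_of_nat_eq[where ?'a = real, of N s] of_int_floor_le[of "real N / real s"] by linarith
      finally show "real (N div s + 1) \<le> 2 * real N / real s" by simp
    qed
    have f: "block a X x < s" if "x \<in> X" for x
      using block_less[OF X that] bound[OF 3(1)] by (simp add: a_def)
    have g: "block b Y y < s" if "y \<in> Y" for y
      using block_less[OF Y that] bound[OF 3(2)] by (simp add: b_def)
    let ?h = "\<lambda>(x, y). (block a X x, block b Y y)"
    \<comment> \<open>Ordered pairs of distinct points of one line that share a cell. Two points
      determine the line, so these sets are disjoint for distinct lines and together fit into the
      pairs \<open>?C\<close> sharing a cell.\<close>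
    let ?O = "\<lambda>l. {(p, q). p \<in> ?P l \<and> q \<in> ?P l \<and> p \<noteq> q \<and> ?h p = ?h q}"
    let ?C = "{(p, q). p \<in> X \<times> Y \<and> q \<in> X \<times> Y \<and> ?h p = ?h q}"
    have fC: "finite ?C" by (rule finite_subset[of _ "(X \<times> Y) \<times> (X \<times> Y)"]) (use X Y in auto)
    have sub: "?O l \<subseteq> ?C" for l by blast
    have fO: "finite (?O l)" for l by (rule finite_subset[OF sub fC])
    have line: "card (?P l) \<le> 2 * s + card (?O l)" if "l \<in> L" for l
    proof -
      have "{(p, q). p \<in> ?P l \<and> q \<in> ?P l \<and> ?h p = ?h q} = (\<lambda>p. (p, p)) ` ?P l \<union> ?O l"
        by (intro set_eqI) blast
      then have "card {(p, q). p \<in> ?P l \<and> q \<in> ?P l \<and> ?h p = ?h q} \<le> card ((\<lambda>p. (p, p)) ` ?P l) + card (?O l)"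
        using card_Un_le[of "(\<lambda>p. (p, p)) ` ?P l" "?O l"] by (simp only:)
      also have "card ((\<lambda>p. (p, p)) ` ?P l) = card (?P l)" by (intro card_image) (simp add: inj_on_def)
      finally have 1: "(\<Sum>y\<in>?h ` ?P l. (fib ?h (?P l) y)\<^sup>2) \<le> card (?P l) + card (?O l)"
        by (simp only: card_collisions[OF fP])
      have "2 * card (?P l) = (\<Sum>y\<in>?h ` ?P l. 2 * fib ?h (?P l) y)"
        using card_eq_sum_fib[OF fP, of l ?h] by (simp add: sum_distrib_left)
      \<comment> \<open>A cell with k points of the line is charged 1 for being met, and its k^2
        pairs, diagonal included, account for the rest.\<close>
      also have "\<dots> \<le> (\<Sum>y\<in>?h ` ?P l. 1 + (fib ?h (?P l) y)\<^sup>2)"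
      proof (rule sum_mono)
        show "2 * k \<le> 1 + k\<^sup>2" for k :: nat
          using zero_le_power2[of "int k - 1"]
          by (simp add: power2_eq_square algebra_simps flip: of_nat_mult of_nat_add of_nat_le_iff[where ?'a = int])
      qed
      also have "\<dots> = card (?h ` ?P l) + (\<Sum>y\<in>?h ` ?P l. (fib ?h (?P l) y)\<^sup>2)"
        by (simp only: sum.distrib card_eq_sum)
      finally have 2: "2 * card (?P l) \<le> card (?h ` ?P l) + (\<Sum>y\<in>?h ` ?P l. (fib ?h (?P l) y)\<^sup>2)" .
      have 3: "card (?h ` ?P l) \<le> 2 * s"
        using card_cells_on_line[OF X Y L(2)[OF that] f g] by blast
      show ?thesis using 1 2 3 by linarith
    qed
    have "(\<Sum>l\<in>L. card (?O l)) = card (\<Union>l\<in>L. ?O l)"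
    proof (rule card_UN_disjoint[symmetric])
      show "\<forall>l\<in>L. \<forall>l'\<in>L. l \<noteq> l' \<longrightarrow> ?O l \<inter> ?O l' = {}"
        using on_line_unique by blast
    qed (use L fO in auto)
    also have "\<dots> \<le> card ?C" using sub by (intro card_mono[OF fC] UN_least)
    also have "card ?C = (\<Sum>y\<in>?h ` (X \<times> Y). (fib ?h (X \<times> Y) y)\<^sup>2)"
      using X Y by (intro card_collisions) auto
    also have "\<dots> \<le> (\<Sum>y\<in>?h ` (X \<times> Y). a * b * fib ?h (X \<times> Y) y)"
    proof (rule sum_mono)
      fix y assume "y \<in> ?h ` (X \<times> Y)"
      have "fib ?h (X \<times> Y) y = card ({x \<in> X. block a X x = fst y} \<times> {x \<in> Y. block b Y x = snd y})"
        unfolding fib_def by (rule arg_cong[where f = card]) auto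
      also have "\<dots> \<le> a * b"
        unfolding card_cartesian_product using X Y
        by (intro mult_le_mono card_block) (auto simp: a_def b_def)
      finally show "(fib ?h (X \<times> Y) y)\<^sup>2 \<le> a * b * fib ?h (X \<times> Y) y" by (simp add: power2_eq_square)
    qed
    also have "\<dots> = a * b * (card X * card Y)"
      using X Y card_eq_sum_fib[of "X \<times> Y" ?h] by (simp add: sum_distrib_left[symmetric] card_cartesian_product)
    finally have O: "(\<Sum>l\<in>L. card (?O l)) \<le> a * b * (card X * card Y)" .
    have "incidences L (X \<times> Y) = (\<Sum>l\<in>L. card (?P l))"
      by (rule incidences_eq_sum[OF L(1) finite_cartesian_product[OF X Y]])
    also have "\<dots> \<le> (\<Sum>l\<in>L. 2 * s + card (?O l))" by (rule sum_mono) (rule line)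
    also have "\<dots> = 2 * s * card L + (\<Sum>l\<in>L. card (?O l))"
      by (simp only: sum.distrib sum_constant mult.commute of_nat_id)
    also note O
    finally have le: "incidences L (X \<times> Y) \<le> 2 * s * card L + a * b * (card X * card Y)" by simp
    have "real (incidences L (X \<times> Y)) \<le> 2 * real s * card L + (real a * real b) * (real (card X) * card Y)"
      using of_nat_mono[OF le, where ?'a = real] by simp
    also have "real a * real b \<le> (2 * real (card X) / real s) * (2 * real (card Y) / real s)"
      using bound[OF 3(1)] bound[OF 3(2)] by (intro mult_mono) (auto simp: a_def b_def)
    finally show ?thesis by (simp add: power2_eq_square mult_right_mono field_simps)
  qed
qed

text \<open>The choice s ~ p^2 / l balances s l^3 against p^6 / s^2. The usual Szemeredi-Trotter
  term |X||Y| is absent: where it would dominate, the bound of sqrt(|X||Y|) points per line on a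
  grid is already covered by the main term. The computation gives 6 in place of 18.\<close>

lemma incidences_le:
  fixes p l :: real
  assumes "finite X" "finite Y" "finite L" "\<And>l. l \<in> L \<Longrightarrow> fst l \<noteq> 0"
    and p: "0 \<le> p" "p ^ 3 = real (card X) * real (card Y)" and l: "0 \<le> l" "l ^ 3 = real (card L)"
  shows "real (incidences L (X \<times> Y)) \<le> 18 * (p * l)\<^sup>2 + 2 * l ^ 3"
proof (cases "l = 0 \<or> p = 0")
  case True
  have "incidences L (X \<times> Y) = 0"
  proof -
    have "L = {} \<or> X = {} \<or> Y = {}" using True p l assms by auto
    then show ?thesis by (auto simp: incidences_def)
  qed
  then show ?thesis using l by simp
next
  case False
  then have pos: "0 < p" "0 < l" using p l by auto
  define s where "s = nat \<lceil>p\<^sup>2 / l\<rceil>"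
  have r: "0 < p\<^sup>2 / l" using pos by simp
  then have s: "p\<^sup>2 / l \<le> real s" "real s \<le> p\<^sup>2 / l + 1" "0 < s"
    unfolding s_def by linarith+
  have "real (incidences L (X \<times> Y)) \<le> 2 * real s * l ^ 3 + 4 * (p ^ 3)\<^sup>2 / (real s)\<^sup>2"
    using grid_incidences_parameter[OF assms(1-4) s(3)] p l by simp
  also have "2 * real s * l ^ 3 \<le> 2 * (p\<^sup>2 / l + 1) * l ^ 3"
    using s pos by (intro mult_right_mono) auto
  also have "\<dots> = 2 * (p * l)\<^sup>2 + 2 * l ^ 3"
    using pos by (simp add: field_simps power2_eq_square power3_eq_cube)
  also have "4 * (p ^ 3)\<^sup>2 / (real s)\<^sup>2 \<le> 4 * (p ^ 3)\<^sup>2 / (p\<^sup>2 / l)\<^sup>2"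
    using s r by (intro divide_left_mono power_mono mult_pos_pos) (auto simp: less_le_trans)
  also have "\<dots> = 4 * (p * l)\<^sup>2"
    using pos by (simp add: field_simps power2_eq_square power3_eq_cube)
  finally show ?thesis by (smt (verit) zero_le_power2)
qed

text \<open>In terms of cardinalities this is |L| << |V|^4 / k^3. Counting incidences gives k l^3 <=
  18 w^4 l^2 + 2 l^3, and k >= 4 allows the last term to be absorbed on the left.\<close>

lemma rich_lines_le:
  fixes w l k :: real
  assumes "finite V" "finite L" "\<And>l. l \<in> L \<Longrightarrow> fst l \<noteq> 0"
    and rich: "\<And>l. l \<in> L \<Longrightarrow> k \<le> real (card {p \<in> V \<times> V. on_line l p})" and k: "4 \<le> k"
    and w: "0 \<le> w" "w ^ 3 = real (card V)" and l: "0 \<le> l" "l ^ 3 = real (card L)"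
  shows "l \<le> 36 * w ^ 4 / k"
proof (cases "l = 0")
  case True
  then show ?thesis using w k by simp
next
  case False
  then have pos: "0 < l" using l by simp
  have "k * l ^ 3 \<le> (\<Sum>l\<in>L. real (card {p \<in> V \<times> V. on_line l p}))"
    using sum_bounded_below[of L k "\<lambda>l. real (card {p \<in> V \<times> V. on_line l p})"] rich l by (simp add: mult.commute)
  also have "\<dots> = real (incidences L (V \<times> V))"
    using assms by (simp add: incidences_eq_sum)
  also have "\<dots> \<le> 18 * (w\<^sup>2 * l)\<^sup>2 + 2 * l ^ 3"
  proof (rule incidences_le)
    show "(w\<^sup>2) ^ 3 = real (card V) * real (card V)"
      by (simp flip: w(2) power_mult power_add)
  qed (use assms in auto)
  finally have "(k - 2) * l ^ 3 \<le> 18 * w ^ 4 * l\<^sup>2"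
    by (simp add: algebra_simps power_mult_distrib flip: power_mult)
  then have "((k - 2) * l) * l\<^sup>2 \<le> (18 * w ^ 4) * l\<^sup>2" by (simp add: power2_eq_square power3_eq_cube mult.assoc)
  then have "(k - 2) * l \<le> 18 * w ^ 4" using pos by simp
  moreover have "k * l \<le> 2 * ((k - 2) * l)" using k pos by (simp add: algebra_simps)
  ultimately have "k * l \<le> 36 * w ^ 4" by linarith
  then show ?thesis using k by (simp add: field_simps)
qed

section \<open>Collinear triples and multiplicative energy\<close>

definition translates :: "real set \<Rightarrow> real set \<Rightarrow> real \<Rightarrow> real set" where
  "translates A V u = {a \<in> A. a - u \<in> V}"

text \<open>The multiplicative energy of \<open>X\<close> and \<open>Y\<close>. The cross-multiplied
  form serves quotients directly and products after exchanging two variables.\<close>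

definition cross_energy :: "real set \<Rightarrow> real set \<Rightarrow> nat" where
  "cross_energy X Y = card {(p, p'). p \<in> X \<times> Y \<and> p' \<in> X \<times> Y \<and> fst p * snd p' = fst p' * snd p}"

lemma finite_translates [simp]: "finite A \<Longrightarrow> finite (translates A V u)"
  by (simp add: translates_def)

lemma cross_energy_eq_sum:
  assumes "finite X" "finite Y"
  shows "cross_energy X Y = (\<Sum>p\<in>X \<times> Y. card {p' \<in> X \<times> Y. fst p * snd p' = fst p' * snd p})"
proof -
  have "{(p, p'). p \<in> X \<times> Y \<and> p' \<in> X \<times> Y \<and> fst p * snd p' = fst p' * snd p} =
      (SIGMA p:X \<times> Y. {p' \<in> X \<times> Y. fst p * snd p' = fst p' * snd p})" by auto
  then show ?thesis using assms by (simp add: cross_energy_def)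
qed

text \<open>Eliminates an unknown dyadic level \<open>k\<close>: the product of 2 k g^2 and 2 b^2 /
  k does not contain it.\<close>

lemma le_of_two_bounds:
  fixes x a b k g :: real
  assumes "x \<le> 2 * k * g\<^sup>2" "x \<le> a + b\<^sup>2 / k" "0 < k" "0 \<le> a" "0 \<le> b" "0 \<le> g"
  shows "x \<le> 2 * a + 2 * b * g"
proof (cases "b\<^sup>2 / k \<le> a")
  case True
  then show ?thesis using assms by (smt (verit) mult_nonneg_nonneg)
next
  case False
  show ?thesis
  proof (cases "x \<le> 0")
    case True
    then show ?thesis using assms by (smt (verit) mult_nonneg_nonneg)
  next
    case x: False
    have "x \<le> 2 * b\<^sup>2 / k" using False assms(2) by simp
    moreover have "0 \<le> 2 * k * g\<^sup>2" using assms(3) by simp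
    ultimately have "x * x \<le> (2 * k * g\<^sup>2) * (2 * b\<^sup>2 / k)"
      using assms(1) x by (intro mult_mono) linarith+
    also have "\<dots> = (2 * b * g)\<^sup>2 * (k / k)" by (simp only: power_mult_distrib times_divide_eq_right) simp
    finally have "x\<^sup>2 \<le> (2 * b * g)\<^sup>2" using assms(3) by (simp add: power2_eq_square[of x])
    then have "x \<le> 2 * b * g" using assms(5,6) power2_le_imp_le[of x "2 * b * g"] by simp
    then show ?thesis using assms(4) by linarith
  qed
qed

text \<open>Solutions of \<open>x y' = x' y\<close> with \<open>x, x' \<in> u + V\<close> and \<open>y, y' \<in> u' + V\<close> are pairs of points of the
  grid \<open>V \<times> V\<close> collinear with \<open>(- u, - u')\<close>.\<close>

lemma sum_cross_energy_le:
  fixes u v :: real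
  assumes fin: "finite U" "finite V" "finite A" and A0: "0 \<notin> A"
    and J: "card V < 2 ^ J" "0 < J"
    and u: "0 \<le> u" "u ^ 3 = real (card U)" and v: "0 \<le> v" "v ^ 3 = real (card V)"
    and g: "g = (\<Sum>x\<in>U. real (card (translates A V x)))"
  shows "(\<Sum>(x, y)\<in>U \<times> U. real (cross_energy (translates A V x) (translates A V y)))
    \<le> real J * (8 * g\<^sup>2 + 186624 * u ^ 4 * v ^ 8 + 1224 * v ^ 6 * g)"
proof -
  let ?X = "translates A V"
  define \<Gamma> where "\<Gamma> = (SIGMA c:U \<times> U. ?X (fst c) \<times> ?X (snd c))"
  \<comment> \<open>Here \<open>ln\<close> is not the logarithm. It is the line through the origin
    and p, translated by -c; it passes through -c and, since p - c lies in V x V, through a point of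
    that grid.\<close>
  define ln where "ln = (\<lambda>(c, p). (snd p / fst p, snd p / fst p * fst c - snd c) :: real \<times> real)"
  define i where "i = (\<lambda>l. card {p \<in> V \<times> V. on_line l p})"
  have fV: "finite {p \<in> V \<times> V. on_line l p}" for l using fin by auto
  have fG: "finite \<Gamma>" unfolding \<Gamma>_def using fin by auto
  have cardG: "real (card \<Gamma>) = g\<^sup>2"
  proof -
    have "card \<Gamma> = (\<Sum>c\<in>U \<times> U. card (?X (fst c)) * card (?X (snd c)))"
      unfolding \<Gamma>_def using fin by (subst card_SigmaI) (auto simp: card_cartesian_product)
    then show ?thesis
      by (simp add: g power2_eq_square sum_product sum.cartesian_product case_prod_beta)
  qed
  have g0: "0 \<le> g" unfolding g by (simp add: sum_nonneg)
  have nz: "fst p \<noteq> 0 \<and> snd p \<noteq> 0" if "(c, p) \<in> \<Gamma>" for c p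
    using that A0 by (auto simp: \<Gamma>_def translates_def)
  have le_i: "card {p' \<in> ?X (fst c) \<times> ?X (snd c). fst p * snd p' = fst p' * snd p} \<le> i (ln (c, p))"
    if "(c, p) \<in> \<Gamma>" for c p
    unfolding i_def
  proof (rule card_inj_on_le[OF _ _ fV])
    let ?f = "\<lambda>p'. (fst p' - fst c, snd p' - snd c)"
    show "inj_on ?f {p' \<in> ?X (fst c) \<times> ?X (snd c). fst p * snd p' = fst p' * snd p}"
      by (auto simp: inj_on_def)
    show "?f ` {p' \<in> ?X (fst c) \<times> ?X (snd c). fst p * snd p' = fst p' * snd p} \<subseteq> {z \<in> V \<times> V. on_line (ln (c, p)) z}"
    proof (rule image_subsetI)
      fix q assume *: "q \<in> {p' \<in> ?X (fst c) \<times> ?X (snd c). fst p * snd p' = fst p' * snd p}"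
      then have "snd q = snd p / fst p * fst q" using nz[OF that] by (simp add: field_simps)
      then have "on_line (ln (c, p)) (?f q)"
        by (simp add: on_line_def ln_def right_diff_distrib)
      then show "?f q \<in> {z \<in> V \<times> V. on_line (ln (c, p)) z}"
        using * by (auto simp: translates_def)
    qed
  qed
  have i_pos: "1 \<le> i (ln \<gamma>)" if "\<gamma> \<in> \<Gamma>" for \<gamma>
  proof -
    obtain c p where cp: "\<gamma> = (c, p)" by (cases \<gamma>)
    have "p \<in> {p' \<in> ?X (fst c) \<times> ?X (snd c). fst p * snd p' = fst p' * snd p}"
      using that by (auto simp: cp \<Gamma>_def)
    moreover have "finite {p' \<in> ?X (fst c) \<times> ?X (snd c). fst p * snd p' = fst p' * snd p}"
      using fin by auto
    ultimately have "1 \<le> card {p' \<in> ?X (fst c) \<times> ?X (snd c). fst p * snd p' = fst p' * snd p}"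
      by (metis (no_types, lifting) One_nat_def Suc_leI card_gt_0_iff empty_iff)
    then show ?thesis using le_i that cp by fastforce
  qed
  have i_le: "i l < 2 ^ J" for l
  proof -
    have "i l \<le> card V" unfolding i_def
    proof (rule card_inj_on_le)
      show "inj_on fst {p \<in> V \<times> V. on_line l p}" by (rule inj_onI) (auto simp: on_line_def)
    qed (use fin in auto)
    then show ?thesis using J by simp
  qed
  obtain j where "j < J" and
    j: "(\<Sum>\<gamma>\<in>\<Gamma>. real (i (ln \<gamma>))) \<le> real J * (\<Sum>\<gamma>\<in>{\<gamma> \<in> \<Gamma>. 2 ^ j \<le> i (ln \<gamma>) \<and> i (ln \<gamma>) < 2 * 2 ^ j}. real (i (ln \<gamma>)))"
    using dyadic_pigeonhole[OF fG, of "\<lambda>\<gamma>. real (i (ln \<gamma>))" "\<lambda>\<gamma>. i (ln \<gamma>)" J] i_pos i_le J(2) by auto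
  \<comment> \<open>The common richness, up to a factor 2, of the lines that dominate the
    sum.\<close>
  define k :: nat where "k = 2 ^ j"
  define \<Delta> where "\<Delta> = {\<gamma> \<in> \<Gamma>. k \<le> i (ln \<gamma>) \<and> i (ln \<gamma>) < 2 * k}"
  define x where "x = (\<Sum>\<gamma>\<in>\<Delta>. real (i (ln \<gamma>)))"
  have k1: "1 \<le> k" by (simp add: k_def)
  have fD: "finite \<Delta>" using fG by (simp add: \<Delta>_def)
  have x_le: "x \<le> 2 * real k * card \<Delta>"
  proof -
    have "x \<le> (\<Sum>\<gamma>\<in>\<Delta>. 2 * real k)" unfolding x_def
      by (rule sum_mono) (auto simp: \<Delta>_def)
    then show ?thesis by (simp add: mult.commute)
  qed
  have "card \<Delta> \<le> card \<Gamma>" using fG by (intro card_mono) (auto simp: \<Delta>_def)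
  then have D_le: "real (card \<Delta>) \<le> g\<^sup>2" using cardG by (metis of_nat_le_iff)
  then have x1: "x \<le> 2 * real k * g\<^sup>2"
  proof -
    have "2 * real k * card \<Delta> \<le> 2 * real k * g\<^sup>2" using D_le by (intro mult_left_mono) auto
    with x_le show ?thesis by linarith
  qed
  \<comment> \<open>Poor lines are paid for by the trivial bound \<open>x1\<close>. For k >= 4 the
    rich lines of V x V are few, and they are tested for incidences against the second grid of the
    points -c.\<close>
  have x_bound: "x \<le> 8 * g\<^sup>2 + 186624 * u ^ 4 * v ^ 8 + 1224 * v ^ 6 * g"
  proof (cases "k < 4")
    case True
    then have "2 * real k * g\<^sup>2 \<le> 8 * g\<^sup>2" by (intro mult_right_mono) auto
    moreover have "0 \<le> 186624 * u ^ 4 * v ^ 8 + 1224 * v ^ 6 * g" using u v g0 by simp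
    ultimately show ?thesis using x1 by linarith
  next
    case False
    define L where "L = ln ` \<Delta>"
    define l where "l = root 3 (real (card L))"
    define W where "W = uminus ` U"
    have fL: "finite L" using fD by (simp add: L_def)
    have l: "0 \<le> l" "l ^ 3 = real (card L)" by (simp_all add: l_def)
    have Lnz: "fst m \<noteq> 0" if "m \<in> L" for m
      using that nz by (fastforce simp: L_def \<Delta>_def ln_def)
    have l_le: "l \<le> 36 * v ^ 4 / real k"
      by (rule rich_lines_le[OF fin(2) fL Lnz _ _ v l]) (use False in \<open>auto simp: L_def \<Delta>_def i_def\<close>)
    \<comment> \<open>A pair (c, p) in \<open>\<Delta>\<close> is determined by its line, the
      incidence of that line with -c, and the point p - c of V x V on it; the last has fewer than 2
      k choices.\<close>
    have "card \<Delta> \<le> 2 * k * incidences L (W \<times> W)"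
    proof -
      let ?I = "{(m, p). m \<in> L \<and> p \<in> W \<times> W \<and> on_line m p}"
      let ?h = "\<lambda>(c, p). (ln (c, p), (- fst c, - snd c))"
      have fI: "finite ?I" by (rule finite_subset[of _ "L \<times> (W \<times> W)"]) (use fL fin W_def in auto)
      have im: "?h ` \<Delta> \<subseteq> ?I"
        by (auto simp: L_def W_def \<Delta>_def \<Gamma>_def ln_def on_line_def)
      have "card \<Delta> = (\<Sum>y\<in>?h ` \<Delta>. fib ?h \<Delta> y)" by (rule card_eq_sum_fib[OF fD])
      also have "\<dots> \<le> (\<Sum>y\<in>?h ` \<Delta>. 2 * k)"
      proof (rule sum_mono)
        fix y assume "y \<in> ?h ` \<Delta>"
        then obtain c0 p0 where y: "y = ?h (c0, p0)" "(c0, p0) \<in> \<Delta>" by fastforce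
        have "fib ?h \<Delta> y \<le> i (fst y)"
          unfolding fib_def i_def
        proof (rule card_inj_on_le[OF _ _ fV])
          let ?f = "\<lambda>(c, p). (fst p - fst c, snd p - snd c)"
          show "inj_on ?f {p \<in> \<Delta>. ?h p = y}"
            unfolding y by (rule inj_onI) (auto simp: prod_eq_iff)
          show "?f ` {p \<in> \<Delta>. ?h p = y} \<subseteq> {p \<in> V \<times> V. on_line (fst y) p}"
          proof (rule image_subsetI)
            fix \<gamma> assume *: "\<gamma> \<in> {p \<in> \<Delta>. ?h p = y}"
            obtain c p where cp: "\<gamma> = (c, p)" by (cases \<gamma>)
            then have G: "(c, p) \<in> \<Gamma>" using * by (simp add: \<Delta>_def)
            then have "fst p \<noteq> 0" using nz by blast
            then have "on_line (ln (c, p)) (fst p - fst c, snd p - snd c)"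
              by (simp add: on_line_def ln_def field_simps)
            moreover have "fst y = ln (c, p)" using * cp by auto
            ultimately show "?f \<gamma> \<in> {z \<in> V \<times> V. on_line (fst y) z}"
              using G cp by (auto simp: \<Gamma>_def translates_def)
          qed
        qed
        also have "\<dots> \<le> 2 * k" using y by (auto simp: \<Delta>_def)
        finally show "fib ?h \<Delta> y \<le> 2 * k" .
      qed
      also have "\<dots> \<le> 2 * k * card ?I"
        using card_mono[OF fI im] by simp
      finally show ?thesis by (simp add: incidences_def)
    qed
    then have D_inc: "real (card \<Delta>) \<le> 2 * real k * real (incidences L (W \<times> W))"
      by (metis of_nat_le_iff of_nat_mult of_nat_numeral)
    have "real (incidences L (W \<times> W)) \<le> 18 * (u\<^sup>2 * l)\<^sup>2 + 2 * l ^ 3"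
    proof (rule incidences_le[OF _ _ fL Lnz _ _ l])
      have "card W = card U" unfolding W_def by (intro card_image) auto
      then show "(u\<^sup>2) ^ 3 = real (card W) * real (card W)"
        by (simp flip: u(2) power_mult power_add)
    qed (use fin W_def in auto)
    then have "2 * real k * real (incidences L (W \<times> W)) \<le> 2 * real k * (18 * (u\<^sup>2 * l)\<^sup>2 + 2 * l ^ 3)"
      by (intro mult_left_mono) auto
    with D_inc have "real (card \<Delta>) \<le> 2 * real k * (18 * (u\<^sup>2 * l)\<^sup>2 + 2 * l ^ 3)" by linarith
    then have "2 * real k * card \<Delta> \<le> 2 * real k * (2 * real k * (18 * (u\<^sup>2 * l)\<^sup>2 + 2 * l ^ 3))"
      by (intro mult_left_mono) auto
    with x_le have "x \<le> 2 * real k * (2 * real k * (18 * (u\<^sup>2 * l)\<^sup>2 + 2 * l ^ 3))" by linarith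
    also have "\<dots> \<le> 2 * real k * (2 * real k * (18 * (u\<^sup>2 * (36 * v ^ 4 / real k))\<^sup>2 + 2 * (36 * v ^ 4 / real k) ^ 3))"
      using l l_le u by (intro mult_left_mono add_mono power_mono) auto
    \<comment> \<open>Here 93312 = 4 * 18 * 36^2 and 373248 = 8 * 36^3. The latter is rounded up to
      the square 612^2, the shape that \<open>le_of_two_bounds\<close> expects.\<close>
    also have "\<dots> = 93312 * u ^ 4 * v ^ 8 + 373248 * v ^ 12 / real k"
      using k1 by (simp add: field_simps power2_eq_square power3_eq_cube) (simp add: eval_nat_numeral)
    also have "\<dots> \<le> 93312 * u ^ 4 * v ^ 8 + (612 * v ^ 6)\<^sup>2 / real k"
      using v k1 by (intro add_left_mono divide_right_mono) (auto simp: power_mult_distrib simp flip: power_mult)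
    finally have x2: "x \<le> 93312 * u ^ 4 * v ^ 8 + (612 * v ^ 6)\<^sup>2 / real k" .
    have "x \<le> 2 * (93312 * u ^ 4 * v ^ 8) + 2 * (612 * v ^ 6) * g"
      by (rule le_of_two_bounds[OF x1 x2]) (use k1 u v g0 in auto)
    moreover have "0 \<le> 8 * g\<^sup>2" by simp
    ultimately show ?thesis by linarith
  qed
  have "(\<Sum>(x, y)\<in>U \<times> U. real (cross_energy (?X x) (?X y)))
      = (\<Sum>c\<in>U \<times> U. \<Sum>p\<in>?X (fst c) \<times> ?X (snd c). real (card {p' \<in> ?X (fst c) \<times> ?X (snd c). fst p * snd p' = fst p' * snd p}))"
    using fin by (simp add: cross_energy_eq_sum case_prod_beta)
  also have "\<dots> = (\<Sum>(c, p)\<in>\<Gamma>. real (card {p' \<in> ?X (fst c) \<times> ?X (snd c). fst p * snd p' = fst p' * snd p}))"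
    unfolding \<Gamma>_def using fin by (intro sum.Sigma) auto
  also have "\<dots> \<le> (\<Sum>\<gamma>\<in>\<Gamma>. real (i (ln \<gamma>)))"
    by (rule sum_mono) (use le_i in auto)
  also have "\<dots> \<le> real J * x" using j by (simp add: x_def \<Delta>_def k_def)
  also have "\<dots> \<le> real J * (8 * g\<^sup>2 + 186624 * u ^ 4 * v ^ 8 + 1224 * v ^ 6 * g)"
    using x_bound by (intro mult_left_mono) auto
  finally show ?thesis .
qed

text \<open>Cauchy-Schwarz over the translates, squared, gives the sum of (|X||Y|)^2 over pairs of
  translates; the hypothesis on \<open>q\<close> turns each summand into an energy. All translates
  lie in \<open>A\<close>, so subsets of \<open>A\<close> suffice there.\<close>

lemma sum_cross_energy_ge:
  assumes fin: "finite U" "finite A"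
    and q: "\<And>X Y. X \<subseteq> A \<Longrightarrow> Y \<subseteq> A \<Longrightarrow> (real (card X) * real (card Y))\<^sup>2 \<le> q * real (cross_energy X Y)"
    and g: "g = (\<Sum>x\<in>U. real (card (translates A V x)))"
  shows "g ^ 4 \<le> (real (card U))\<^sup>2 * q * (\<Sum>(x, y)\<in>U \<times> U. real (cross_energy (translates A V x) (translates A V y)))"
proof -
  let ?X = "translates A V" and ?s = "\<Sum>x\<in>U. (real (card (translates A V x)))\<^sup>2"
  have "g\<^sup>2 \<le> real (card U) * ?s"
    using Cauchy_Schwarz_ineq_sum[of "\<lambda>_. 1" "\<lambda>x. real (card (?X x))" U] by (simp add: g)
  then have "(g\<^sup>2)\<^sup>2 \<le> (real (card U) * ?s)\<^sup>2" by (intro power_mono) auto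
  also have "\<dots> = (real (card U))\<^sup>2 * (\<Sum>(x, y)\<in>U \<times> U. (real (card (?X x)) * real (card (?X y)))\<^sup>2)"
    by (simp add: power_mult_distrib power2_eq_square[of ?s] sum_product sum.cartesian_product)
  also have "\<dots> \<le> (real (card U))\<^sup>2 * (\<Sum>(x, y)\<in>U \<times> U. q * real (cross_energy (?X x) (?X y)))"
    by (intro mult_left_mono sum_mono) (auto intro!: q simp: translates_def)
  also have "\<dots> = (real (card U))\<^sup>2 * q * (\<Sum>(x, y)\<in>U \<times> U. real (cross_energy (?X x) (?X y)))"
    by (simp add: sum_distrib_left case_prod_beta mult.assoc)
  finally show ?thesis by (simp flip: power_mult)
qed

section \<open>The third moment of the difference representation\<close>

text \<open>Differences are treated as sums with the negated set, so that one theory of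
  \<open>rep\<close> and \<open>energy\<close> covers both.\<close>

definition sums_set :: "real set \<Rightarrow> real set \<Rightarrow> real set" where
  "sums_set A B = (\<lambda>p. fst p + snd p) ` (A \<times> B)"

definition rep :: "real set \<Rightarrow> real set \<Rightarrow> real \<Rightarrow> nat" where
  "rep A B = fib (\<lambda>p. fst p + snd p) (A \<times> B)"

definition energy :: "real set \<Rightarrow> real set \<Rightarrow> real" where
  "energy A B = (\<Sum>z\<in>sums_set A B. (real (rep A B z))\<^sup>2)"

definition energy3 :: "real set \<Rightarrow> real" where
  "energy3 A = (\<Sum>z\<in>sums_set A (uminus ` A). (real (rep A (uminus ` A) z)) ^ 3)"

lemma finite_sums_set [simp]: "finite A \<Longrightarrow> finite B \<Longrightarrow> finite (sums_set A B)"
  by (simp add: sums_set_def)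

lemma card_uminus_image [simp]: "card (uminus ` (A :: real set)) = card A"
  by (intro card_image) auto

lemma mem_uminus_image: "(x :: real) \<in> uminus ` A \<longleftrightarrow> - x \<in> A"
proof
  assume "- x \<in> A"
  then have "- (- x) \<in> uminus ` A" by (rule imageI)
  then show "x \<in> uminus ` A" by simp
qed auto

lemma rep_pos: "finite A \<Longrightarrow> finite B \<Longrightarrow> z \<in> sums_set A B \<Longrightarrow> 1 \<le> rep A B z"
  unfolding rep_def sums_set_def by (intro fib_pos) auto

lemma rep_eq_card_left: "rep A B z = card {a \<in> A. z - a \<in> B}"
  unfolding rep_def fib_def
  by (rule bij_betw_same_card[of fst], rule bij_betwI[of _ _ _ "\<lambda>a. (a, z - a)"]) auto

lemma rep_le_left: "finite A \<Longrightarrow> rep A B z \<le> card A"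
  unfolding rep_eq_card_left by (intro card_mono) auto

lemma sum_rep:
  assumes "finite A" "finite B"
  shows "(\<Sum>z\<in>sums_set A B. rep A B z) = card A * card B"
  unfolding rep_def sums_set_def using card_eq_sum_fib[of "A \<times> B" "\<lambda>p. fst p + snd p"] assms
  by (simp add: card_cartesian_product)

text \<open>Dyadic pigeonholing of the e-th moment; 2^J only has to exceed |A|, because no sum has
  more than |A| representations.\<close>

lemma level_set:
  fixes e :: nat
  assumes fin: "finite A" "finite B" and J: "card A < 2 ^ J" "0 < J"
  obtains k Z where "1 \<le> k" "Z \<subseteq> sums_set A B"
    "\<And>z. z \<in> Z \<Longrightarrow> k \<le> rep A B z" "\<And>z. z \<in> Z \<Longrightarrow> rep A B z < 2 * k"
    "(\<Sum>z\<in>sums_set A B. real (rep A B z) ^ e) \<le> real J * (\<Sum>z\<in>Z. real (rep A B z) ^ e)"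
    "(\<Sum>z\<in>Z. real (rep A B z) ^ e) \<le> (2 * real k) ^ e * real (card Z)"
proof -
  have "rep A B z < 2 ^ J" for z using rep_le_left[OF fin(1), of B z] J by simp
  then obtain j where j: "(\<Sum>z\<in>sums_set A B. real (rep A B z) ^ e) \<le>
      real J * (\<Sum>z\<in>{z \<in> sums_set A B. 2 ^ j \<le> rep A B z \<and> rep A B z < 2 * 2 ^ j}. real (rep A B z) ^ e)"
    using dyadic_pigeonhole[OF finite_sums_set[OF fin], of "\<lambda>z. real (rep A B z) ^ e" "rep A B" J]
      rep_pos[OF fin] J(2) by (metis of_nat_0_le_iff zero_le_power)
  define Z where "Z = {z \<in> sums_set A B. 2 ^ j \<le> rep A B z \<and> rep A B z < 2 * 2 ^ j}"
  have "(\<Sum>z\<in>Z. real (rep A B z) ^ e) \<le> (\<Sum>z\<in>Z. (2 * real (2 ^ j)) ^ e)"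
  proof (intro sum_mono power_mono)
    fix z assume "z \<in> Z"
    then have "rep A B z \<le> 2 * 2 ^ j" by (simp add: Z_def)
    from of_nat_mono[OF this, where ?'a = real]
    show "real (rep A B z) \<le> 2 * real (2 ^ j)" by simp
  qed simp
  then have "(\<Sum>z\<in>Z. real (rep A B z) ^ e) \<le> (2 * real (2 ^ j)) ^ e * real (card Z)"
    by (simp add: mult.commute)
  then show thesis
    by (rule that[of "2 ^ j" Z, rotated -1]) (use j in \<open>auto simp: Z_def\<close>)
qed

text \<open>Here \<open>\<nu>\<close> and \<open>\<sigma>\<close> are the cube roots of \<open>|A|\<close> and of the size of a level set, which keeps the exponent
  \<open>2/3\<close> of the incidence bound polynomial.\<close>

lemma level_set_algebra:
  fixes \<nu> \<sigma> k g q J :: real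
  assumes pos: "0 < \<nu>" "0 < \<sigma>" "0 \<le> k" "0 \<le> q" "0 \<le> J"
    and g: "k * \<sigma> ^ 3 \<le> g" "g \<le> 2 * k * \<sigma> ^ 3" and k: "k \<le> \<nu> ^ 3" "k * \<sigma> ^ 3 \<le> \<nu> ^ 6"
    and big: "\<nu> \<le> \<sigma> \<Longrightarrow> g ^ 4 \<le> (\<nu> ^ 3)\<^sup>2 * q * (J * (8 * g\<^sup>2 + 186624 * \<nu> ^ 4 * \<sigma> ^ 8 + 1224 * \<sigma> ^ 6 * g))"
    and small: "\<sigma> \<le> \<nu> \<Longrightarrow> g ^ 4 \<le> (\<sigma> ^ 3)\<^sup>2 * q * (J * (8 * g\<^sup>2 + 186624 * \<sigma> ^ 4 * \<nu> ^ 8 + 1224 * \<nu> ^ 6 * g))"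
  shows "(k * \<sigma>) ^ 4 \<le> 189104 * J * q * \<nu> ^ 10"
proof -
  have g0: "0 \<le> g" using g pos by (smt (verit) mult_nonneg_nonneg zero_le_power)
  have gl: "(k * \<sigma>) ^ 4 * \<sigma> ^ 8 \<le> g ^ 4"
  proof -
    have "(k * \<sigma> ^ 3) ^ 4 \<le> g ^ 4" using g pos by (intro power_mono) auto
    then show ?thesis by (simp add: power_mult_distrib flip: power_mult power_add) (simp add: mult.assoc flip: power_add)
  qed
  have g2: "g\<^sup>2 \<le> 4 * k\<^sup>2 * \<sigma> ^ 6"
  proof -
    have "g\<^sup>2 \<le> (2 * k * \<sigma> ^ 3)\<^sup>2" using g g0 by (intro power_mono) auto
    then show ?thesis by (simp add: power_mult_distrib flip: power_mult)
  qed
  \<comment> \<open>Product of k^2 <= \<nu>^6 and k \<sigma>^3 <= \<nu>^6. It controls the terms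
    linear in g.\<close>
  have k\<sigma>: "k * \<sigma> \<le> \<nu> ^ 4"
  proof -
    have "k\<^sup>2 \<le> (\<nu> ^ 3)\<^sup>2" using k pos by (intro power_mono) auto
    then have "k\<^sup>2 * (k * \<sigma> ^ 3) \<le> (\<nu> ^ 3)\<^sup>2 * \<nu> ^ 6" using k pos by (intro mult_mono) auto
    moreover have "k\<^sup>2 * (k * \<sigma> ^ 3) = (k * \<sigma>) ^ 3" by (simp add: eval_nat_numeral)
    moreover have "(\<nu> ^ 3)\<^sup>2 * \<nu> ^ 6 = (\<nu> ^ 4) ^ 3" by (simp flip: power_mult power_add)
    ultimately have "(k * \<sigma>) ^ 3 \<le> (\<nu> ^ 4) ^ 3" by simp
    then show ?thesis using pos power_mono_iff[of "k * \<sigma>" "\<nu> ^ 4" 3] by simp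
  qed
  have k2: "k\<^sup>2 \<le> \<nu> ^ 6"
  proof -
    have "k\<^sup>2 \<le> (\<nu> ^ 3)\<^sup>2" using k pos by (intro power_mono) auto
    then show ?thesis by (simp flip: power_mult)
  qed
  \<comment> \<open>The parameters of the translates come from the smaller of the two sets, which
    makes the lower-order terms harmless. The constant is 32 + 2448 + 186624, one summand for each
    term of the bound.\<close>
  have "g ^ 4 \<le> (189104 * J * q * \<nu> ^ 10) * \<sigma> ^ 8"
  proof (cases "\<nu> \<le> \<sigma>")
    case True
    have 1: "8 * g\<^sup>2 \<le> 32 * \<nu> ^ 4 * \<sigma> ^ 8"
    proof -
      have "k\<^sup>2 * \<sigma> ^ 6 \<le> \<nu> ^ 6 * \<sigma> ^ 6" using k2 pos by (intro mult_right_mono) auto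
      also have "\<dots> = (\<nu> ^ 4 * \<sigma> ^ 6) * \<nu>\<^sup>2" by (simp flip: power_add)
      also have "\<dots> \<le> (\<nu> ^ 4 * \<sigma> ^ 6) * \<sigma>\<^sup>2" using True pos by (intro mult_left_mono power_mono) auto
      also have "\<dots> = \<nu> ^ 4 * \<sigma> ^ 8" by (simp add: mult.assoc flip: power_add)
      finally show ?thesis using g2 by linarith
    qed
    have 2: "1224 * \<sigma> ^ 6 * g \<le> 2448 * \<nu> ^ 4 * \<sigma> ^ 8"
    proof -
      have "\<sigma> ^ 6 * g \<le> \<sigma> ^ 6 * (2 * k * \<sigma> ^ 3)" using g pos by (intro mult_left_mono) auto
      also have "\<dots> = 2 * (k * \<sigma>) * \<sigma> ^ 8" by (simp add: eval_nat_numeral)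
      also have "\<dots> \<le> 2 * \<nu> ^ 4 * \<sigma> ^ 8" using k\<sigma> pos by (intro mult_right_mono) auto
      finally show ?thesis by (simp add: mult_ac)
    qed
    have "8 * g\<^sup>2 + 186624 * \<nu> ^ 4 * \<sigma> ^ 8 + 1224 * \<sigma> ^ 6 * g \<le> 189104 * \<nu> ^ 4 * \<sigma> ^ 8"
      using 1 2 by linarith
    then have "(\<nu> ^ 3)\<^sup>2 * q * (J * (8 * g\<^sup>2 + 186624 * \<nu> ^ 4 * \<sigma> ^ 8 + 1224 * \<sigma> ^ 6 * g)) \<le> (\<nu> ^ 3)\<^sup>2 * q * (J * (189104 * \<nu> ^ 4 * \<sigma> ^ 8))"
      using pos by (intro mult_left_mono) auto
    also have "\<dots> = (189104 * J * q * \<nu> ^ 10) * \<sigma> ^ 8"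
      by (simp add: eval_nat_numeral)
    finally show ?thesis using big[OF True] by linarith
  next
    case False
    then have le: "\<sigma> \<le> \<nu>" by simp
    have 1: "8 * g\<^sup>2 \<le> 32 * \<nu> ^ 10 * \<sigma>\<^sup>2"
    proof -
      have "k\<^sup>2 * \<sigma> ^ 6 \<le> \<nu> ^ 6 * \<sigma> ^ 6" using k2 pos by (intro mult_right_mono) auto
      also have "\<dots> = (\<nu> ^ 6 * \<sigma>\<^sup>2) * \<sigma> ^ 4" by (simp add: mult.assoc flip: power_add)
      also have "\<dots> \<le> (\<nu> ^ 6 * \<sigma>\<^sup>2) * \<nu> ^ 4" using le pos by (intro mult_left_mono power_mono) auto
      also have "\<dots> = \<nu> ^ 10 * \<sigma>\<^sup>2" by (simp add: eval_nat_numeral)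
      finally show ?thesis using g2 by linarith
    qed
    have 2: "1224 * \<nu> ^ 6 * g \<le> 2448 * \<nu> ^ 10 * \<sigma>\<^sup>2"
    proof -
      have "\<nu> ^ 6 * g \<le> \<nu> ^ 6 * (2 * k * \<sigma> ^ 3)" using g pos by (intro mult_left_mono) auto
      also have "\<dots> = 2 * \<nu> ^ 6 * (k * \<sigma>) * \<sigma>\<^sup>2" by (simp add: eval_nat_numeral)
      also have "\<dots> \<le> 2 * \<nu> ^ 6 * \<nu> ^ 4 * \<sigma>\<^sup>2" using k\<sigma> pos by (intro mult_right_mono mult_left_mono) auto
      also have "\<dots> = 2 * \<nu> ^ 10 * \<sigma>\<^sup>2" by (simp add: eval_nat_numeral)
      finally show ?thesis by (simp add: mult_ac)
    qed
    have 3: "186624 * \<sigma> ^ 4 * \<nu> ^ 8 \<le> 186624 * \<nu> ^ 10 * \<sigma>\<^sup>2"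
    proof -
      have "\<sigma> ^ 4 * \<nu> ^ 8 = \<sigma>\<^sup>2 * (\<sigma>\<^sup>2 * \<nu> ^ 8)" by (simp add: mult.assoc[symmetric] flip: power_add)
      also have "\<dots> \<le> \<sigma>\<^sup>2 * (\<nu>\<^sup>2 * \<nu> ^ 8)" using le pos by (intro mult_left_mono mult_right_mono power_mono) auto
      also have "\<dots> = \<nu> ^ 10 * \<sigma>\<^sup>2" by (simp flip: power_add)
      finally show ?thesis by (simp add: mult_ac)
    qed
    have "8 * g\<^sup>2 + 186624 * \<sigma> ^ 4 * \<nu> ^ 8 + 1224 * \<nu> ^ 6 * g \<le> 189104 * \<nu> ^ 10 * \<sigma>\<^sup>2"
      using 1 2 3 by linarith
    then have "(\<sigma> ^ 3)\<^sup>2 * q * (J * (8 * g\<^sup>2 + 186624 * \<sigma> ^ 4 * \<nu> ^ 8 + 1224 * \<nu> ^ 6 * g)) \<le> (\<sigma> ^ 3)\<^sup>2 * q * (J * (189104 * \<nu> ^ 10 * \<sigma>\<^sup>2))"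
      using pos by (intro mult_left_mono) auto
    also have "\<dots> = (189104 * J * q * \<nu> ^ 10) * \<sigma> ^ 8"
      by (simp add: eval_nat_numeral)
    finally show ?thesis using small[OF le] by linarith
  qed
  with gl have "(k * \<sigma>) ^ 4 * \<sigma> ^ 8 \<le> (189104 * J * q * \<nu> ^ 10) * \<sigma> ^ 8" by linarith
  then show ?thesis using pos by simp
qed

text \<open>The number \<open>q\<close> may be the size of the product set or of the quotient set;
  only the energy inequality is used. \<open>J\<close> has to accommodate n^2, since the level set S
  can be that large and takes the role of \<open>V\<close> in the collinearity bound.\<close>

lemma energy3_le:
  assumes A: "finite A" "A \<noteq> {}" "0 \<notin> A" and J: "(card A)\<^sup>2 < 2 ^ J" "0 < J"
    and q: "\<And>X Y. X \<subseteq> A \<Longrightarrow> Y \<subseteq> A \<Longrightarrow> (real (card X) * real (card Y))\<^sup>2 \<le> q * real (cross_energy X Y)"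
    and q0: "0 \<le> q"
  shows "energy3 A ^ 4 \<le> 4096 * 189104 ^ 3 * real J ^ 7 * q ^ 3 * real (card A) ^ 10"
proof -
  let ?N = "uminus ` A" and ?n = "real (card A)"
  have fin: "finite A" "finite ?N" using A by auto
  have "card A \<le> (card A)\<^sup>2" by (simp add: power2_nat_le_imp_le)
  then have "card A < 2 ^ J" using J by simp
  from level_set[OF fin this J(2), of 3] obtain k S where k: "1 \<le> k" and S: "S \<subseteq> sums_set A ?N"
    and Sk: "\<And>z. z \<in> S \<Longrightarrow> k \<le> rep A ?N z" "\<And>z. z \<in> S \<Longrightarrow> rep A ?N z < 2 * k"
    and E: "energy3 A \<le> real J * (\<Sum>z\<in>S. real (rep A ?N z) ^ 3)"
       "(\<Sum>z\<in>S. real (rep A ?N z) ^ 3) \<le> (2 * real k) ^ 3 * real (card S)"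
    unfolding energy3_def by blast
  have fS: "finite S" using S fin by (meson finite_subset finite_sums_set)
  have E3: "energy3 A \<le> 8 * real J * (real k ^ 3 * real (card S))"
  proof -
    have "real J * (\<Sum>z\<in>S. real (rep A ?N z) ^ 3) \<le> real J * ((2 * real k) ^ 3 * real (card S))"
      using E(2) by (intro mult_left_mono) auto
    then show ?thesis using E(1) by (simp add: power_mult_distrib)
  qed
  have E0: "0 \<le> energy3 A" by (simp add: energy3_def sum_nonneg)
  have rep_eq: "rep A ?N s = card (translates A A s)" for s
    unfolding rep_eq_card_left translates_def
    by (rule arg_cong[where f = card]) (simp add: mem_uminus_image)
  define \<nu> where "\<nu> = root 3 ?n"
  define \<sigma> where "\<sigma> = root 3 (real (card S))"
  define g where "g = (\<Sum>s\<in>S. real (card (translates A A s)))"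
  have \<nu>: "0 < \<nu>" "\<nu> ^ 3 = ?n" using A by (simp_all add: \<nu>_def card_gt_0_iff)
  have \<sigma>: "0 \<le> \<sigma>" "\<sigma> ^ 3 = real (card S)" by (simp_all add: \<sigma>_def)
  \<comment> \<open>Double counting of the pairs (s, b) with s + b in \<open>A\<close>: the same g
    belongs to translates indexed by S and to translates indexed by \<open>A\<close>, so both cases
    of \<open>level_set_algebra\<close> apply to it.\<close>
  have g': "g = (\<Sum>a\<in>A. real (card (translates A S a)))"
  proof -
    have "g = (\<Sum>s\<in>S. \<Sum>a\<in>A. if a - s \<in> A then 1 else 0)"
      using A by (simp add: g_def translates_def sum.inter_filter[symmetric])
    also have "\<dots> = real (card (SIGMA s:S. {a \<in> A. a - s \<in> A}))"
      using A fS by (simp add: sum.inter_filter[symmetric])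
    also have "card (SIGMA s:S. {a \<in> A. a - s \<in> A}) = card (SIGMA a:A. translates A S a)"
      by (rule bij_betw_same_card[of "\<lambda>(s, a). (a - s, a)"], rule bij_betwI[of _ _ _ "\<lambda>(a, b). (b - a, b)"])
        (auto simp: translates_def)
    finally show ?thesis using A by simp
  qed
  show ?thesis
  proof (cases "S = {}")
    case True
    then show ?thesis using E3 E0 q0 by simp
  next
    case False
    then have \<sigma>0: "0 < \<sigma>" using fS by (simp add: \<sigma>_def card_gt_0_iff)
    have g1: "real k * \<sigma> ^ 3 \<le> g"
    proof -
      have "(\<Sum>s\<in>S. real k) \<le> g" unfolding g_def rep_eq[symmetric]
        by (rule sum_mono) (use Sk in auto)
      then show ?thesis by (simp add: \<sigma> mult.commute)
    qed
    have g2: "g \<le> 2 * real k * \<sigma> ^ 3"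
    proof -
      have "g \<le> (\<Sum>s\<in>S. 2 * real k)" unfolding g_def rep_eq[symmetric]
      proof (rule sum_mono)
        fix s assume "s \<in> S"
        then have "rep A ?N s \<le> 2 * k" using Sk(2) by (meson less_imp_le)
        from of_nat_mono[OF this, where ?'a = real] show "real (rep A ?N s) \<le> 2 * real k" by simp
      qed
      then show ?thesis by (simp add: \<sigma> mult.commute)
    qed
    have gn: "g \<le> \<nu> ^ 6"
    proof -
      have "g \<le> (\<Sum>z\<in>sums_set A ?N. real (rep A ?N z))" unfolding g_def rep_eq[symmetric]
        using S fin by (intro sum_mono2) auto
      also have "\<dots> = ?n * ?n" using sum_rep[OF fin] by (simp flip: of_nat_sum)
      finally show ?thesis by (simp flip: \<nu>(2) power_add)
    qed
    have kn: "real k \<le> \<nu> ^ 3"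
    proof -
      obtain s where "s \<in> S" using False by blast
      then have "k \<le> card A" using Sk(1) rep_le_left[OF fin(1)] by (meson le_trans)
      then show ?thesis by (simp add: \<nu>)
    qed
    have cS: "card S \<le> (card A)\<^sup>2"
    proof -
      have "card S \<le> card (sums_set A ?N)" using S fin by (intro card_mono) auto
      also have "\<dots> \<le> card (A \<times> ?N)" unfolding sums_set_def using fin by (intro card_image_le) auto
      finally show ?thesis by (simp add: card_cartesian_product power2_eq_square)
    qed
    have "(real k * \<sigma>) ^ 4 \<le> 189104 * real J * q * \<nu> ^ 10"
    proof (rule level_set_algebra[OF \<nu>(1) \<sigma>0 _ q0 _ g1 g2 kn])
      show "real k * \<sigma> ^ 3 \<le> \<nu> ^ 6" using g1 gn by linarith
      have "g ^ 4 \<le> (real (card A))\<^sup>2 * q * (\<Sum>(x, y)\<in>A \<times> A. real (cross_energy (translates A S x) (translates A S y)))"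
        by (rule sum_cross_energy_ge[OF A(1) A(1) q g'])
      also have "\<dots> \<le> (real (card A))\<^sup>2 * q * (real J * (8 * g\<^sup>2 + 186624 * \<nu> ^ 4 * \<sigma> ^ 8 + 1224 * \<sigma> ^ 6 * g))"
        using A fS J cS \<nu> \<sigma> g' q0
        by (intro mult_left_mono sum_cross_energy_le) auto
      finally show "g ^ 4 \<le> (\<nu> ^ 3)\<^sup>2 * q * (real J * (8 * g\<^sup>2 + 186624 * \<nu> ^ 4 * \<sigma> ^ 8 + 1224 * \<sigma> ^ 6 * g))"
        by (simp only: \<nu>)
      have "g ^ 4 \<le> (real (card S))\<^sup>2 * q * (\<Sum>(x, y)\<in>S \<times> S. real (cross_energy (translates A A x) (translates A A y)))"
        by (rule sum_cross_energy_ge[OF fS A(1) q g_def])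
      also have "\<dots> \<le> (real (card S))\<^sup>2 * q * (real J * (8 * g\<^sup>2 + 186624 * \<sigma> ^ 4 * \<nu> ^ 8 + 1224 * \<nu> ^ 6 * g))"
        using A fS J \<nu> \<sigma> g_def q0 \<open>card A < 2 ^ J\<close>
        by (intro mult_left_mono sum_cross_energy_le) auto
      finally show "g ^ 4 \<le> (\<sigma> ^ 3)\<^sup>2 * q * (real J * (8 * g\<^sup>2 + 186624 * \<sigma> ^ 4 * \<nu> ^ 8 + 1224 * \<nu> ^ 6 * g))"
        by (simp only: \<sigma>)
    qed auto
    \<comment> \<open>The third moment is about (k \<sigma>)^3 while the bound concerns (k
      \<sigma>)^4, hence the cube here and the fourth power of \<open>energy3\<close> in the
      statement.\<close>
    then have "((real k * \<sigma>) ^ 4) ^ 3 \<le> (189104 * real J * q * \<nu> ^ 10) ^ 3"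
      using \<sigma> by (intro power_mono) auto
    then have le: "(real k ^ 3 * \<sigma> ^ 3) ^ 4 \<le> 189104 ^ 3 * real J ^ 3 * q ^ 3 * (\<nu> ^ 3) ^ 10"
      by (simp add: power_mult_distrib flip: power_mult)
    have "energy3 A ^ 4 \<le> (8 * real J * (real k ^ 3 * \<sigma> ^ 3)) ^ 4"
      using E3 E0 by (intro power_mono) (auto simp: \<sigma>)
    also have "\<dots> = 4096 * real J ^ 4 * (real k ^ 3 * \<sigma> ^ 3) ^ 4"
      by (simp add: power_mult_distrib)
    also have "\<dots> \<le> 4096 * real J ^ 4 * (189104 ^ 3 * real J ^ 3 * q ^ 3 * (\<nu> ^ 3) ^ 10)"
      using le by (intro mult_left_mono) auto
    also have "\<dots> = 4096 * 189104 ^ 3 * (real J ^ 4 * real J ^ 3) * q ^ 3 * (\<nu> ^ 3) ^ 10"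
      by simp
    also have "\<dots> = 4096 * 189104 ^ 3 * real J ^ 7 * q ^ 3 * ?n ^ 10"
      by (simp add: \<nu>(2) flip: power_add)
    finally show ?thesis .
  qed
qed

section \<open>Multiplicatively spread out sets\<close>

text \<open>An incidence bound for the sums of \<open>C\<close> with arbitrary sets. For h = 1 and
  \<kappa> >= 1 it is trivial; for h^3 = |C| it reads |C|^(1/3) (|Y||W|)^(2/3) + |W| up to \<kappa>.
  It is applied to logarithms, where c + w in Y is a multiplicative relation.\<close>

definition spread :: "real \<Rightarrow> real \<Rightarrow> real set \<Rightarrow> bool" where
  "spread \<kappa> h C \<longleftrightarrow> (\<forall>Y W. finite Y \<longrightarrow> finite W \<longrightarrow>
     real (card {p \<in> C \<times> W. fst p + snd p \<in> Y})
       \<le> \<kappa> * real (card C) * ((root 3 (real (card Y) * real (card W)))\<^sup>2 / h\<^sup>2 + real (card W) / h ^ 3))"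

lemma spread_empty: "spread \<kappa> h {}"
  by (simp add: spread_def)

text \<open>The right-hand side depends on the set only through a factor |C|, so the two bounds add
  up without loss in \<open>\<kappa>\<close> or \<open>h\<close>.\<close>

lemma spread_Un:
  assumes "spread \<kappa> h B" "spread \<kappa> h C" "finite B" "finite C" "B \<inter> C = {}"
  shows "spread \<kappa> h (B \<union> C)"
  unfolding spread_def
proof (intro allI impI)
  fix Y W :: "real set" assume fin: "finite Y" "finite W"
  let ?R = "(root 3 (real (card Y) * real (card W)))\<^sup>2 / h\<^sup>2 + real (card W) / h ^ 3"
  let ?P = "\<lambda>C. {p \<in> C \<times> W. fst p + snd p \<in> Y}"
  have "?P (B \<union> C) = ?P B \<union> ?P C" by auto
  then have "card (?P (B \<union> C)) \<le> card (?P B) + card (?P C)" by (simp only: card_Un_le)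
  then have "real (card (?P (B \<union> C))) \<le> real (card (?P B)) + real (card (?P C))" by linarith
  also have "\<dots> \<le> \<kappa> * real (card B) * ?R + \<kappa> * real (card C) * ?R"
    using assms(1,2) fin by (intro add_mono) (simp_all add: spread_def)
  also have "\<dots> = \<kappa> * real (card (B \<union> C)) * ?R"
    unfolding card_Un_disjoint[OF assms(3-5)] of_nat_add by (simp only: distrib_left distrib_right)
  finally show "real (card (?P (B \<union> C))) \<le> \<kappa> * real (card (B \<union> C)) * ?R" .
qed

lemma sum_rep_eq_card:
  assumes "finite C" "finite W" "finite Y"
  shows "(\<Sum>y\<in>Y. rep C W y) = card {p \<in> C \<times> W. fst p + snd p \<in> Y}"
proof -
  have "{p \<in> C \<times> W. fst p + snd p \<in> Y} = (\<Union>y\<in>Y. {p \<in> C \<times> W. fst p + snd p = y})" by auto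
  then have "card {p \<in> C \<times> W. fst p + snd p \<in> Y} = card (\<Union>y\<in>Y. {p \<in> C \<times> W. fst p + snd p = y})" by simp
  also have "\<dots> = (\<Sum>y\<in>Y. card {p \<in> C \<times> W. fst p + snd p = y})"
    using assms by (intro card_UN_disjoint) auto
  finally show ?thesis by (simp add: rep_def fib_def)
qed

text \<open>The defining inequality is applied with Y = Z. The alternatives correspond to the
  dominating term: the first gives level sets decaying like k^(-3), the second is the degenerate
  case.\<close>

lemma spread_level_set:
  assumes sp: "spread \<kappa> h C" and \<kappa>: "1 \<le> \<kappa>" and h: "0 < h" and fin: "finite C" "finite W"
    and Z: "Z \<subseteq> sums_set C W" "\<And>z. z \<in> Z \<Longrightarrow> k \<le> rep C W z"
  shows "real k ^ 3 * real (card Z) \<le> 8 * \<kappa> ^ 3 * real (card C) ^ 3 * real (card W) ^ 2 / h ^ 6 \<or>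
     real k * real (card Z) \<le> 2 * \<kappa> * real (card C) * real (card W) / h ^ 3"
proof (cases "Z = {}")
  case True
  then show ?thesis using \<kappa> h by simp
next
  case False
  have fZ: "finite Z" using Z fin by (meson finite_subset finite_sums_set)
  define \<rho> where "\<rho> = root 3 (real (card Z) * real (card W))"
  let ?m = "real (card C)"
  have \<rho>: "0 \<le> \<rho>" "\<rho> ^ 3 = real (card Z) * real (card W)" by (simp_all add: \<rho>_def)
  have "card Z * k \<le> (\<Sum>z\<in>Z. rep C W z)" using sum_bounded_below[of Z k "rep C W"] Z by simp
  then have "real (card Z * k) \<le> real (\<Sum>z\<in>Z. rep C W z)" by (rule of_nat_mono)
  also have "\<dots> \<le> \<kappa> * ?m * (\<rho>\<^sup>2 / h\<^sup>2 + real (card W) / h ^ 3)"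
    using sp fin fZ by (simp only: sum_rep_eq_card spread_def \<rho>_def)
  finally have le: "real k * real (card Z) \<le> \<kappa> * ?m * (\<rho>\<^sup>2 / h\<^sup>2 + real (card W) / h ^ 3)"
    by (simp add: mult.commute)
  define x where "x = \<kappa> * ?m * (\<rho>\<^sup>2 / h\<^sup>2)"
  define y where "y = \<kappa> * ?m * (real (card W) / h ^ 3)"
  have xy: "real k * real (card Z) \<le> x + y" using le by (simp only: x_def y_def distrib_left)
  show ?thesis
  proof (cases "x \<le> y")
    case True
    then have "real k * real (card Z) \<le> 2 * y" using xy by linarith
    then show ?thesis by (simp add: y_def mult.assoc)
  next
    case False
    then have "real k * real (card Z) \<le> 2 * x" using xy by linarith
    then have "(real k * real (card Z)) ^ 3 \<le> (2 * (\<kappa> * ?m * (\<rho>\<^sup>2 / h\<^sup>2))) ^ 3"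
      unfolding x_def by (intro power_mono) auto
    also have "\<dots> = 8 * \<kappa> ^ 3 * ?m ^ 3 * (\<rho> ^ 3)\<^sup>2 / h ^ 6"
      by (simp add: power_mult_distrib power_divide flip: power_mult)
    also have "\<dots> = (8 * \<kappa> ^ 3 * ?m ^ 3 * real (card W) ^ 2 / h ^ 6) * real (card Z) ^ 2"
      by (simp add: \<rho>(2) power_mult_distrib)
    also have "(real k * real (card Z)) ^ 3 = (real k ^ 3 * real (card Z)) * real (card Z) ^ 2"
      by (simp add: eval_nat_numeral)
    finally have "(real k ^ 3 * real (card Z)) * real (card Z) ^ 2
        \<le> (8 * \<kappa> ^ 3 * ?m ^ 3 * real (card W) ^ 2 / h ^ 6) * real (card Z) ^ 2" .
    moreover have "0 < real (card Z) ^ 2" using \<open>Z \<noteq> {}\<close> fZ by (simp add: card_gt_0_iff)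
    ultimately show ?thesis by (meson mult_right_le_imp_le)
  qed
qed

text \<open>Cubic decay of level sets bounds every level of the third moment equally. In the
  degenerate alternative h^3 <= |C| and k <= |C| give the same bound.\<close>

lemma spread_energy3:
  assumes sp: "spread \<kappa> h C" and \<kappa>: "1 \<le> \<kappa>" and h: "0 < h" "h ^ 3 \<le> real (card C)" and fin: "finite C"
    and J: "card C < 2 ^ J" "0 < J"
  shows "energy3 C \<le> 64 * real J * \<kappa> ^ 3 * real (card C) ^ 5 / h ^ 6"
proof -
  let ?N = "uminus ` C" and ?m = "real (card C)"
  have fN: "finite ?N" using fin by simp
  from level_set[OF fin fN J, of 3] obtain k Z where k: "1 \<le> k"
    and Z: "Z \<subseteq> sums_set C ?N" "\<And>z. z \<in> Z \<Longrightarrow> k \<le> rep C ?N z" and Zk: "\<And>z. z \<in> Z \<Longrightarrow> rep C ?N z < 2 * k"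
    and E: "energy3 C \<le> real J * (\<Sum>z\<in>Z. real (rep C ?N z) ^ 3)"
       "(\<Sum>z\<in>Z. real (rep C ?N z) ^ 3) \<le> (2 * real k) ^ 3 * real (card Z)"
    unfolding energy3_def by blast
  have b: "real k ^ 3 * real (card Z) \<le> 8 * \<kappa> ^ 3 * ?m ^ 5 / h ^ 6"
  proof (cases "Z = {}")
    case True
    then show ?thesis using \<kappa> h by simp
  next
    case False
    then have "k \<le> card C" using Z(2) rep_le_left[OF fin] by (meson ex_in_conv le_trans)
    then have km: "real k \<le> ?m" by simp
    from spread_level_set[OF sp \<kappa> h(1) fin fN Z] show ?thesis
    proof
      assume "real k ^ 3 * real (card Z) \<le> 8 * \<kappa> ^ 3 * ?m ^ 3 * real (card ?N) ^ 2 / h ^ 6"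
      moreover have "8 * \<kappa> ^ 3 * ?m ^ 3 * ?m ^ 2 = 8 * \<kappa> ^ 3 * ?m ^ 5" by (simp add: mult.assoc flip: power_add)
      ultimately show ?thesis unfolding card_uminus_image by simp
    next
      assume le: "real k * real (card Z) \<le> 2 * \<kappa> * ?m * real (card ?N) / h ^ 3"
      have "real k ^ 3 * real (card Z) = real k ^ 2 * (real k * real (card Z))" by (simp add: power2_eq_square power3_eq_cube)
      also have "\<dots> \<le> ?m ^ 2 * (2 * \<kappa> * ?m * real (card ?N) / h ^ 3)"
        using le km by (intro mult_mono power_mono) auto
      also have "\<dots> = 2 * \<kappa> * (?m ^ 4 * h ^ 3) / h ^ 6"
        using h(1) by (simp add: field_simps) (simp add: eval_nat_numeral)
      also have "\<dots> \<le> 8 * \<kappa> ^ 3 * (?m ^ 4 * ?m) / h ^ 6"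
      proof -
        have "\<kappa> ^ 1 \<le> \<kappa> ^ 3" using \<kappa> by (intro power_increasing) auto
        then have "2 * \<kappa> \<le> 8 * \<kappa> ^ 3" using \<kappa> by simp
        then have "2 * \<kappa> * (?m ^ 4 * h ^ 3) \<le> 8 * \<kappa> ^ 3 * (?m ^ 4 * ?m)"
          using h \<kappa> by (intro mult_mono[OF _ mult_left_mono]) auto
        then show ?thesis using h by (intro divide_right_mono) auto
      qed
      finally show ?thesis by (simp add: eval_nat_numeral mult.assoc)
    qed
  qed
  have "energy3 C \<le> real J * ((2 * real k) ^ 3 * real (card Z))"
    using E mult_left_mono[OF E(2), of "real J"] by linarith
  also have "\<dots> = 8 * real J * (real k ^ 3 * real (card Z))" by (simp add: power_mult_distrib)
  also have "\<dots> \<le> 8 * real J * (8 * \<kappa> ^ 3 * ?m ^ 5 / h ^ 6)" using b by (intro mult_left_mono) auto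
  finally show ?thesis by (simp add: mult.assoc)
qed

text \<open>The second moment of a level is the geometric mean of k^3 |Z| and k |Z|. The first is
  bounded by spreading, the second by |C||W|; this is why the energy appears squared.\<close>

lemma spread_energy:
  assumes sp: "spread \<kappa> h C" and \<kappa>: "1 \<le> \<kappa>" and h: "0 < h" and fin: "finite C" "finite W"
    and J: "card C < 2 ^ J" "0 < J"
  shows "(energy C W)\<^sup>2 \<le> 128 * real J ^ 2 * \<kappa> ^ 3 * real (card C) ^ 4 / h ^ 6 * real (card W) ^ 3"
proof -
  let ?m = "real (card C)" and ?w = "real (card W)"
  from level_set[OF fin J, of 2] obtain k Z where k: "1 \<le> k"
    and Z: "Z \<subseteq> sums_set C W" "\<And>z. z \<in> Z \<Longrightarrow> k \<le> rep C W z" and Zk: "\<And>z. z \<in> Z \<Longrightarrow> rep C W z < 2 * k"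
    and E: "energy C W \<le> real J * (\<Sum>z\<in>Z. real (rep C W z) ^ 2)"
       "(\<Sum>z\<in>Z. real (rep C W z) ^ 2) \<le> (2 * real k) ^ 2 * real (card Z)"
    unfolding energy_def by blast
  have fZ: "finite Z" using Z fin by (meson finite_subset finite_sums_set)
  have b: "(real k ^ 2 * real (card Z))\<^sup>2 \<le> 8 * \<kappa> ^ 3 * ?m ^ 4 * ?w ^ 3 / h ^ 6"
  proof (cases "Z = {}")
    case True
    then show ?thesis using \<kappa> h by simp
  next
    case False
    then have "k \<le> card C" using Z(2) rep_le_left[OF fin(1)] by (meson ex_in_conv le_trans)
    then have km: "real k \<le> ?m" by simp
    have "W \<noteq> {}" using False Z(1) by (auto simp: sums_set_def)
    then have w1: "1 \<le> ?w" using fin by (simp add: Suc_le_eq card_gt_0_iff)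
    have "card Z * k \<le> (\<Sum>z\<in>Z. rep C W z)" using sum_bounded_below[of Z k "rep C W"] Z by simp
    also have "\<dots> \<le> (\<Sum>z\<in>sums_set C W. rep C W z)" using Z fin by (intro sum_mono2) auto
    also have "\<dots> = card C * card W" by (rule sum_rep[OF fin])
    finally have "real (card Z * k) \<le> real (card C * card W)" by (rule of_nat_mono)
    then have kZ: "real k * real (card Z) \<le> ?m * ?w" by (simp add: mult.commute)
    from spread_level_set[OF sp \<kappa> h(1) fin Z] show ?thesis
    proof
      assume le: "real k ^ 3 * real (card Z) \<le> 8 * \<kappa> ^ 3 * ?m ^ 3 * ?w ^ 2 / h ^ 6"
      have "(real k ^ 3 * real (card Z)) * (real k * real (card Z)) \<le> (8 * \<kappa> ^ 3 * ?m ^ 3 * ?w ^ 2 / h ^ 6) * (?m * ?w)"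
        by (rule mult_mono[OF le kZ]) (use \<kappa> h in auto)
      then show ?thesis by (simp add: eval_nat_numeral mult_ac)
    next
      assume le: "real k * real (card Z) \<le> 2 * \<kappa> * ?m * ?w / h ^ 3"
      have "(real k ^ 2 * real (card Z))\<^sup>2 = (real k)\<^sup>2 * (real k * real (card Z))\<^sup>2"
        by (simp add: power_mult_distrib power2_eq_square)
      also have "\<dots> \<le> ?m\<^sup>2 * (2 * \<kappa> * ?m * ?w / h ^ 3)\<^sup>2"
        using le km by (intro mult_mono power_mono) auto
      also have "\<dots> = 4 * \<kappa>\<^sup>2 * ?m ^ 4 * ?w ^ 2 / h ^ 6"
        by (simp add: power_divide power_mult_distrib mult_ac flip: power_mult)
      also have "\<dots> \<le> 8 * \<kappa> ^ 3 * ?m ^ 4 * ?w ^ 3 / h ^ 6"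
      proof -
        have "\<kappa>\<^sup>2 \<le> \<kappa> ^ 3" using \<kappa> by (intro power_increasing) auto
        moreover have "0 \<le> \<kappa>\<^sup>2" by simp
        ultimately have "4 * \<kappa>\<^sup>2 \<le> 8 * \<kappa> ^ 3" by linarith
        moreover have "?w ^ 2 \<le> ?w ^ 3" using w1 by (intro power_increasing) auto
        ultimately have "4 * \<kappa>\<^sup>2 * ?m ^ 4 * ?w ^ 2 \<le> 8 * \<kappa> ^ 3 * ?m ^ 4 * ?w ^ 3"
          using \<kappa> by (intro mult_mono[OF mult_right_mono]) auto
        then show ?thesis using h by (intro divide_right_mono) auto
      qed
      finally show ?thesis .
    qed
  qed
  have E0: "0 \<le> energy C W" by (simp add: energy_def sum_nonneg)
  have "energy C W \<le> real J * ((2 * real k) ^ 2 * real (card Z))"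
    using E mult_left_mono[OF E(2), of "real J"] by linarith
  then have "(energy C W)\<^sup>2 \<le> (real J * ((2 * real k) ^ 2 * real (card Z)))\<^sup>2" using E0 by (intro power_mono) auto
  also have "\<dots> = 16 * real J ^ 2 * (real k ^ 2 * real (card Z))\<^sup>2" by (simp add: power_mult_distrib)
  also have "\<dots> \<le> 16 * real J ^ 2 * (8 * \<kappa> ^ 3 * ?m ^ 4 * ?w ^ 3 / h ^ 6)" using b by (intro mult_left_mono) auto
  finally show ?thesis by (simp add: mult.assoc)
qed

text \<open>Elements of \<open>A'\<close> are differences \<open>z - x\<close> in many ways, with \<open>z\<close> in a level set and \<open>x \<in> \<Delta>\<close>.
  The equation \<open>y = w (z - x)\<close> puts the point \<open>(z, y)\<close> on a line
  determined by \<open>(w, x)\<close>, so the incidence bound limits the solutions of \<open>y = a w\<close>.\<close>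

lemma spread_of_large_energy:
  assumes fin: "finite B" "finite \<Delta>" and B: "\<And>b. b \<in> B \<Longrightarrow> 0 < b"
    and n: "card B \<le> n" "n \<le> card \<Delta>" "0 < n" and J: "card \<Delta> < 2 ^ J" "0 < J" and h: "0 < h"
    and E: "16 * real J ^ 2 * h ^ 6 * real n * real (card \<Delta>) ^ 3 < (energy B \<Delta>)\<^sup>2"
  obtains A' where "A' \<subseteq> B" "A' \<noteq> {}" "spread (36 * real J) h (ln ` A')"
proof -
  let ?d = "real (card \<Delta>)" and ?J = "real J"
  have JB: "card B < 2 ^ J" using n J by linarith
  from level_set[OF fin JB J(2), of 2] obtain t Z where t: "1 \<le> t"
    and Z: "Z \<subseteq> sums_set B \<Delta>" "\<And>z. z \<in> Z \<Longrightarrow> t \<le> rep B \<Delta> z" and Zt: "\<And>z. z \<in> Z \<Longrightarrow> rep B \<Delta> z < 2 * t"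
    and EZ: "energy B \<Delta> \<le> ?J * (\<Sum>z\<in>Z. real (rep B \<Delta> z) ^ 2)"
       "(\<Sum>z\<in>Z. real (rep B \<Delta> z) ^ 2) \<le> (2 * real t) ^ 2 * real (card Z)"
    unfolding energy_def by blast
  let ?t = "real t" and ?z = "real (card Z)"
  have fZ: "finite Z" using Z fin by (meson finite_subset finite_sums_set)
  have d1: "real n \<le> ?d" using n by simp
  have n0: "0 < real n" using n by simp
  have d0: "0 < ?d" using d1 n0 by linarith
  have big: "h ^ 6 * real n * ?d ^ 3 < (?t\<^sup>2 * ?z)\<^sup>2"
  proof -
    have E0: "0 \<le> energy B \<Delta>" by (simp add: energy_def sum_nonneg)
    have "energy B \<Delta> \<le> ?J * ((2 * ?t) ^ 2 * ?z)"
      using EZ mult_left_mono[OF EZ(2), of ?J] by linarith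
    then have "(energy B \<Delta>)\<^sup>2 \<le> (?J * ((2 * ?t) ^ 2 * ?z))\<^sup>2" using E0 by (intro power_mono) auto
    also have "\<dots> = 16 * ?J ^ 2 * (?t\<^sup>2 * ?z)\<^sup>2" by (simp add: power_mult_distrib)
    finally have "16 * ?J ^ 2 * (h ^ 6 * real n * ?d ^ 3) < 16 * ?J ^ 2 * (?t\<^sup>2 * ?z)\<^sup>2" using E by (simp add: mult.assoc)
    then show ?thesis using J by simp
  qed
  have Zne: "Z \<noteq> {}"
  proof
    assume "Z = {}"
    then have "h ^ 6 * real n * ?d ^ 3 < 0" using big by simp
    moreover have "0 < h ^ 6 * real n * ?d ^ 3" using h n0 d0 by simp
    ultimately show False by linarith
  qed
  then have z0: "0 < ?z" using fZ by (simp add: card_gt_0_iff)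
  have t0: "0 < ?t" using t by simp
  have tn: "?t \<le> real n"
  proof -
    obtain z where "z \<in> Z" using Zne by blast
    then have "t \<le> card B" using Z(2) rep_le_left[OF fin(1)] by (meson le_trans)
    then show ?thesis using n by simp
  qed
  have tz_le: "?t * ?z \<le> real n * ?d"
  proof -
    have "card Z * t \<le> (\<Sum>z\<in>Z. rep B \<Delta> z)" using sum_bounded_below[of Z t "rep B \<Delta>"] Z by simp
    also have "\<dots> \<le> (\<Sum>z\<in>sums_set B \<Delta>. rep B \<Delta> z)" using Z fin by (intro sum_mono2) auto
    also have "\<dots> = card B * card \<Delta>" by (rule sum_rep[OF fin])
    also have "\<dots> \<le> n * card \<Delta>" using n by simp
    finally have "real (card Z * t) \<le> real (n * card \<Delta>)" by (rule of_nat_mono)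
    then show ?thesis by (simp add: mult.commute)
  qed
  \<comment> \<open>This inequality and \<open>t1\<close> match the two terms in the definition of
    \<open>spread\<close>: it feeds the term with 1 / h^2 through \<open>\<zeta>_le\<close>, and
    \<open>t1\<close> feeds the term with 1 / h^3.\<close>
  have t3: "h ^ 6 * ?d\<^sup>2 \<le> ?t ^ 3 * ?z"
  proof -
    have "(h ^ 6 * ?d\<^sup>2) * (real n * ?d) = h ^ 6 * real n * ?d ^ 3" by (simp add: eval_nat_numeral)
    also have "\<dots> \<le> (?t\<^sup>2 * ?z)\<^sup>2" using big by simp
    also have "\<dots> = (?t ^ 3 * ?z) * (?t * ?z)" by (simp add: eval_nat_numeral)
    also have "\<dots> \<le> (?t ^ 3 * ?z) * (real n * ?d)" using tz_le by (intro mult_left_mono) auto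
    finally show ?thesis using n0 d0 by simp
  qed
  have t1: "?d * h ^ 3 \<le> ?t * ?z"
  proof -
    have "(?d * h ^ 3)\<^sup>2 * real n ^ 2 = (h ^ 6 * real n * ?d\<^sup>2) * real n" by (simp add: power_mult_distrib power2_eq_square flip: power_mult)
    also have "\<dots> \<le> (h ^ 6 * real n * ?d\<^sup>2) * ?d" using d1 h by (intro mult_left_mono) auto
    also have "\<dots> = h ^ 6 * real n * ?d ^ 3" by (simp add: eval_nat_numeral)
    also have "\<dots> \<le> (?t\<^sup>2 * ?z)\<^sup>2" using big by simp
    also have "\<dots> = ?t\<^sup>2 * (?t * ?z)\<^sup>2" by (simp add: power_mult_distrib)
    also have "\<dots> \<le> real n ^ 2 * (?t * ?z)\<^sup>2" using tn by (intro mult_right_mono power_mono) auto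
    finally have "(?d * h ^ 3)\<^sup>2 \<le> (?t * ?z)\<^sup>2" using n0 by simp
    then show ?thesis by (rule power2_le_imp_le) simp
  qed
  define \<zeta> where "\<zeta> = root 3 (?z * ?d)"
  have \<zeta>: "0 \<le> \<zeta>" "\<zeta> ^ 3 = ?z * ?d" by (simp_all add: \<zeta>_def)
  have \<zeta>_le: "\<zeta>\<^sup>2 * h\<^sup>2 \<le> ?t * ?z"
  proof -
    have "(\<zeta>\<^sup>2 * h\<^sup>2) ^ 3 = (\<zeta> ^ 3)\<^sup>2 * h ^ 6" by (simp add: power_mult_distrib flip: power_mult)
    also have "\<dots> = (h ^ 6 * ?d\<^sup>2) * ?z\<^sup>2" by (simp add: \<zeta>(2) power_mult_distrib)
    also have "\<dots> \<le> (?t ^ 3 * ?z) * ?z\<^sup>2" using t3 by (intro mult_right_mono) auto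
    also have "\<dots> = (?t * ?z) ^ 3" by (simp add: eval_nat_numeral)
    finally show ?thesis using power_mono_iff[of "\<zeta>\<^sup>2 * h\<^sup>2" "?t * ?z" 3] by simp
  qed
  \<comment> \<open>The number of ways to write b as z - x with z in the level set. Pigeonholing f
    gives the set A' on which this number is nearly constant.\<close>
  define f where "f = (\<lambda>b. card {x \<in> \<Delta>. b + x \<in> Z})"
  define B1 where "B1 = {b \<in> B. 1 \<le> f b}"
  have f_less: "f b < 2 ^ J" for b
  proof -
    have "f b \<le> card \<Delta>" unfolding f_def using fin by (intro card_mono) auto
    then show ?thesis using J by simp
  qed
  have sum_f: "(\<Sum>b\<in>B. f b) = (\<Sum>z\<in>Z. rep B \<Delta> z)"
  proof -
    have "{p \<in> B \<times> \<Delta>. fst p + snd p \<in> Z} = (SIGMA b:B. {x \<in> \<Delta>. b + x \<in> Z})" by auto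
    then show ?thesis unfolding sum_rep_eq_card[OF fin fZ] f_def using fin by simp
  qed
  have tz: "?t * ?z \<le> (\<Sum>b\<in>B1. real (f b))"
  proof -
    have "card Z * t \<le> (\<Sum>z\<in>Z. rep B \<Delta> z)" using sum_bounded_below[of Z t "rep B \<Delta>"] Z by simp
    also have "\<dots> = (\<Sum>b\<in>B. f b)" by (rule sum_f[symmetric])
    also have "\<dots> = (\<Sum>b\<in>B1. f b)" unfolding B1_def using fin by (intro sum.mono_neutral_right) auto
    finally have "real (card Z * t) \<le> real (\<Sum>b\<in>B1. f b)" by (rule of_nat_mono)
    then show ?thesis by (simp add: mult.commute)
  qed
  have fB1: "finite B1" using fin by (simp add: B1_def)
  obtain j where j: "(\<Sum>b\<in>B1. real (f b)) \<le> ?J * (\<Sum>b\<in>{b \<in> B1. 2 ^ j \<le> f b \<and> f b < 2 * 2 ^ j}. real (f b))"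
    using dyadic_pigeonhole[OF fB1, of "\<lambda>b. real (f b)" f J] f_less J(2) by (auto simp: B1_def)
  define k :: nat where "k = 2 ^ j"
  define A' where "A' = {b \<in> B1. k \<le> f b \<and> f b < 2 * k}"
  let ?a = "real (card A')" and ?k = "real k"
  have k0: "0 < ?k" by (simp add: k_def)
  have fA: "finite A'" using fB1 by (simp add: A'_def)
  have AB: "A' \<subseteq> B" by (auto simp: A'_def B1_def)
  have "(\<Sum>b\<in>A'. real (f b)) \<le> (\<Sum>b\<in>A'. 2 * ?k)"
    by (rule sum_mono) (auto simp: A'_def)
  then have "?J * (\<Sum>b\<in>A'. real (f b)) \<le> ?J * (2 * ?k * ?a)" by (intro mult_left_mono) (auto simp: mult.commute)
  with tz j have tz_A: "?t * ?z \<le> 2 * ?J * ?k * ?a" by (simp add: A'_def k_def mult.assoc)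
  have "A' \<noteq> {}"
  proof
    assume "A' = {}"
    then have "?t * ?z \<le> 0" using tz_A by simp
    then show False using t0 z0 by (simp add: mult_le_0_iff)
  qed
  moreover have "spread (36 * ?J) h (ln ` A')"
    unfolding spread_def
  proof (intro allI impI)
    fix Y W :: "real set" assume YW: "finite Y" "finite W"
    define I where "I = card {p \<in> ln ` A' \<times> W. fst p + snd p \<in> Y}"
    define L where "L = (\<lambda>(x, w). (exp w, - exp w * x)) ` (\<Delta> \<times> W)"
    define l where "l = root 3 (real (card L))"
    define \<rho> where "\<rho> = root 3 (real (card Y) * real (card W))"
    let ?w = "real (card W)"
    have inj_ln: "inj_on ln A'"
      using AB B by (intro inj_onI) (meson ln_inj_iff subsetD)
    have "inj_on (\<lambda>(x, w). (exp w, - exp w * x)) (\<Delta> \<times> W)"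
      by (auto simp: inj_on_def)
    then have cL: "card L = card \<Delta> * card W"
      unfolding L_def by (simp add: card_image card_cartesian_product)
    have fL: "finite L" using fin YW by (simp add: L_def)
    have Lnz: "fst m \<noteq> 0" if "m \<in> L" for m using that by (auto simp: L_def)
    have l: "0 \<le> l" "l ^ 3 = real (card L)" by (simp_all add: l_def)
    have cY: "card (exp ` Y) = card Y" by (intro card_image) (auto intro!: inj_onI)
    \<comment> \<open>Each pair (ln a, w) counted by I is repeated for at least k values x with a +
      x in Z. The point (a + x, a exp w) lies on the line of slope exp w that vanishes at x.\<close>
    have "k * I \<le> incidences L (Z \<times> exp ` Y)"
    proof -
      let ?P = "{p \<in> ln ` A' \<times> W. fst p + snd p \<in> Y}"
      let ?S = "SIGMA p:?P. {x \<in> \<Delta>. exp (fst p) + x \<in> Z}"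
      let ?h = "\<lambda>(p, x). ((exp (snd p), - exp (snd p) * x), (exp (fst p) + x, exp (fst p + snd p)))"
      have fP: "finite ?P" by (rule finite_subset[of _ "ln ` A' \<times> W"]) (use fA YW in auto)
      have "k * I = (\<Sum>p\<in>?P. k)" by (simp add: I_def)
      also have "\<dots> \<le> (\<Sum>p\<in>?P. card {x \<in> \<Delta>. exp (fst p) + x \<in> Z})"
      proof (rule sum_mono)
        fix p assume "p \<in> ?P"
        then obtain a where a: "a \<in> A'" "fst p = ln a" by auto
        then have "exp (fst p) = a" using AB B by auto
        then show "k \<le> card {x \<in> \<Delta>. exp (fst p) + x \<in> Z}" using a by (simp add: A'_def f_def)
      qed
      also have "\<dots> = card ?S" using fP fin by simp
      also have "\<dots> \<le> incidences L (Z \<times> exp ` Y)"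
        unfolding incidences_def
      proof (rule card_inj_on_le[of ?h])
        show "inj_on ?h ?S" by (auto simp: inj_on_def)
        show "?h ` ?S \<subseteq> {(m, p). m \<in> L \<and> p \<in> Z \<times> exp ` Y \<and> on_line m p}"
        proof (rule image_subsetI)
          fix q assume q: "q \<in> ?S"
          obtain p x where px: "q = (p, x)" by (cases q)
          have "(exp (snd p), - exp (snd p) * x) \<in> L" using q by (auto simp: L_def px)
          moreover have "exp (fst p + snd p) \<in> exp ` Y" using q by (simp add: px)
          moreover have "on_line (exp (snd p), - exp (snd p) * x) (exp (fst p) + x, exp (fst p + snd p))"
            by (simp add: on_line_def exp_add algebra_simps)
          ultimately show "?h q \<in> {(m, p). m \<in> L \<and> p \<in> Z \<times> exp ` Y \<and> on_line m p}"
            using q by (simp add: px)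
        qed
        show "finite {(m, p). m \<in> L \<and> p \<in> Z \<times> exp ` Y \<and> on_line m p}"
          by (rule finite_subset[of _ "L \<times> (Z \<times> exp ` Y)"]) (use fL fZ YW in auto)
      qed
      finally show ?thesis .
    qed
    then have "real (k * I) \<le> real (incidences L (Z \<times> exp ` Y))" by (rule of_nat_mono)
    also have "\<dots> \<le> 18 * (root 3 (?z * real (card Y)) * l)\<^sup>2 + 2 * l ^ 3"
      by (rule incidences_le[OF fZ _ fL Lnz _ _ l]) (use YW cY in auto)
    \<comment> \<open>The four cardinalities are regrouped: \<open>\<rho>\<close> keeps the
      arbitrary sets Y and W, \<open>\<zeta>\<close> keeps Z and \<open>\<Delta>\<close>, which are
      controlled by the large energy.\<close>
    also have "root 3 (?z * real (card Y)) * l = \<rho> * \<zeta>"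
      unfolding l_def \<rho>_def \<zeta>_def cL of_nat_mult real_root_mult by simp
    also have "l ^ 3 = ?d * ?w" by (simp add: l(2) cL)
    finally have kI: "?k * real I \<le> 18 * (\<rho> * \<zeta>)\<^sup>2 + 2 * (?d * ?w)" by simp
    have 1: "(\<rho> * \<zeta>)\<^sup>2 \<le> \<rho>\<^sup>2 / h\<^sup>2 * (?t * ?z)"
    proof -
      have "(\<rho> * \<zeta>)\<^sup>2 = \<rho>\<^sup>2 / h\<^sup>2 * (\<zeta>\<^sup>2 * h\<^sup>2)" using h by (simp add: power_mult_distrib)
      also have "\<dots> \<le> \<rho>\<^sup>2 / h\<^sup>2 * (?t * ?z)" using \<zeta>_le by (intro mult_left_mono) auto
      finally show ?thesis .
    qed
    have 2: "?d * ?w \<le> ?w / h ^ 3 * (?t * ?z)"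
    proof -
      have "?d * ?w = ?w / h ^ 3 * (?d * h ^ 3)" using h by simp
      also have "\<dots> \<le> ?w / h ^ 3 * (?t * ?z)" using t1 h by (intro mult_left_mono) auto
      finally show ?thesis .
    qed
    have w0: "0 \<le> ?w / h ^ 3 * (?t * ?z)" using h by simp
    have "?k * real I \<le> 18 * (\<rho>\<^sup>2 / h\<^sup>2 + ?w / h ^ 3) * (?t * ?z)"
    proof -
      have "x \<le> 18 * (p + q) * s" if "x \<le> 18 * a + 2 * b" "a \<le> p * s" "b \<le> q * s" "0 \<le> q * s"
        for x a b p q s :: real
        using that by (simp add: algebra_simps)
      from this[OF kI 1 2 w0] show ?thesis .
    qed
    also have "\<dots> \<le> 18 * (\<rho>\<^sup>2 / h\<^sup>2 + ?w / h ^ 3) * (2 * ?J * ?k * ?a)"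
      using tz_A h by (intro mult_left_mono) auto
    also have "\<dots> = ?k * (36 * ?J * ?a * (\<rho>\<^sup>2 / h\<^sup>2 + ?w / h ^ 3))" by simp
    finally have "real I \<le> 36 * ?J * ?a * (\<rho>\<^sup>2 / h\<^sup>2 + ?w / h ^ 3)" using k0 by (rule mult_left_le_imp_le)
    then show "real (card {p \<in> ln ` A' \<times> W. fst p + snd p \<in> Y})
       \<le> 36 * ?J * real (card (ln ` A')) *
         ((root 3 (real (card Y) * real (card W)))\<^sup>2 / h\<^sup>2 + real (card W) / h ^ 3)"
      by (simp add: I_def \<rho>_def card_image[OF inj_ln])
  qed
  ultimately show thesis using that AB by blast
qed

section \<open>Difference sets and sum sets from energies\<close>

lemma energy_eq_card:
  assumes "finite A" "finite B"
  shows "energy A B = real (card {(p, q). p \<in> A \<times> B \<and> q \<in> A \<times> B \<and> fst p + snd p = fst q + snd q})"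
  using card_collisions[of "A \<times> B" "\<lambda>p. fst p + snd p"] assms
  by (simp add: energy_def sums_set_def rep_def)

lemma card_le_energy:
  assumes fin: "finite A" "finite B" and g: "inj_on g T"
    and sub: "g ` T \<subseteq> {(p, q). p \<in> A \<times> B \<and> q \<in> A \<times> B \<and> fst p + snd p = fst q + snd q}"
  shows "real (card T) \<le> energy A B"
proof -
  let ?E = "{(p, q). p \<in> A \<times> B \<and> q \<in> A \<times> B \<and> fst p + snd p = fst q + snd q}"
  have "finite ?E" by (rule finite_subset[of _ "(A \<times> B) \<times> (A \<times> B)"]) (use fin in auto)
  then show ?thesis using card_inj_on_le[OF g sub] by (simp add: energy_eq_card[OF fin])
qed

lemma card_le_energy3:
  assumes fin: "finite A" and g: "inj_on g T"
    and sub: "g ` T \<subseteq> {((a, a'), (b, b'), (c, c')). {a, a', b, b', c, c'} \<subseteq> A \<and> a - a' = b - b' \<and> b - b' = c - c'}"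
  shows "real (card T) \<le> energy3 A"
proof -
  let ?f = "\<lambda>p. fst p + snd p :: real" and ?S = "A \<times> uminus ` A"
  let ?E = "{((a, a'), (b, b'), (c, c')). {a, a', b, b', c, c'} \<subseteq> A \<and> a - a' = b - b' \<and> b - b' = c - c'}"
  have fE: "finite ?E" by (rule finite_subset[of _ "(A \<times> A) \<times> (A \<times> A) \<times> (A \<times> A)"]) (use fin in auto)
  have "?E \<subseteq> (\<Union>z\<in>?f ` ?S. {(a, a'). a \<in> A \<and> a' \<in> A \<and> a - a' = z} \<times> {(a, a'). a \<in> A \<and> a' \<in> A \<and> a - a' = z} \<times> {(a, a'). a \<in> A \<and> a' \<in> A \<and> a - a' = z})"
    (is "_ \<subseteq> (\<Union>z\<in>_. ?D z \<times> ?D z \<times> ?D z)")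
  proof clarify
    fix a a' b b' c c' assume *: "{a, a', b, b', c, c'} \<subseteq> A" "a - a' = b - b'" "b - b' = c - c'"
    have "?f (a, - a') \<in> ?f ` ?S" using * by (intro imageI) auto
    then show "((a, a'), (b, b'), (c, c')) \<in> (\<Union>z\<in>?f ` ?S. ?D z \<times> ?D z \<times> ?D z)"
      using * by (intro UN_I[of "a - a'"]) auto
  qed
  moreover have fD: "finite (?D z)" for z by (rule finite_subset[of _ "A \<times> A"]) (use fin in auto)
  ultimately have "card ?E \<le> card (\<Union>z\<in>?f ` ?S. ?D z \<times> ?D z \<times> ?D z)"
    using fin by (intro card_mono) auto
  also have "\<dots> \<le> (\<Sum>z\<in>?f ` ?S. card (?D z \<times> ?D z \<times> ?D z))"
    using fin by (intro card_UN_le) auto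
  also have "\<dots> = (\<Sum>z\<in>?f ` ?S. rep A (uminus ` A) z ^ 3)"
  proof (rule sum.cong[OF refl])
    fix z
    have "card (?D z) = rep A (uminus ` A) z"
      unfolding rep_def fib_def
      by (rule bij_betw_same_card[of "\<lambda>(a, a'). (a, - a')"], rule bij_betwI[of _ _ _ "\<lambda>(a, a'). (a, - a')"]) auto
    then show "card (?D z \<times> ?D z \<times> ?D z) = rep A (uminus ` A) z ^ 3"
      by (simp add: card_cartesian_product power3_eq_cube mult.assoc)
  qed
  finally have "card T \<le> (\<Sum>z\<in>?f ` ?S. rep A (uminus ` A) z ^ 3)"
    using card_inj_on_le[OF g sub fE] by linarith
  from of_nat_mono[OF this, where ?'a = real] show ?thesis
    by (simp add: energy3_def sums_set_def)
qed

lemma rep_neg: "rep A (uminus ` B) x = card {b \<in> B. x + b \<in> A}"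
  unfolding rep_eq_card_left
  by (rule bij_betw_same_card[of "\<lambda>a. a - x"], rule bij_betwI[of _ _ _ "\<lambda>b. x + b"])
    (auto simp: mem_uminus_image)

text \<open>An unpopular sum has fewer than |A||B| / (c |S|) representations, and there are at most
  |S| of them.\<close>

lemma sum_unpopular_rep:
  assumes fin: "finite A" "finite B" and c: "0 < c" and S: "sums_set A B \<subseteq> S" "finite S"
  shows "c * (\<Sum>x\<in>{x \<in> sums_set A B. \<not> card A * card B \<le> c * card S * rep A B x}. rep A B x) \<le> card A * card B"
proof (cases "S = {}")
  case True
  then show ?thesis using S by simp
next
  case False
  let ?Q = "{x \<in> sums_set A B. \<not> card A * card B \<le> c * card S * rep A B x}"
  have "card S * (c * (\<Sum>x\<in>?Q. rep A B x)) = (\<Sum>x\<in>?Q. c * card S * rep A B x)"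
    by (simp add: sum_distrib_left mult_ac)
  also have "\<dots> \<le> (\<Sum>x\<in>?Q. card A * card B)" by (intro sum_mono) auto
  also have "\<dots> = card ?Q * (card A * card B)" by simp
  also have "\<dots> \<le> card S * (card A * card B)"
    using S by (intro mult_right_mono card_mono) auto
  finally show ?thesis using False S by (simp add: card_gt_0_iff)
qed

text \<open>The triple (a, b, c) is sent to (a - b, a - c), two elements of \<open>\<Delta>\<close>
  whose gap b - c is popular. Collisions of this map are counted by \<open>energy3\<close>, its
  possible values by \<open>energy B \<Delta>\<close>.\<close>

lemma power8_le_energies:
  assumes fin: "finite B" "finite \<Delta>" and \<Delta>: "\<And>b c. b \<in> B \<Longrightarrow> c \<in> B \<Longrightarrow> b - c \<in> \<Delta>"
  shows "real (card B) ^ 8 \<le> 8 * real (card \<Delta>) * energy3 B * energy B \<Delta>"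
proof -
  let ?N = "uminus ` B" and ?m = "real (card B)" and ?d = "real (card \<Delta>)"
  have fN: "finite ?N" using fin by simp
  have sub: "sums_set B ?N \<subseteq> \<Delta>" using \<Delta> by (auto simp: sums_set_def)
  define P where "P = {x \<in> sums_set B ?N. card B * card ?N \<le> 2 * card \<Delta> * rep B ?N x}"
  define S where "S = {(a, b, c). a \<in> B \<and> b \<in> B \<and> c \<in> B \<and> b - c \<in> P}"
  define f where "f = (\<lambda>(a, b, c). (a - b, a - c) :: real \<times> real)"
  define R where "R = {(p, q). p \<in> \<Delta> \<and> q \<in> \<Delta> \<and> q - p \<in> P}"
  have fP: "finite P" unfolding P_def using fin by auto
  have fS: "finite S" by (rule finite_subset[of _ "B \<times> B \<times> B"]) (use fin in \<open>auto simp: S_def\<close>)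
  have fR: "finite R" by (rule finite_subset[of _ "\<Delta> \<times> \<Delta>"]) (use fin in \<open>auto simp: R_def\<close>)
  have E0: "0 \<le> energy3 B" "0 \<le> energy B \<Delta>" by (simp_all add: energy3_def energy_def sum_nonneg)
  have popular: "?m ^ 2 \<le> 2 * real (\<Sum>x\<in>P. rep B ?N x)"
  proof -
    let ?Q = "{x \<in> sums_set B ?N. \<not> card B * card ?N \<le> 2 * card \<Delta> * rep B ?N x}"
    have "sums_set B ?N = P \<union> ?Q" "P \<inter> ?Q = {}" by (auto simp: P_def)
    then have "card B * card ?N = (\<Sum>x\<in>P. rep B ?N x) + (\<Sum>x\<in>?Q. rep B ?N x)"
      using sum_rep[OF fin(1) fN] fin by (metis (no_types, lifting) finite_Un finite_sums_set fN sum.union_disjoint)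
    moreover have "2 * (\<Sum>x\<in>?Q. rep B ?N x) \<le> card B * card ?N"
      by (rule sum_unpopular_rep[OF fin(1) fN _ sub fin(2)]) simp
    ultimately have "card B * card ?N \<le> 2 * (\<Sum>x\<in>P. rep B ?N x)" by linarith
    then have "real (card B * card ?N) \<le> real (2 * (\<Sum>x\<in>P. rep B ?N x))" by (rule of_nat_mono)
    then show ?thesis by (simp add: power2_eq_square)
  qed
  have cS: "card S = card B * (\<Sum>x\<in>P. rep B ?N x)"
  proof -
    have "card S = card (B \<times> {p \<in> B \<times> ?N. fst p + snd p \<in> P})"
      by (rule bij_betw_same_card[of "\<lambda>(a, b, c). (a, (b, - c))"], rule bij_betwI[of _ _ _ "\<lambda>(a, (b, c)). (a, b, - c)"])
        (auto simp: S_def)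
    then show ?thesis by (simp add: card_cartesian_product sum_rep_eq_card[OF fin(1) fN fP])
  qed
  have "?m ^ 3 \<le> 2 * real (card S)"
  proof -
    have "?m * ?m ^ 2 \<le> ?m * (2 * real (\<Sum>x\<in>P. rep B ?N x))" using popular by (intro mult_left_mono) auto
    then show ?thesis unfolding cS by (simp add: power2_eq_square power3_eq_cube)
  qed
  then have "(?m ^ 3)\<^sup>2 \<le> (2 * real (card S))\<^sup>2" by (intro power_mono) auto
  then have 1: "?m ^ 6 \<le> 4 * (real (card S))\<^sup>2" by (simp add: power_mult_distrib flip: power_mult)
  have "(real (card S))\<^sup>2 \<le> real (card (f ` S)) * real (card {(p, q). p \<in> S \<and> q \<in> S \<and> f p = f q})"
    by (rule card_square_le_image_times_collisions[OF fS])
  also have "\<dots> \<le> real (card R) * energy3 B"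
  proof (intro mult_mono)
    have "f ` S \<subseteq> R" using \<Delta> by (auto simp: f_def S_def R_def)
    then show "real (card (f ` S)) \<le> real (card R)" using fR by (simp add: card_mono)
    \<comment> \<open>If (a, b, c) and (a', b', c') collide, then a - a' = b - b' = c - c'.\<close>
    show "real (card {(p, q). p \<in> S \<and> q \<in> S \<and> f p = f q}) \<le> energy3 B"
      by (rule card_le_energy3[OF fin(1), of "\<lambda>((a, b, c), (a', b', c')). ((a, a'), (b, b'), (c, c'))"])
        (auto simp: inj_on_def S_def f_def)
  qed auto
  finally have 2: "(real (card S))\<^sup>2 \<le> real (card R) * energy3 B" .
  \<comment> \<open>Popularity supplies at least m^2 / (2 d) ways to write q - p = b - c, and each
    is a solution of b + p = c + q.\<close>
  have 3: "?m ^ 2 * real (card R) \<le> 2 * ?d * energy B \<Delta>"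
  proof -
    let ?T = "SIGMA r:R. {c \<in> B. (snd r - fst r) + c \<in> B}"
    have "card B * card ?N * card R = (\<Sum>r\<in>R. card B * card ?N)" by simp
    also have "\<dots> \<le> (\<Sum>r\<in>R. 2 * card \<Delta> * rep B ?N (snd r - fst r))"
      by (intro sum_mono) (auto simp: R_def P_def)
    also have "\<dots> = 2 * card \<Delta> * card ?T"
      using fR fin by (simp add: rep_neg sum_distrib_left)
    finally have "real (card B * card ?N * card R) \<le> real (2 * card \<Delta> * card ?T)" by (rule of_nat_mono)
    moreover have "real (card ?T) \<le> energy B \<Delta>"
      by (rule card_le_energy[OF fin, of "\<lambda>(r, c). (((snd r - fst r) + c, fst r), (c, snd r))"])
        (auto simp: inj_on_def R_def)
    then have "2 * ?d * real (card ?T) \<le> 2 * ?d * energy B \<Delta>" by (intro mult_left_mono) auto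
    ultimately show ?thesis by (simp add: power2_eq_square)
  qed
  have "?m ^ 8 = ?m ^ 6 * ?m ^ 2" by (simp flip: power_add)
  also have "\<dots> \<le> (4 * (real (card R) * energy3 B)) * ?m ^ 2"
    using 1 2 by (intro mult_right_mono) auto
  also have "\<dots> = 4 * energy3 B * (?m ^ 2 * real (card R))" by simp
  also have "\<dots> \<le> 4 * energy3 B * (2 * ?d * energy B \<Delta>)" using 3 E0 by (intro mult_left_mono) auto
  finally show ?thesis by (simp add: mult_ac)
qed

section \<open>The inequality for sum sets\<close>

lemma rep_eq_0: "z \<notin> sums_set A B \<Longrightarrow> rep A B z = 0"
proof -
  assume "z \<notin> sums_set A B"
  then have "{p \<in> A \<times> B. fst p + snd p = z} = {}" by (auto simp: sums_set_def image_iff)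
  then show ?thesis by (simp only: rep_def fib_def card.empty)
qed

lemma rep_mono: "finite A' \<Longrightarrow> finite B' \<Longrightarrow> A \<subseteq> A' \<Longrightarrow> B \<subseteq> B' \<Longrightarrow> rep A B z \<le> rep A' B' z"
  unfolding rep_def fib_def by (intro card_mono) auto

lemma card_opposite_sums_le:
  assumes fin: "finite C" "finite U" "finite V"
  shows "(real (card {(p, q). p \<in> C \<times> U \<and> q \<in> C \<times> V \<and> fst p + snd p = - (fst q + snd q)}))\<^sup>2
    \<le> energy C U * energy C V"
proof -
  let ?T = "{(p, q). p \<in> C \<times> U \<and> q \<in> C \<times> V \<and> fst p + snd p = - (fst q + snd q)}"
  have "?T = (\<Union>y\<in>sums_set C U. {p \<in> C \<times> U. fst p + snd p = y} \<times> {q \<in> C \<times> V. fst q + snd q = - y})"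
    by (auto simp: sums_set_def)
  moreover have "card \<dots> = (\<Sum>y\<in>sums_set C U. card ({p \<in> C \<times> U. fst p + snd p = y} \<times> {q \<in> C \<times> V. fst q + snd q = - y}))"
    using fin by (intro card_UN_disjoint) auto
  ultimately have cT: "card ?T = (\<Sum>y\<in>sums_set C U. rep C U y * rep C V (- y))"
    by (simp add: rep_def fib_def card_cartesian_product)
  have "(\<Sum>y\<in>sums_set C U. (real (rep C V (- y)))\<^sup>2) = (\<Sum>y\<in>uminus ` sums_set C U. (real (rep C V y))\<^sup>2)"
    by (simp add: sum.reindex)
  also have "\<dots> \<le> (\<Sum>y\<in>uminus ` sums_set C U \<union> sums_set C V. (real (rep C V y))\<^sup>2)"
    using fin by (intro sum_mono2) auto
  also have "\<dots> = energy C V" unfolding energy_def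
    using fin by (intro sum.mono_neutral_right) (auto simp: rep_eq_0)
  finally have V: "(\<Sum>y\<in>sums_set C U. (real (rep C V (- y)))\<^sup>2) \<le> energy C V" .
  have "(real (card ?T))\<^sup>2 = (\<Sum>y\<in>sums_set C U. real (rep C U y) * real (rep C V (- y)))\<^sup>2"
    unfolding cT by simp
  also have "\<dots> \<le> energy C U * (\<Sum>y\<in>sums_set C U. (real (rep C V (- y)))\<^sup>2)"
    unfolding energy_def by (rule Cauchy_Schwarz_ineq_sum)
  also have "\<dots> \<le> energy C U * energy C V"
    using V by (intro mult_left_mono) (auto simp: energy_def sum_nonneg)
  finally show ?thesis .
qed

text \<open>A solution of a + b = c + d is also one of a - c = d - b, so a small sum set forces a
  large energy of differences.\<close>

lemma card_power4_le_energy_difference: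
  assumes "finite B"
  shows "real (card B) ^ 4 \<le> real (card (sums_set B B)) * energy B (uminus ` B)"
proof -
  let ?T = "{(p, q). p \<in> B \<times> B \<and> q \<in> B \<times> B \<and> fst p + snd p = fst q + snd q}"
  have "(real (card (B \<times> B)))\<^sup>2 \<le> real (card (sums_set B B)) * real (card ?T)"
    unfolding sums_set_def using assms by (intro card_square_le_image_times_collisions) auto
  also have "\<dots> \<le> real (card (sums_set B B)) * energy B (uminus ` B)"
  proof (rule mult_left_mono)
    show "real (card ?T) \<le> energy B (uminus ` B)"
      using assms
      by (intro card_le_energy[of _ _ "\<lambda>(p, q). ((fst p, - fst q), (snd q, - snd p))"])
        (auto simp: inj_on_def)
  qed simp
  finally show ?thesis by (simp add: card_cartesian_product eval_nat_numeral mult_ac)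
qed

text \<open>Triples are now sent to (a + b, a + c). The gap b - c is still a difference, so it is
  confined to a dyadic level D of differences with multiplicity t. The bounds on t^2 |D|, t^3 |D|
  and t^8 |D|^5 are finally combined so that t and |D| disappear.\<close>

lemma power44_le_energies:
  assumes fin: "finite C" and J: "card C < 2 ^ J" "0 < J"
    and G: "energy3 C \<le> G" and F: "\<And>W. finite W \<Longrightarrow> (energy C W)\<^sup>2 \<le> F * real (card W) ^ 3" "0 \<le> F"
  shows "real (card C) ^ 44 \<le> 2 ^ 62 * real J ^ 7 * G ^ 6 * F\<^sup>2 * real (card (sums_set C C)) ^ 14"
proof -
  let ?m = "real (card C)"
  define S where "S = sums_set C C"
  let ?s = "real (card S)"
  have fS: "finite S" using fin by (simp add: S_def)
  have G0: "0 \<le> G" using G by (smt (verit) energy3_def of_nat_0_le_iff sum_nonneg zero_le_power)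
  have memS: "x + y \<in> S" if "x \<in> C" "y \<in> C" for x y
    using that by (force simp: S_def sums_set_def)
  \<comment> \<open>With the constant 8 the unpopular pairs form at most an eighth of all pairs.
    Averaging then shows that at least half of the b in C have \<open>bad b\<close> at most |C| /
    4.\<close>
  define P where "P = {x \<in> S. card C * card C \<le> 8 * card S * rep C C x}"
  have fP: "finite P" using fS by (simp add: P_def)
  define bad where "bad = (\<lambda>b. card {a \<in> C. a + b \<notin> P})"
  define B where "B = {b \<in> C. 4 * bad b \<le> card C}"
  have BC: "B \<subseteq> C" by (auto simp: B_def)
  have fB: "finite B" using fin by (simp add: B_def)
  have sum_bad: "8 * (\<Sum>b\<in>C. bad b) \<le> card C * card C"
  proof -
    let ?Q = "{x \<in> sums_set C C. \<not> card C * card C \<le> 8 * card S * rep C C x}"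
    have "(\<Sum>b\<in>C. bad b) = card (SIGMA b:C. {a \<in> C. a + b \<notin> P})"
      using fin by (simp add: bad_def)
    also have "\<dots> = card {p \<in> C \<times> C. fst p + snd p \<in> ?Q}"
      by (rule bij_betw_same_card[of "\<lambda>(b, a). (a, b)"], rule bij_betwI[of _ _ _ "\<lambda>(a, b). (b, a)"])
        (auto simp: P_def memS add.commute simp flip: S_def)
    also have "\<dots> = (\<Sum>x\<in>?Q. rep C C x)" using fin by (intro sum_rep_eq_card[symmetric]) auto
    finally show ?thesis
      using sum_unpopular_rep[OF fin fin, of 8 S] fS by (simp add: S_def)
  qed
  have halfB: "card C \<le> 2 * card B"
  proof -
    have "card C * card (C - B) = (\<Sum>b\<in>C - B. card C)" by simp
    also have "\<dots> \<le> (\<Sum>b\<in>C - B. 4 * bad b)" by (intro sum_mono) (auto simp: B_def)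
    also have "\<dots> \<le> (\<Sum>b\<in>C. 4 * bad b)" using fin by (intro sum_mono2) auto
    also have "\<dots> = 4 * (\<Sum>b\<in>C. bad b)" by (simp only: sum_distrib_left)
    finally have "2 * (card C * card (C - B)) \<le> card C * card C"
      using sum_bad by linarith
    then have "card C * (2 * card (C - B)) \<le> card C * card C" by (simp add: mult_ac)
    then have "2 * card (C - B) \<le> card C" by (cases "card C = 0") (use fin in auto)
    moreover have "card (C - B) = card C - card B" "card B \<le> card C"
      using BC fin fB by (auto simp: card_Diff_subset card_mono)
    ultimately show ?thesis by linarith
  qed
  let ?N = "uminus ` B" and ?NC = "uminus ` C"
  have fN: "finite ?N" "finite ?NC" using fB fin by auto
  have JB: "card B < 2 ^ J" using J card_mono[OF fin BC] by linarith
  from level_set[OF fB fN(1) JB J(2), of 2] obtain t D where t: "1 \<le> t" and D: "D \<subseteq> sums_set B ?N"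
    and Dt: "\<And>z. z \<in> D \<Longrightarrow> t \<le> rep B ?N z" and Dt2: "\<And>z. z \<in> D \<Longrightarrow> rep B ?N z < 2 * t"
    and E: "energy B ?N \<le> real J * (\<Sum>z\<in>D. real (rep B ?N z) ^ 2)"
       "(\<Sum>z\<in>D. real (rep B ?N z) ^ 2) \<le> (2 * real t) ^ 2 * real (card D)"
    unfolding energy_def by blast
  let ?t = "real t" and ?d = "real (card D)"
  have fD: "finite D" using D fB by (meson finite_subset finite_sums_set fN(1))
  have popular: "?m ^ 4 \<le> 64 * real J * ?s * (?t\<^sup>2 * ?d)"
  proof -
    have "real (card C) \<le> real (2 * card B)" using halfB by (rule of_nat_mono)
    then have "?m ^ 4 \<le> (2 * real (card B)) ^ 4" by (intro power_mono) auto
    also have "\<dots> = 16 * real (card B) ^ 4" by (simp add: power_mult_distrib)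
    also have "\<dots> \<le> 16 * (real (card (sums_set B B)) * energy B ?N)"
      using card_power4_le_energy_difference[OF fB] by simp
    also have "\<dots> \<le> 16 * (?s * (real J * ((2 * ?t) ^ 2 * ?d)))"
    proof (intro mult_left_mono mult_mono)
      have "sums_set B B \<subseteq> S" using BC by (auto simp: S_def sums_set_def)
      then show "real (card (sums_set B B)) \<le> ?s" using fS by (simp add: card_mono)
      show "energy B ?N \<le> real J * ((2 * ?t) ^ 2 * ?d)"
        using E mult_left_mono[OF E(2), of "real J"] by linarith
    qed (auto simp: energy_def sum_nonneg)
    finally show ?thesis by (simp add: power_mult_distrib mult_ac)
  qed
  have third: "?t ^ 3 * ?d \<le> G"
  proof -
    have "?t ^ 3 * ?d = (\<Sum>z\<in>D. ?t ^ 3)" by simp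
    also have "\<dots> \<le> (\<Sum>z\<in>D. real (rep C ?NC z) ^ 3)"
    proof (intro sum_mono power_mono)
      fix z assume "z \<in> D"
      have "rep B ?N z \<le> rep C ?NC z" using fin fN BC by (intro rep_mono) auto
      then show "?t \<le> real (rep C ?NC z)" using Dt[OF \<open>z \<in> D\<close>] by simp
    qed simp
    also have "\<dots> \<le> energy3 C" unfolding energy3_def
    proof (intro sum_mono2)
      have "sums_set B ?N \<subseteq> sums_set C ?NC" using BC unfolding sums_set_def by (intro image_mono) auto
      then show "D \<subseteq> sums_set C ?NC" using D by blast
    qed (use fin fN in auto)
    finally show ?thesis using G by linarith
  qed
  define T where "T = {(a, b, c). a \<in> C \<and> b \<in> B \<and> c \<in> B \<and> b - c \<in> D \<and> a + b \<in> P \<and> a + c \<in> P}"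
  define f where "f = (\<lambda>(a, b, c). (a + b, a + c) :: real \<times> real)"
  define R where "R = {(p, q). p \<in> P \<and> q \<in> P \<and> p - q \<in> D}"
  have fT: "finite T" by (rule finite_subset[of _ "C \<times> B \<times> B"]) (use fin fB in \<open>auto simp: T_def\<close>)
  have fR: "finite R" by (rule finite_subset[of _ "P \<times> P"]) (use fP in \<open>auto simp: R_def\<close>)
  have cT: "?m * (?t * ?d) \<le> 2 * real (card T)"
  proof -
    let ?Q = "{p \<in> B \<times> ?N. fst p + snd p \<in> D}"
    have fQ: "finite ?Q" by (rule finite_subset[of _ "B \<times> ?N"]) (use fB in auto)
    have "card D * t \<le> (\<Sum>z\<in>D. rep B ?N z)" using sum_bounded_below[of D t "rep B ?N"] Dt by simp
    also have "\<dots> = card ?Q" by (rule sum_rep_eq_card[OF fB fN(1) fD])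
    finally have dQ: "card D * t \<le> card ?Q" .
    have "card C * card ?Q = (\<Sum>p\<in>?Q. card C)" by simp
    \<comment> \<open>Two elements of B exclude at most a quarter of C each, so half of the a in C
      make both sums popular.\<close>
    also have "\<dots> \<le> (\<Sum>p\<in>?Q. 2 * card {a \<in> C. a + fst p \<in> P \<and> a - snd p \<in> P})"
    proof (rule sum_mono)
      fix p assume p: "p \<in> ?Q"
      let ?g = "{a \<in> C. a + fst p \<in> P \<and> a - snd p \<in> P}"
      let ?b1 = "{a \<in> C. a + fst p \<notin> P}" and ?b2 = "{a \<in> C. a + (- snd p) \<notin> P}"
      have "fst p \<in> B" "- snd p \<in> B" using p by auto
      then have "4 * card ?b1 \<le> card C" "4 * card ?b2 \<le> card C" by (simp_all only: B_def bad_def) auto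
      moreover have "card C \<le> card ?g + (card ?b1 + card ?b2)"
      proof -
        have "C = ?g \<union> (?b1 \<union> ?b2)" by auto
        then have "card C \<le> card ?g + card (?b1 \<union> ?b2)" using card_Un_le[of ?g "?b1 \<union> ?b2"] by simp
        then show ?thesis using card_Un_le[of ?b1 ?b2] by linarith
      qed
      ultimately show "card C \<le> 2 * card ?g" by linarith
    qed
    also have "\<dots> = 2 * card (SIGMA p:?Q. {a \<in> C. a + fst p \<in> P \<and> a - snd p \<in> P})"
      using fQ fin by (simp add: sum_distrib_left)
    also have "card (SIGMA p:?Q. {a \<in> C. a + fst p \<in> P \<and> a - snd p \<in> P}) = card T"
      by (rule bij_betw_same_card[of "\<lambda>(p, a). (a, fst p, - snd p)"], rule bij_betwI[of _ _ _ "\<lambda>(a, b, c). ((b, - c), a)"])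
        (auto simp: T_def)
    finally have "card C * (card D * t) \<le> 2 * card T" using dQ mult_le_mono2 le_trans by meson
    from of_nat_mono[OF this, where ?'a = real] show ?thesis by (simp add: mult_ac)
  qed
  have "(real (card T))\<^sup>2 \<le> real (card (f ` T)) * real (card {(p, q). p \<in> T \<and> q \<in> T \<and> f p = f q})"
    by (rule card_square_le_image_times_collisions[OF fT])
  also have "\<dots> \<le> real (card R) * energy3 C"
  proof (intro mult_mono)
    have "f ` T \<subseteq> R" by (auto simp: f_def T_def R_def)
    then show "real (card (f ` T)) \<le> real (card R)" using fR by (simp add: card_mono)
    \<comment> \<open>For sums a collision reads a - a' = b' - b = c' - c, hence the reversed pairs
      in the injection.\<close>
    show "real (card {(p, q). p \<in> T \<and> q \<in> T \<and> f p = f q}) \<le> energy3 C"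
      by (rule card_le_energy3[OF fin, of "\<lambda>((a, b, c), (a', b', c')). ((a, a'), (b', b), (c', c))"])
        (use BC in \<open>auto simp: inj_on_def T_def f_def\<close>)
  qed auto
  also have "\<dots> \<le> real (card R) * G" using G by (intro mult_left_mono) auto
  finally have TR: "(real (card T))\<^sup>2 \<le> real (card R) * G" .
  define K where "K = {(p, q). p \<in> C \<times> uminus ` D \<and> q \<in> C \<times> uminus ` P \<and> fst p + snd p = - (fst q + snd q)}"
  have fK: "finite K" by (rule finite_subset[of _ "(C \<times> uminus ` D) \<times> (C \<times> uminus ` P)"])
    (use fin fD fP in \<open>auto simp: K_def\<close>)
  \<comment> \<open>A popular p is a + a' in at least m^2 / (8 s) ways. Each gives the relation (a -
    (p - q)) + (a' - q) = 0 counted by K, which Cauchy-Schwarz separates into the energies of C with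
    the negatives of D and P.\<close>
  have RK: "?m\<^sup>2 * real (card R) \<le> 8 * ?s * real (card K)"
  proof -
    let ?U = "SIGMA r:R. {a \<in> C. fst r - a \<in> C}"
    have "card C * card C * card R = (\<Sum>r\<in>R. card C * card C)" by simp
    also have "\<dots> \<le> (\<Sum>r\<in>R. 8 * card S * rep C C (fst r))"
      by (intro sum_mono) (auto simp: R_def P_def)
    also have "\<dots> = 8 * card S * card ?U"
      using fR fin by (simp add: rep_eq_card_left sum_distrib_left)
    also have "card ?U \<le> card K"
      by (rule card_inj_on_le[OF _ _ fK, of "\<lambda>(r, a). ((a, - (fst r - snd r)), (fst r - a, - snd r))"])
        (auto simp: inj_on_def R_def K_def mem_uminus_image)
    finally have "card C * card C * card R \<le> 8 * card S * card K" by simp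
    from of_nat_mono[OF this, where ?'a = real] show ?thesis by (simp add: power2_eq_square)
  qed
  have K4: "real (card K) ^ 4 \<le> F\<^sup>2 * ?d ^ 3 * ?s ^ 3"
  proof -
    have E: "0 \<le> energy C W" for W by (simp add: energy_def sum_nonneg)
    have "(real (card K))\<^sup>2 \<le> energy C (uminus ` D) * energy C (uminus ` P)"
      unfolding K_def using fin fD fP by (intro card_opposite_sums_le) auto
    then have "((real (card K))\<^sup>2)\<^sup>2 \<le> (energy C (uminus ` D) * energy C (uminus ` P))\<^sup>2"
      by (intro power_mono) auto
    also have "\<dots> = (energy C (uminus ` D))\<^sup>2 * (energy C (uminus ` P))\<^sup>2" by (simp add: power_mult_distrib)
    also have "\<dots> \<le> (F * ?d ^ 3) * (F * real (card P) ^ 3)"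
      using F(1)[of "uminus ` D"] F(1)[of "uminus ` P"] F(2) fD fP by (intro mult_mono) auto
    also have "\<dots> \<le> (F * ?d ^ 3) * (F * ?s ^ 3)"
    proof (intro mult_left_mono power_mono)
      show "real (card P) \<le> ?s" using fS by (simp add: P_def card_mono)
    qed (use F in auto)
    also have "((real (card K))\<^sup>2)\<^sup>2 = real (card K) ^ 4" by (simp flip: power_mult)
    finally show ?thesis by (simp add: power2_eq_square[of F] mult_ac)
  qed
  have "(?m ^ 4 * (?t\<^sup>2 * ?d\<^sup>2)) \<le> 32 * ?s * G * real (card K)"
  proof -
    have "(?m * (?t * ?d))\<^sup>2 \<le> (2 * real (card T))\<^sup>2" using cT by (intro power_mono) auto
    then have "(?m * (?t * ?d))\<^sup>2 \<le> 4 * (real (card R) * G)" using TR by (simp add: power_mult_distrib)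
    then have "?m\<^sup>2 * (?m * (?t * ?d))\<^sup>2 \<le> ?m\<^sup>2 * (4 * (real (card R) * G))" by (intro mult_left_mono) auto
    also have "\<dots> = 4 * G * (?m\<^sup>2 * real (card R))" by simp
    also have "\<dots> \<le> 4 * G * (8 * ?s * real (card K))" using RK G0 by (intro mult_left_mono) auto
    finally show ?thesis by (simp add: power_mult_distrib eval_nat_numeral mult_ac)
  qed
  then have "(?m ^ 4 * (?t\<^sup>2 * ?d\<^sup>2)) ^ 4 \<le> (32 * ?s * G * real (card K)) ^ 4" by (intro power_mono) auto
  also have "\<dots> = 2 ^ 20 * ?s ^ 4 * G ^ 4 * real (card K) ^ 4" by (simp add: power_mult_distrib)
  also have "\<dots> \<le> 2 ^ 20 * ?s ^ 4 * G ^ 4 * (F\<^sup>2 * ?d ^ 3 * ?s ^ 3)" using K4 by (intro mult_left_mono) auto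
  finally have main: "?m ^ 16 * (?t ^ 8 * ?d ^ 8) \<le> 2 ^ 20 * (?s ^ 4 * ?s ^ 3) * G ^ 4 * F\<^sup>2 * ?d ^ 3"
    by (simp add: power_mult_distrib mult_ac flip: power_mult)
  show ?thesis
  proof (cases "D = {}")
    case True
    then have "?m = 0" using popular by simp
    then show ?thesis using G0 by simp
  next
    case False
    then have d0: "0 < ?d" using fD by (simp add: card_gt_0_iff)
    have "(?m ^ 16 * (?t ^ 8 * ?d ^ 5)) * ?d ^ 3 \<le> (2 ^ 20 * ?s ^ 7 * G ^ 4 * F\<^sup>2) * ?d ^ 3"
    proof -
      have "(?m ^ 16 * (?t ^ 8 * ?d ^ 5)) * ?d ^ 3 = ?m ^ 16 * (?t ^ 8 * ?d ^ 8)" by (simp add: mult.assoc flip: power_add)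
      also note main
      also have "?s ^ 4 * ?s ^ 3 = ?s ^ 7" by (simp flip: power_add)
      finally show ?thesis .
    qed
    then have m5: "?m ^ 16 * (?t ^ 8 * ?d ^ 5) \<le> 2 ^ 20 * ?s ^ 7 * G ^ 4 * F\<^sup>2"
      using d0 by simp
    \<comment> \<open>The seventh power is chosen so that t^14 |D|^7 = (t^8 |D|^5) (t^3 |D|)^2,
      which are exactly the two quantities already bounded.\<close>
    have "?m ^ 44 = ?m ^ 16 * (?m ^ 4) ^ 7" by (simp flip: power_mult power_add)
    also have "\<dots> \<le> ?m ^ 16 * (64 * real J * ?s * (?t\<^sup>2 * ?d)) ^ 7"
      using popular by (intro mult_left_mono power_mono) auto
    also have "\<dots> = 2 ^ 42 * real J ^ 7 * ?s ^ 7 * ((?m ^ 16 * (?t ^ 8 * ?d ^ 5)) * (?t ^ 3 * ?d)\<^sup>2)"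
    proof -
      have "?t ^ 14 * ?d ^ 7 = (?t ^ 8 * ?d ^ 5) * (?t ^ 6 * ?d\<^sup>2)"
      proof -
        have "?t ^ 14 = ?t ^ 8 * ?t ^ 6" "?d ^ 7 = ?d ^ 5 * ?d\<^sup>2" by (simp_all flip: power_add)
        then show ?thesis by (simp only: mult_ac)
      qed
      then show ?thesis by (simp add: power_mult_distrib flip: power_mult)
    qed
    also have "\<dots> \<le> 2 ^ 42 * real J ^ 7 * ?s ^ 7 * ((2 ^ 20 * ?s ^ 7 * G ^ 4 * F\<^sup>2) * G\<^sup>2)"
      using m5 third F(2) G0 by (intro mult_left_mono[OF mult_mono] power_mono) auto
    also have "\<dots> = (2 ^ 42 * 2 ^ 20) * real J ^ 7 * (G ^ 4 * G\<^sup>2) * F\<^sup>2 * (?s ^ 7 * ?s ^ 7)" by (simp only: mult_ac)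
    also have "\<dots> = 2 ^ 62 * real J ^ 7 * G ^ 6 * F\<^sup>2 * ?s ^ 14" by (simp flip: power_add)
    finally show ?thesis by (simp add: S_def)
  qed
qed

section \<open>The main estimate\<close>

text \<open>The energy bounds for spread sets, inserted into the square of
  \<open>power8_le_energies\<close> with the difference set as \<open>\<Delta>\<close>; the power
  m^14 cancels.\<close>

lemma spread_difference_set:
  assumes sp: "spread \<kappa> h C" and \<kappa>: "1 \<le> \<kappa>" and h: "0 < h" "h ^ 3 \<le> real (card C)" and fin: "finite C"
    and J: "card C < 2 ^ J" "0 < J"
  shows "real (card C) ^ 2 * h ^ 18 \<le> 2 ^ 25 * real J ^ 4 * \<kappa> ^ 9 * real (card (sums_set C (uminus ` C))) ^ 5"
proof -
  let ?D = "sums_set C (uminus ` C)" and ?m = "real (card C)"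
  let ?s = "real (card ?D)"
  let ?G = "64 * real J * \<kappa> ^ 3 * ?m ^ 5 / h ^ 6"
  let ?F = "128 * real J ^ 2 * \<kappa> ^ 3 * ?m ^ 4 / h ^ 6"
  have m0: "0 < ?m" using h by (smt (verit) zero_less_power)
  have fD: "finite ?D" using fin by simp
  have mem: "b - c \<in> ?D" if "b \<in> C" "c \<in> C" for b c
    unfolding sums_set_def using that by (intro image_eqI[of _ _ "(b, - c)"]) auto
  have E0: "0 \<le> energy3 C" "0 \<le> energy C ?D" by (simp_all add: energy3_def energy_def sum_nonneg)
  have "?m ^ 16 = (?m ^ 8)\<^sup>2" by (simp flip: power_mult)
  also have "\<dots> \<le> (8 * ?s * energy3 C * energy C ?D)\<^sup>2"
    using power8_le_energies[OF fin fD mem] by (intro power_mono) auto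
  also have "\<dots> = 64 * ?s\<^sup>2 * (energy3 C)\<^sup>2 * (energy C ?D)\<^sup>2" by (simp add: power_mult_distrib)
  also have "\<dots> \<le> 64 * ?s\<^sup>2 * ?G\<^sup>2 * (?F * ?s ^ 3)"
    using spread_energy3[OF sp \<kappa> h fin J] spread_energy[OF sp \<kappa> h(1) fin fD J] E0 \<kappa> h
    by (intro mult_mono mult_left_mono power_mono) auto
  also have "\<dots> = 2 ^ 25 * real J ^ 4 * \<kappa> ^ 9 * ?s ^ 5 * ?m ^ 14 / h ^ 18"
    using h(1) by (simp add: power_mult_distrib power_divide field_simps flip: power_mult power_add)
  finally have "?m ^ 16 * h ^ 18 \<le> 2 ^ 25 * real J ^ 4 * \<kappa> ^ 9 * ?s ^ 5 * ?m ^ 14"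
    using h(1) by (simp add: field_simps)
  moreover have "?m ^ 16 * h ^ 18 = (?m\<^sup>2 * h ^ 18) * ?m ^ 14"
  proof -
    have "?m ^ 16 = ?m\<^sup>2 * ?m ^ 14" by (simp flip: power_add)
    then show ?thesis by (simp only: mult_ac)
  qed
  ultimately have "(?m\<^sup>2 * h ^ 18) * ?m ^ 14 \<le> (2 ^ 25 * real J ^ 4 * \<kappa> ^ 9 * ?s ^ 5) * ?m ^ 14" by linarith
  then show ?thesis using m0 by simp
qed

text \<open>The same energy bounds inserted as G and F into \<open>power44_le_energies\<close>; here
  m^38 cancels.\<close>

lemma spread_sum_set:
  assumes sp: "spread \<kappa> h C" and \<kappa>: "1 \<le> \<kappa>" and h: "0 < h" "h ^ 3 \<le> real (card C)" and fin: "finite C"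
    and J: "card C < 2 ^ J" "0 < J"
  shows "real (card C) ^ 6 * h ^ 48 \<le> 2 ^ 112 * real J ^ 17 * \<kappa> ^ 24 * real (card (sums_set C C)) ^ 14"
proof -
  let ?m = "real (card C)" and ?s = "real (card (sums_set C C))"
  let ?G = "64 * real J * \<kappa> ^ 3 * ?m ^ 5 / h ^ 6"
  let ?F = "128 * real J ^ 2 * \<kappa> ^ 3 * ?m ^ 4 / h ^ 6"
  have m0: "0 < ?m" using h by (smt (verit) zero_less_power)
  have F0: "0 \<le> ?F" using \<kappa> h by simp
  have "?m ^ 44 \<le> 2 ^ 62 * real J ^ 7 * ?G ^ 6 * ?F\<^sup>2 * ?s ^ 14"
    by (rule power44_le_energies[OF fin J spread_energy3[OF sp \<kappa> h fin J] spread_energy[OF sp \<kappa> h(1) fin _ J] F0])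
  also have "\<dots> = 2 ^ 112 * real J ^ 17 * \<kappa> ^ 24 * ?s ^ 14 * ?m ^ 38 / h ^ 48"
  proof -
    have G6: "?G ^ 6 = 2 ^ 36 * real J ^ 6 * \<kappa> ^ 18 * ?m ^ 30 / h ^ 36"
      by (simp add: power_mult_distrib power_divide flip: power_mult)
    have F2: "?F\<^sup>2 = 2 ^ 14 * real J ^ 4 * \<kappa> ^ 6 * ?m ^ 8 / h ^ 12"
      by (simp add: power_mult_distrib power_divide flip: power_mult)
    have "2 ^ 62 * real J ^ 7 * (2 ^ 36 * real J ^ 6 * \<kappa> ^ 18 * ?m ^ 30 / h ^ 36) * (2 ^ 14 * real J ^ 4 * \<kappa> ^ 6 * ?m ^ 8 / h ^ 12) * ?s ^ 14
       = (2 ^ 62 * 2 ^ 36 * 2 ^ 14) * (real J ^ 7 * real J ^ 6 * real J ^ 4) * (\<kappa> ^ 18 * \<kappa> ^ 6) * ?s ^ 14 * (?m ^ 30 * ?m ^ 8) / (h ^ 36 * h ^ 12)"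
      by (simp only: times_divide_eq_left times_divide_eq_right divide_divide_eq_left mult_ac)
    then show ?thesis unfolding G6 F2 by (simp flip: power_add)
  qed
  finally have "?m ^ 44 * h ^ 48 \<le> 2 ^ 112 * real J ^ 17 * \<kappa> ^ 24 * ?s ^ 14 * ?m ^ 38"
    using h(1) by (simp add: pos_le_divide_eq)
  moreover have "?m ^ 44 * h ^ 48 = (?m ^ 6 * h ^ 48) * ?m ^ 38"
  proof -
    have "?m ^ 44 = ?m ^ 6 * ?m ^ 38" by (simp flip: power_add)
    then show ?thesis by (simp only: mult_ac)
  qed
  ultimately have "(?m ^ 6 * h ^ 48) * ?m ^ 38 \<le> (2 ^ 112 * real J ^ 17 * \<kappa> ^ 24 * ?s ^ 14) * ?m ^ 38" by linarith
  then show ?thesis using m0 by simp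
qed

lemma energy3_mono:
  assumes "finite A" "B \<subseteq> A"
  shows "energy3 B \<le> energy3 A"
proof -
  have fB: "finite B" using assms finite_subset by blast
  have "energy3 B \<le> (\<Sum>z\<in>sums_set B (uminus ` B). (real (rep A (uminus ` A) z)) ^ 3)"
    unfolding energy3_def using assms
    by (intro sum_mono power_mono) (auto intro!: rep_mono)
  also have "\<dots> \<le> energy3 A" unfolding energy3_def
  proof (rule sum_mono2)
    show "sums_set B (uminus ` B) \<subseteq> sums_set A (uminus ` A)"
      unfolding sums_set_def using assms by (intro image_mono) auto
  qed (use assms in auto)
  finally show ?thesis .
qed

section \<open>Sizes of the difference, product and quotient sets\<close>

lemma finite_diffset: "finite A \<Longrightarrow> finite (diffset A)"
  unfolding diffset_def by (rule finite_subset[of _ "(\<lambda>(a, b). a - b) ` (A \<times> A)"]) auto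

lemma finite_prodset: "finite A \<Longrightarrow> finite (prodset A)"
  unfolding prodset_def by (rule finite_subset[of _ "(\<lambda>(a, b). a * b) ` (A \<times> A)"]) auto

lemma finite_quotset: "finite A \<Longrightarrow> finite (quotset A)"
  unfolding quotset_def by (rule finite_subset[of _ "(\<lambda>(a, b). a / b) ` (A \<times> A)"]) auto

lemma card_diffset_le:
  assumes "finite A" shows "card (diffset A) \<le> (card A)\<^sup>2"
proof -
  have "diffset A = (\<lambda>(a, b). a - b) ` (A \<times> A)" by (auto simp: diffset_def)
  then show ?thesis
    using card_image_le[of "A \<times> A" "\<lambda>(a, b). a - b"] assms by (simp add: card_cartesian_product power2_eq_square)
qed

lemma card_le_diffset:
  assumes "finite A" "A \<noteq> {}" shows "card A \<le> card (diffset A)"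
proof -
  obtain b where "b \<in> A" using assms by blast
  then show ?thesis
    using finite_diffset[OF assms(1)]
    by (intro card_inj_on_le[of "\<lambda>a. a - b"]) (auto simp: diffset_def inj_on_def)
qed

text \<open>The set \<open>B\<close> below is the complement of a maximal spread out subset, so by maximality its energy with
  \<open>A - A\<close> is small.\<close>

lemma power20_le_of_no_spread_subset:
  assumes A: "finite A" "A \<noteq> {}" "\<And>a. a \<in> A \<Longrightarrow> 0 < a" and J: "(card A)\<^sup>2 < 2 ^ J" "0 < J"
    and q: "\<And>X Y. X \<subseteq> A \<Longrightarrow> Y \<subseteq> A \<Longrightarrow> (real (card X) * real (card Y))\<^sup>2 \<le> q * real (cross_energy X Y)"
    and q0: "0 \<le> q" and h: "0 < h"
    and none: "\<And>C. C \<subseteq> A \<Longrightarrow> spread (36 * real J) h (ln ` C) \<Longrightarrow> 2 * card C < card A"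
  shows "real (card A) ^ 20 \<le> 2 ^ 118 * real J ^ 11 * q ^ 3 * h ^ 12 * real (card (diffset A)) ^ 10"
proof -
  let ?n = "real (card A)" and ?D = "diffset A"
  let ?d = "real (card ?D)"
  let ?good = "\<lambda>C. C \<subseteq> A \<and> spread (36 * real J) h (ln ` C)"
  have "finite {C. ?good C}" by (rule finite_subset[of _ "Pow A"]) (use A in auto)
  moreover have "{} \<in> {C. ?good C}" by (simp add: spread_empty)
  ultimately have "\<exists>C\<in>{C. ?good C}. \<forall>C'\<in>{C. ?good C}. C \<subseteq> C' \<longrightarrow> C = C'"
    by (intro finite_has_maximal) auto
  then obtain C where C: "?good C" and max: "\<forall>C'\<in>{C. ?good C}. C \<subseteq> C' \<longrightarrow> C = C'" by (elim bexE) simp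
  define B where "B = A - C"
  have BA: "B \<subseteq> A" by (auto simp: B_def)
  have fC: "finite C" and fB: "finite B" using A C BA finite_subset by blast+
  have fD: "finite ?D" by (rule finite_diffset[OF A(1)])
  have "card B = card A - card C" unfolding B_def using C fC by (intro card_Diff_subset) auto
  then have halfB: "card A \<le> 2 * card B" using none[of C] C by linarith
  have inj: "inj_on ln X" if "X \<subseteq> A" for X
    using that A(3) by (intro inj_onI) (meson ln_inj_iff subsetD)
  have n0: "0 < card A" using A by (simp add: card_gt_0_iff)
  \<comment> \<open>The threshold is measured with |A|, not |B|. Above it, B would contain a
    nonempty spread set disjoint from C, and adding it to C would contradict maximality.\<close>
  have E: "(energy B ?D)\<^sup>2 \<le> 16 * real J ^ 2 * h ^ 6 * ?n * ?d ^ 3"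
  proof (rule ccontr)
    assume "\<not> ?thesis"
    then have big: "16 * real J ^ 2 * h ^ 6 * ?n * ?d ^ 3 < (energy B ?D)\<^sup>2" by simp
    have pos: "\<And>b. b \<in> B \<Longrightarrow> 0 < b" using A(3) BA by blast
    have cB: "card B \<le> card A" using A(1) BA by (rule card_mono)
    have cD: "card ?D < 2 ^ J" using card_diffset_le[OF A(1)] J by linarith
    obtain A' where A': "A' \<subseteq> B" "A' \<noteq> {}" "spread (36 * real J) h (ln ` A')"
      by (rule spread_of_large_energy[OF fB fD pos cB card_le_diffset[OF A(1,2)] n0 cD J(2) h big])
    have sub: "C \<subseteq> A" "A' \<subseteq> A" using C A'(1) BA by blast+
    have "ln ` C \<inter> ln ` A' = ln ` (C \<inter> A')"
      by (rule inj_on_image_Int[OF inj[OF order_refl] sub, symmetric])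
    also have "\<dots> = {}" using A' by (auto simp: B_def)
    finally have disj: "ln ` C \<inter> ln ` A' = {}" .
    have "finite A'" using A' fB finite_subset by blast
    then have "spread (36 * real J) h (ln ` C \<union> ln ` A')"
      using C A' fC disj by (intro spread_Un) auto
    then have "?good (C \<union> A')" using C A' BA by (auto simp: image_Un)
    then have "C = C \<union> A'" using max by simp
    then show False using A' by (auto simp: B_def)
  qed
  have E0: "0 \<le> energy3 B" "0 \<le> energy B ?D" by (simp_all add: energy3_def energy_def sum_nonneg)
  have mem: "b - c \<in> ?D" if "b \<in> B" "c \<in> B" for b c using that BA by (auto simp: diffset_def)
  have A0: "0 \<notin> A" using A(3) by force
  have "?n ^ 20 * ?n ^ 12 = ?n ^ 32" by (simp flip: power_add)
  also have "\<dots> \<le> (2 * real (card B)) ^ 32"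
  proof (rule power_mono)
    show "?n \<le> 2 * real (card B)" using of_nat_mono[OF halfB, where ?'a = real] by simp
  qed simp
  also have "\<dots> = 2 ^ 32 * (real (card B) ^ 8) ^ 4" by (simp add: power_mult_distrib flip: power_mult)
  also have "\<dots> \<le> 2 ^ 32 * (8 * ?d * energy3 B * energy B ?D) ^ 4"
    using power8_le_energies[OF fB fD mem] by (intro mult_left_mono power_mono) auto
  also have "\<dots> = 2 ^ 44 * ?d ^ 4 * energy3 B ^ 4 * ((energy B ?D)\<^sup>2)\<^sup>2"
    by (simp add: power_mult_distrib flip: power_mult)
  also have "\<dots> \<le> 2 ^ 44 * ?d ^ 4 * (4096 * 189104 ^ 3 * real J ^ 7 * q ^ 3 * ?n ^ 10) * (16 * real J ^ 2 * h ^ 6 * ?n * ?d ^ 3)\<^sup>2"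
  proof -
    have "energy3 B ^ 4 \<le> energy3 A ^ 4"
      using E0 energy3_mono[OF A(1) BA] by (intro power_mono) auto
    also have "\<dots> \<le> 4096 * 189104 ^ 3 * real J ^ 7 * q ^ 3 * ?n ^ 10"
      by (rule energy3_le[OF A(1,2) A0 J q q0])
    finally have "energy3 B ^ 4 \<le> 4096 * 189104 ^ 3 * real J ^ 7 * q ^ 3 * ?n ^ 10" .
    moreover have "((energy B ?D)\<^sup>2)\<^sup>2 \<le> (16 * real J ^ 2 * h ^ 6 * ?n * ?d ^ 3)\<^sup>2"
      using E by (intro power_mono) auto
    ultimately show ?thesis
      using q0 by (intro mult_mono[OF mult_left_mono]) auto
  qed
  also have "\<dots> = (2 ^ 64 * 189104 ^ 3) * real J ^ 11 * q ^ 3 * h ^ 12 * ?d ^ 10 * ?n ^ 12"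
  proof -
    have sq: "(16 * real J ^ 2 * h ^ 6 * ?n * ?d ^ 3)\<^sup>2 = 256 * real J ^ 4 * h ^ 12 * ?n\<^sup>2 * ?d ^ 6"
      by (simp add: power_mult_distrib flip: power_mult)
    have "2 ^ 44 * ?d ^ 4 * (4096 * 189104 ^ 3 * real J ^ 7 * q ^ 3 * ?n ^ 10) * (256 * real J ^ 4 * h ^ 12 * ?n\<^sup>2 * ?d ^ 6)
       = (2 ^ 44 * 4096 * 256 * 189104 ^ 3) * (real J ^ 7 * real J ^ 4) * q ^ 3 * h ^ 12 * (?d ^ 4 * ?d ^ 6) * (?n ^ 10 * ?n\<^sup>2)"
      by (simp only: mult_ac)
    then show ?thesis unfolding sq by (simp flip: power_add)
  qed
  \<comment> \<open>Since 189104 < 2^18, the constant is below 2^(64 + 54).\<close>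
  also have "\<dots> \<le> 2 ^ 118 * real J ^ 11 * q ^ 3 * h ^ 12 * ?d ^ 10 * ?n ^ 12"
    using q0 h by (intro mult_right_mono) auto
  finally have "?n ^ 20 * ?n ^ 12 \<le> (2 ^ 118 * real J ^ 11 * q ^ 3 * h ^ 12 * ?d ^ 10) * ?n ^ 12" .
  then show ?thesis by (rule mult_right_le_imp_le) (use n0 in simp)
qed

section \<open>Products and quotients as multiplicative energies and as sums of logarithms\<close>

lemma cross_energy_quotset:
  assumes "finite A" "X \<subseteq> A" "Y \<subseteq> A" "0 \<notin> A"
  shows "(real (card X) * real (card Y))\<^sup>2 \<le> real (card (quotset A)) * real (cross_energy X Y)"
proof -
  let ?f = "\<lambda>p. fst p / snd p :: real"
  have fin: "finite (X \<times> Y)" using assms finite_subset by (intro finite_cartesian_product) blast+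
  have "(real (card (X \<times> Y)))\<^sup>2 \<le> real (card (?f ` (X \<times> Y))) * real (card {(p, q). p \<in> X \<times> Y \<and> q \<in> X \<times> Y \<and> ?f p = ?f q})"
    by (rule card_square_le_image_times_collisions[OF fin])
  also have "\<dots> \<le> real (card (quotset A)) * real (cross_energy X Y)"
  proof (intro mult_mono)
    have "?f ` (X \<times> Y) \<subseteq> quotset A" using assms by (force simp: quotset_def)
    then show "real (card (?f ` (X \<times> Y))) \<le> real (card (quotset A))"
      using finite_quotset[OF assms(1)] by (simp add: card_mono)
    have nz: "y \<noteq> 0" if "y \<in> Y" for y using that assms by blast
    have "{(p, q). p \<in> X \<times> Y \<and> q \<in> X \<times> Y \<and> ?f p = ?f q} = {(p, q). p \<in> X \<times> Y \<and> q \<in> X \<times> Y \<and> fst p * snd q = fst q * snd p}"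
      using nz by (auto simp: frac_eq_eq)
    then show "real (card {(p, q). p \<in> X \<times> Y \<and> q \<in> X \<times> Y \<and> ?f p = ?f q}) \<le> real (cross_energy X Y)"
      by (simp add: cross_energy_def)
  qed auto
  finally show ?thesis by (simp add: card_cartesian_product)
qed

text \<open>Exchanging the second coordinates turns x y = x' y' into x y = x' y' in cross-multiplied
  form, so equal products are as numerous as the solutions in \<open>cross_energy\<close>.\<close>

lemma cross_energy_prodset:
  assumes "finite A" "X \<subseteq> A" "Y \<subseteq> A"
  shows "(real (card X) * real (card Y))\<^sup>2 \<le> real (card (prodset A)) * real (cross_energy X Y)"
proof -
  let ?f = "\<lambda>p. fst p * snd p :: real"
  have fin: "finite (X \<times> Y)" using assms finite_subset by (intro finite_cartesian_product) blast+
  have "(real (card (X \<times> Y)))\<^sup>2 \<le> real (card (?f ` (X \<times> Y))) * real (card {(p, q). p \<in> X \<times> Y \<and> q \<in> X \<times> Y \<and> ?f p = ?f q})"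
    by (rule card_square_le_image_times_collisions[OF fin])
  also have "\<dots> \<le> real (card (prodset A)) * real (cross_energy X Y)"
  proof (intro mult_mono)
    have "?f ` (X \<times> Y) \<subseteq> prodset A" using assms by (force simp: prodset_def)
    then show "real (card (?f ` (X \<times> Y))) \<le> real (card (prodset A))"
      using finite_prodset[OF assms(1)] by (simp add: card_mono)
    have "card {(p, q). p \<in> X \<times> Y \<and> q \<in> X \<times> Y \<and> ?f p = ?f q} = cross_energy X Y"
      unfolding cross_energy_def
      by (rule bij_betw_same_card[of "\<lambda>(p, q). ((fst p, snd q), (fst q, snd p))"],
          rule bij_betwI[of _ _ _ "\<lambda>(p, q). ((fst p, snd q), (fst q, snd p))"]) auto
    then show "real (card {(p, q). p \<in> X \<times> Y \<and> q \<in> X \<times> Y \<and> ?f p = ?f q}) \<le> real (cross_energy X Y)"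
      by simp
  qed auto
  finally show ?thesis by (simp add: card_cartesian_product)
qed

lemma card_difference_ln_le:
  assumes "finite A" "C \<subseteq> A" "\<And>a. a \<in> A \<Longrightarrow> 0 < a"
  shows "card (sums_set (ln ` C) (uminus ` ln ` C)) \<le> card (quotset A)"
proof -
  have "sums_set (ln ` C) (uminus ` ln ` C) \<subseteq> ln ` quotset A"
  proof
    fix z assume "z \<in> sums_set (ln ` C) (uminus ` ln ` C)"
    then obtain a b where ab: "a \<in> C" "b \<in> C" "z = ln a - ln b" by (auto simp: sums_set_def)
    then have "z = ln (a / b)" using assms by (subst ln_div) auto
    moreover have "a / b \<in> quotset A" using ab assms by (auto simp: quotset_def)
    ultimately show "z \<in> ln ` quotset A" by blast
  qed
  then have "card (sums_set (ln ` C) (uminus ` ln ` C)) \<le> card (ln ` quotset A)"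
    using finite_quotset[OF assms(1)] by (intro card_mono) auto
  also have "\<dots> \<le> card (quotset A)" by (rule card_image_le[OF finite_quotset[OF assms(1)]])
  finally show ?thesis .
qed

lemma card_sum_ln_le:
  assumes "finite A" "C \<subseteq> A" "\<And>a. a \<in> A \<Longrightarrow> 0 < a"
  shows "card (sums_set (ln ` C) (ln ` C)) \<le> card (prodset A)"
proof -
  have "sums_set (ln ` C) (ln ` C) \<subseteq> ln ` prodset A"
  proof
    fix z assume "z \<in> sums_set (ln ` C) (ln ` C)"
    then obtain a b where ab: "a \<in> C" "b \<in> C" "z = ln a + ln b" by (auto simp: sums_set_def)
    then have "z = ln (a * b)" using assms by (subst ln_mult_pos) auto
    moreover have "a * b \<in> prodset A" using ab assms by (auto simp: prodset_def)
    ultimately show "z \<in> ln ` prodset A" by blast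
  qed
  then have "card (sums_set (ln ` C) (ln ` C)) \<le> card (ln ` prodset A)"
    using finite_prodset[OF assms(1)] by (intro card_mono) auto
  also have "\<dots> \<le> card (prodset A)" by (rule card_image_le[OF finite_prodset[OF assms(1)]])
  finally show ?thesis .
qed

section \<open>Choice of the threshold h\<close>

text \<open>If both sizes are at most \<open>\<mu>\<close>, the alternatives give the exponents 8/5
  and 64/49; the second is the smaller and equals 1 + 15/49.\<close>

lemma power64_le_quotient:
  assumes A: "finite A" "A \<noteq> {}" "\<And>a. a \<in> A \<Longrightarrow> 0 < a" and J: "(card A)\<^sup>2 < 2 ^ J" "0 < J"
  defines "n \<equiv> real (card A)" and "q \<equiv> real (card (quotset A))" and "d \<equiv> real (card (diffset A))"
  shows "n ^ 8 \<le> 2 ^ 81 * real J ^ 13 * q ^ 5 \<or> n ^ 64 \<le> 2 ^ 504 * real J ^ 59 * q ^ 19 * d ^ 30"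
proof (rule disjCI)
  assume large: "\<not> n ^ 64 \<le> 2 ^ 504 * real J ^ 59 * q ^ 19 * d ^ 30"
  have n1: "1 \<le> n" using A by (simp add: n_def Suc_le_eq card_gt_0_iff)
  have J1: "1 \<le> real J" using J by simp
  have q1: "1 \<le> q"
  proof -
    obtain a where "a \<in> A" using A by blast
    then have "quotset A \<noteq> {}" by (auto simp: quotset_def)
    then show ?thesis using finite_quotset[OF A(1)] by (simp add: q_def Suc_le_eq card_gt_0_iff)
  qed
  have A0: "0 \<notin> A" using A(3) by force
  \<comment> \<open>Chosen just large enough to contradict \<open>spread_difference_set\<close> for
    a spread half of size at least h^3: as n <= 2 m and \<kappa> = 36 J, the contradiction needs 4 *
    2^25 * 36^9 < 2^75.\<close>
  define h where "h = root 18 (2 ^ 75 * real J ^ 13 * q ^ 5 / n\<^sup>2)"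
  have hpos: "0 < 2 ^ 75 * real J ^ 13 * q ^ 5 / n\<^sup>2" using n1 J1 q1 by simp
  then have h: "0 < h" "h ^ 18 = 2 ^ 75 * real J ^ 13 * q ^ 5 / n\<^sup>2" by (simp_all add: h_def)
  have "\<exists>C\<subseteq>A. spread (36 * real J) h (ln ` C) \<and> \<not> 2 * card C < card A"
  proof (rule ccontr)
    assume "\<not> ?thesis"
    then have none: "\<And>C. C \<subseteq> A \<Longrightarrow> spread (36 * real J) h (ln ` C) \<Longrightarrow> 2 * card C < card A" by blast
    have "n ^ 20 \<le> 2 ^ 118 * real J ^ 11 * q ^ 3 * h ^ 12 * d ^ 10"
      unfolding n_def d_def
      by (rule power20_le_of_no_spread_subset[OF A J _ _ h(1) none])
        (use cross_energy_quotset A A0 q1 in \<open>auto simp: q_def\<close>)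
    then have "(n ^ 20) ^ 3 \<le> (2 ^ 118 * real J ^ 11 * q ^ 3 * h ^ 12 * d ^ 10) ^ 3"
      using n1 by (intro power_mono) auto
    also have "\<dots> = 2 ^ 354 * real J ^ 33 * q ^ 9 * (h ^ 18)\<^sup>2 * d ^ 30"
      by (simp add: power_mult_distrib flip: power_mult)
    also have "(h ^ 18)\<^sup>2 = 2 ^ 150 * real J ^ 26 * q ^ 10 / n ^ 4"
      unfolding h(2) by (simp add: power_mult_distrib power_divide flip: power_mult)
    finally have "(n ^ 20) ^ 3 * n ^ 4 \<le> 2 ^ 354 * real J ^ 33 * q ^ 9 * (2 ^ 150 * real J ^ 26 * q ^ 10) * d ^ 30"
      using n1 by (simp add: field_simps)
    also have "\<dots> = (2 ^ 354 * 2 ^ 150) * (real J ^ 33 * real J ^ 26) * (q ^ 9 * q ^ 10) * d ^ 30" by (simp only: mult_ac)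
    finally show False using large by (simp flip: power_add power_mult)
  qed
  then obtain C where C: "C \<subseteq> A" "spread (36 * real J) h (ln ` C)" "card A \<le> 2 * card C" by auto
  define m where "m = real (card C)"
  have nm: "n \<le> 2 * m" using of_nat_mono[OF C(3), where ?'a = real] by (simp add: n_def m_def)
  have fC: "finite C" using C A finite_subset by blast
  have "inj_on ln C" using C A(3) by (intro inj_onI) (meson ln_inj_iff subsetD)
  then have cln: "card (ln ` C) = card C" by (rule card_image)
  have "card C \<le> card A" "card A \<le> (card A)\<^sup>2"
    using A C by (auto simp: card_mono power2_nat_le_imp_le)
  then have JC: "card (ln ` C) < 2 ^ J" using J cln by linarith
  \<comment> \<open>A spread half can therefore only exist when h^3 exceeds its size; with the value
    of h this is the first alternative.\<close>
  have "m < h ^ 3"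
  proof (rule ccontr)
    assume "\<not> m < h ^ 3"
    then have hm: "h ^ 3 \<le> real (card (ln ` C))" by (simp add: cln m_def)
    have "m ^ 2 * h ^ 18 \<le> 2 ^ 25 * real J ^ 4 * (36 * real J) ^ 9 * real (card (sums_set (ln ` C) (uminus ` ln ` C))) ^ 5"
      using spread_difference_set[OF C(2) _ h(1) hm _ JC J(2)] fC J1 by (simp add: cln m_def)
    also have "\<dots> \<le> 2 ^ 25 * real J ^ 4 * (36 * real J) ^ 9 * q ^ 5"
      unfolding q_def using card_difference_ln_le[OF A(1) C(1) A(3)]
      by (intro mult_left_mono power_mono) auto
    also have "\<dots> = (2 ^ 25 * 36 ^ 9) * (real J ^ 4 * real J ^ 9) * q ^ 5" by (simp only: power_mult_distrib mult_ac)
    also have "\<dots> = (2 ^ 25 * 36 ^ 9) * real J ^ 13 * q ^ 5" by (simp flip: power_add)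
    finally have le: "m ^ 2 * h ^ 18 \<le> (2 ^ 25 * 36 ^ 9) * real J ^ 13 * q ^ 5" .
    have pos: "0 < real J ^ 13 * q ^ 5" using J1 q1 by simp
    have "2 ^ 75 * (real J ^ 13 * q ^ 5) = n\<^sup>2 * h ^ 18" unfolding h(2) using n1 by simp
    also have "\<dots> \<le> (2 * m)\<^sup>2 * h ^ 18" using nm n1 h(1) by (intro mult_right_mono power_mono) auto
    also have "\<dots> = 4 * (m\<^sup>2 * h ^ 18)" by (simp add: power_mult_distrib)
    also have "\<dots> \<le> 4 * ((2 ^ 25 * 36 ^ 9) * (real J ^ 13 * q ^ 5))"
      using le by (simp only: mult.assoc mult_le_cancel_left_pos zero_less_numeral)
    finally have "2 ^ 75 * (real J ^ 13 * q ^ 5) \<le> (4 * (2 ^ 25 * 36 ^ 9)) * (real J ^ 13 * q ^ 5)" by simp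
    then have "(2::real) ^ 75 \<le> 4 * (2 ^ 25 * 36 ^ 9)" using pos by (rule mult_right_le_imp_le)
    then show False by simp
  qed
  then have "n \<le> 2 * h ^ 3" using nm by simp
  then have "n ^ 6 \<le> (2 * h ^ 3) ^ 6" using n1 by (intro power_mono) auto
  also have "\<dots> = 64 * h ^ 18" by (simp add: power_mult_distrib flip: power_mult)
  finally have "n ^ 6 * n\<^sup>2 \<le> 64 * (2 ^ 75 * real J ^ 13 * q ^ 5)" unfolding h(2) using n1 by (simp add: field_simps)
  then show "n ^ 8 \<le> 2 ^ 81 * real J ^ 13 * q ^ 5" by (simp flip: power_add)
qed

text \<open>The alternatives give the exponents 22/14 and 86/66. The latter is 43/33, slightly more
  than 1 + 105/347.\<close>

lemma power86_le_product:
  assumes A: "finite A" "A \<noteq> {}" "\<And>a. a \<in> A \<Longrightarrow> 0 < a" and J: "(card A)\<^sup>2 < 2 ^ J" "0 < J"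
  defines "n \<equiv> real (card A)" and "q \<equiv> real (card (prodset A))" and "d \<equiv> real (card (diffset A))"
  shows "n ^ 22 \<le> 2 ^ 260 * real J ^ 41 * q ^ 14 \<or> n ^ 86 \<le> 2 ^ 716 * real J ^ 85 * q ^ 26 * d ^ 40"
proof (rule disjCI)
  assume large: "\<not> n ^ 86 \<le> 2 ^ 716 * real J ^ 85 * q ^ 26 * d ^ 40"
  have n1: "1 \<le> n" using A by (simp add: n_def Suc_le_eq card_gt_0_iff)
  have J1: "1 \<le> real J" using J by simp
  have q1: "1 \<le> q"
  proof -
    obtain a where "a \<in> A" using A by blast
    then have "prodset A \<noteq> {}" by (auto simp: prodset_def)
    then show ?thesis using finite_prodset[OF A(1)] by (simp add: q_def Suc_le_eq card_gt_0_iff)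
  qed
  \<comment> \<open>As for quotients, with \<open>spread_sum_set\<close>: the contradiction for a
    spread half needs 64 * 2^112 * 36^24 < 2^244, where 64 = 2^6 comes from n^6 <= (2 m)^6.\<close>
  define h where "h = root 48 (2 ^ 244 * real J ^ 41 * q ^ 14 / n ^ 6)"
  have hpos: "0 < 2 ^ 244 * real J ^ 41 * q ^ 14 / n ^ 6" using n1 J1 q1 by simp
  then have h: "0 < h" "h ^ 48 = 2 ^ 244 * real J ^ 41 * q ^ 14 / n ^ 6" by (simp_all add: h_def)
  have "\<exists>C\<subseteq>A. spread (36 * real J) h (ln ` C) \<and> \<not> 2 * card C < card A"
  proof (rule ccontr)
    assume "\<not> ?thesis"
    then have none: "\<And>C. C \<subseteq> A \<Longrightarrow> spread (36 * real J) h (ln ` C) \<Longrightarrow> 2 * card C < card A" by blast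
    have "n ^ 20 \<le> 2 ^ 118 * real J ^ 11 * q ^ 3 * h ^ 12 * d ^ 10"
      unfolding n_def d_def
      by (rule power20_le_of_no_spread_subset[OF A J _ _ h(1) none])
        (use cross_energy_prodset A q1 in \<open>auto simp: q_def\<close>)
    then have "(n ^ 20) ^ 4 \<le> (2 ^ 118 * real J ^ 11 * q ^ 3 * h ^ 12 * d ^ 10) ^ 4"
      using n1 by (intro power_mono) auto
    also have "\<dots> = 2 ^ 472 * real J ^ 44 * q ^ 12 * h ^ 48 * d ^ 40"
      by (simp add: power_mult_distrib flip: power_mult)
    finally have "(n ^ 20) ^ 4 * n ^ 6 \<le> 2 ^ 472 * real J ^ 44 * q ^ 12 * (2 ^ 244 * real J ^ 41 * q ^ 14) * d ^ 40"
      unfolding h(2) using n1 by (simp add: field_simps)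
    also have "\<dots> = (2 ^ 472 * 2 ^ 244) * (real J ^ 44 * real J ^ 41) * (q ^ 12 * q ^ 14) * d ^ 40" by (simp only: mult_ac)
    finally show False using large by (simp flip: power_add power_mult)
  qed
  then obtain C where C: "C \<subseteq> A" "spread (36 * real J) h (ln ` C)" "card A \<le> 2 * card C" by auto
  define m where "m = real (card C)"
  have nm: "n \<le> 2 * m" using of_nat_mono[OF C(3), where ?'a = real] by (simp add: n_def m_def)
  have fC: "finite C" using C A finite_subset by blast
  have "inj_on ln C" using C A(3) by (intro inj_onI) (meson ln_inj_iff subsetD)
  then have cln: "card (ln ` C) = card C" by (rule card_image)
  have "card C \<le> card A" "card A \<le> (card A)\<^sup>2"
    using A C by (auto simp: card_mono power2_nat_le_imp_le)
  then have JC: "card (ln ` C) < 2 ^ J" using J cln by linarith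
  have "m < h ^ 3"
  proof (rule ccontr)
    assume "\<not> m < h ^ 3"
    then have hm: "h ^ 3 \<le> real (card (ln ` C))" by (simp add: cln m_def)
    have "m ^ 6 * h ^ 48 \<le> 2 ^ 112 * real J ^ 17 * (36 * real J) ^ 24 * real (card (sums_set (ln ` C) (ln ` C))) ^ 14"
      using spread_sum_set[OF C(2) _ h(1) hm _ JC J(2)] fC J1 by (simp add: cln m_def)
    also have "\<dots> \<le> 2 ^ 112 * real J ^ 17 * (36 * real J) ^ 24 * q ^ 14"
      unfolding q_def using card_sum_ln_le[OF A(1) C(1) A(3)]
      by (intro mult_left_mono power_mono) auto
    also have "\<dots> = (2 ^ 112 * 36 ^ 24) * (real J ^ 17 * real J ^ 24) * q ^ 14" by (simp only: power_mult_distrib mult_ac)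
    also have "\<dots> = (2 ^ 112 * 36 ^ 24) * real J ^ 41 * q ^ 14" by (simp flip: power_add)
    finally have le: "m ^ 6 * h ^ 48 \<le> (2 ^ 112 * 36 ^ 24) * real J ^ 41 * q ^ 14" .
    have pos: "0 < real J ^ 41 * q ^ 14" using J1 q1 by simp
    have "2 ^ 244 * (real J ^ 41 * q ^ 14) = n ^ 6 * h ^ 48" unfolding h(2) using n1 by simp
    also have "\<dots> \<le> (2 * m) ^ 6 * h ^ 48" using nm n1 h(1) by (intro mult_right_mono power_mono) auto
    also have "\<dots> = 64 * (m ^ 6 * h ^ 48)" by (simp add: power_mult_distrib)
    also have "\<dots> \<le> 64 * ((2 ^ 112 * 36 ^ 24) * (real J ^ 41 * q ^ 14))"
      using le by (simp only: mult.assoc mult_le_cancel_left_pos zero_less_numeral)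
    finally have "2 ^ 244 * (real J ^ 41 * q ^ 14) \<le> (64 * (2 ^ 112 * 36 ^ 24)) * (real J ^ 41 * q ^ 14)" by simp
    then have "(2::real) ^ 244 \<le> 64 * (2 ^ 112 * 36 ^ 24)" using pos by (rule mult_right_le_imp_le)
    then show False by simp
  qed
  then have "n \<le> 2 * h ^ 3" using nm by simp
  then have "n ^ 16 \<le> (2 * h ^ 3) ^ 16" using n1 by (intro power_mono) auto
  also have "\<dots> = 2 ^ 16 * h ^ 48" by (simp add: power_mult_distrib flip: power_mult)
  finally have "n ^ 16 * n ^ 6 \<le> 2 ^ 16 * (2 ^ 244 * real J ^ 41 * q ^ 14)" unfolding h(2) using n1 by (simp add: field_simps)
  then show "n ^ 22 \<le> 2 ^ 260 * real J ^ 41 * q ^ 14" by (simp flip: power_add)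
qed

section \<open>From integer powers to real exponents and logarithms\<close>

text \<open>Taking s-th roots. The constants 19 and 3 are 260/14 and 41/14 rounded up, the worst
  ratios among the four inequalities to which this is applied.\<close>

lemma powr_le_of_power_le:
  fixes n \<mu> J e c :: real and a b p s :: nat
  assumes le: "n ^ a \<le> 2 ^ p * J ^ b * \<mu> ^ s" and n: "1 \<le> n" and J: "1 \<le> J" and \<mu>: "0 < \<mu>"
    and s: "0 < s" "p \<le> 19 * s" "b \<le> 3 * s" and e: "e * real s \<le> real a"
  shows "n powr e \<le> 2 ^ 19 * J ^ 3 * \<mu>"
proof -
  have "(n powr e) ^ s = n powr (e * real s)" using n by (simp add: powr_powr flip: powr_realpow)
  also have "\<dots> \<le> n powr real a" using e n by (intro powr_mono) auto
  also have "\<dots> = n ^ a" using n by (simp add: powr_realpow)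
  also note le
  also have "2 ^ p * J ^ b * \<mu> ^ s \<le> 2 ^ (19 * s) * J ^ (3 * s) * \<mu> ^ s"
    using s J \<mu> by (intro mult_right_mono mult_mono power_increasing) auto
  also have "\<dots> = (2 ^ 19 * J ^ 3 * \<mu>) ^ s" by (simp add: power_mult_distrib power_mult)
  finally show ?thesis using s(1) J \<mu> power_mono_iff[of "n powr e" "2 ^ 19 * J ^ 3 * \<mu>" s] by simp
qed

text \<open>Twice the rounded-up binary logarithm, because the square of n has to stay below
  2^J.\<close>

lemma exists_dyadic_bound:
  assumes "1 \<le> n"
  obtains J :: nat where "0 < J" "n\<^sup>2 < 2 ^ J" "real J \<le> 6 * ln (2 + real n)"
proof
  define k where "k = nat \<lceil>log 2 (2 + real n)\<rceil>"
  let ?l = "ln (2 + real n)"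
  have l1: "1 \<le> ?l"
  proof -
    have "exp 1 \<le> 2 + real n" using exp_le assms by linarith
    then show ?thesis by (simp add: ln_ge_iff)
  qed
  have log_pos: "0 < log 2 (2 + real n)" by (simp add: zero_less_log_cancel_iff)
  have k: "log 2 (2 + real n) \<le> real k" "real k < log 2 (2 + real n) + 1"
    unfolding k_def using log_pos by linarith+
  show "0 < 2 * k" using k log_pos by linarith
  have "2 + real n \<le> 2 ^ k"
  proof -
    have "2 + real n = 2 powr log 2 (2 + real n)" by simp
    also have "\<dots> \<le> 2 powr real k" using k by (intro powr_mono) auto
    finally show ?thesis by (simp add: powr_realpow)
  qed
  moreover have "real (2 ^ k) = 2 ^ k" by simp
  ultimately have "real n < real (2 ^ k)" by linarith
  then have "n < 2 ^ k" by (simp only: of_nat_less_iff)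
  then have "n\<^sup>2 < (2 ^ k)\<^sup>2" by (intro power_strict_mono) auto
  then show "n\<^sup>2 < 2 ^ (2 * k)" by (simp add: power_mult[symmetric] mult.commute)
  have "1 / 2 \<le> ln (2 :: real)" using ln2_ge_two_thirds by simp
  then have "?l / ln 2 \<le> ?l / (1 / 2)" using l1 by (intro divide_left_mono) auto
  then have "log 2 (2 + real n) \<le> 2 * ?l" by (simp add: log_def)
  then show "real (2 * k) \<le> 6 * ?l" using k l1 by simp
qed

text \<open>Logarithms need positive elements. The larger of the positive and the negative part is
  kept, the latter after negation, which changes none of its difference, product and quotient
  sets.\<close>

lemma positive_half:
  fixes A :: "real set"
  assumes "finite A" "A \<noteq> {}" "0 \<notin> A"
  obtains B where "finite B" "B \<noteq> {}" "\<And>b. b \<in> B \<Longrightarrow> 0 < b" "card B \<le> card A" "card A \<le> 2 * card B"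
    "diffset B \<subseteq> diffset A" "prodset B \<subseteq> prodset A" "quotset B \<subseteq> quotset A"
proof -
  define P where "P = {a \<in> A. 0 < a}"
  define N where "N = {a \<in> A. a < 0}"
  have fin: "finite P" "finite N" using assms by (auto simp: P_def N_def)
  have "a \<noteq> 0" if "a \<in> A" for a using that assms(3) by auto
  then have "A = P \<union> N" by (auto simp: P_def N_def neq_iff)
  then have cA: "card A = card P + card N"
    using fin by (metis (no_types, lifting) N_def P_def card_Un_disjoint disjoint_iff less_asym mem_Collect_eq)
  have A0: "0 < card A" using assms by (simp add: card_gt_0_iff)
  show thesis
  proof (cases "card N \<le> card P")
    case True
    then have "P \<noteq> {}" using cA A0 by auto
    then show ?thesis
      using True cA fin
      by (intro that[of P]) (auto simp: P_def diffset_def prodset_def quotset_def)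
  next
    case False
    then have "N \<noteq> {}" by auto
    moreover have "diffset (uminus ` N) \<subseteq> diffset A"
    proof
      fix z assume "z \<in> diffset (uminus ` N)"
      then obtain a b where "a \<in> N" "b \<in> N" "z = b - a" by (auto simp: diffset_def)
      then show "z \<in> diffset A" by (auto simp: diffset_def N_def)
    qed
    moreover have "prodset (uminus ` N) \<subseteq> prodset A"
    proof
      fix z assume "z \<in> prodset (uminus ` N)"
      then obtain a b where "a \<in> N" "b \<in> N" "z = a * b" by (auto simp: prodset_def)
      then show "z \<in> prodset A" by (auto simp: prodset_def N_def)
    qed
    moreover have "quotset (uminus ` N) \<subseteq> quotset A"
    proof
      fix z assume "z \<in> quotset (uminus ` N)"
      then obtain a b where "a \<in> N" "b \<in> N" "z = a / b" by (auto simp: quotset_def)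
      then show "z \<in> quotset A" by (auto simp: quotset_def N_def)
    qed
    ultimately show ?thesis
      using False cA fin
      by (intro that[of "uminus ` N"]) (auto simp: N_def)
  qed
qed

text \<open>The end of the argument common to both claims, with \<open>Q\<close> the product or
  quotient set. Passing to half of A costs 2^e <= 4, and J <= 6 ln(2 + n) turns J^3 into the third
  power of the logarithm, so c = 3.\<close>

lemma card_powr_le_max:
  fixes Q :: "real set \<Rightarrow> real set" and e :: real
  assumes e: "0 \<le> e" "e \<le> 2" and Q: "\<And>A. finite A \<Longrightarrow> finite (Q A)" "\<And>A. A \<noteq> {} \<Longrightarrow> Q A \<noteq> {}"
    and half: "\<And>A :: real set. finite A \<Longrightarrow> A \<noteq> {} \<Longrightarrow> 0 \<notin> A \<Longrightarrow>
       (\<exists>B. finite B \<and> B \<noteq> {} \<and> (\<forall>b\<in>B. 0 < b) \<and> card B \<le> card A \<and> card A \<le> 2 * card B \<and>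
          diffset B \<subseteq> diffset A \<and> Q B \<subseteq> Q A)"
    and main: "\<And>(A :: real set) J \<mu>. finite A \<Longrightarrow> A \<noteq> {} \<Longrightarrow> (\<And>a. a \<in> A \<Longrightarrow> 0 < a) \<Longrightarrow> (card A)\<^sup>2 < 2 ^ J \<Longrightarrow> 0 < J \<Longrightarrow>
       \<mu> = real (max (card (diffset A)) (card (Q A))) \<Longrightarrow> 0 < \<mu> \<Longrightarrow> real (card A) powr e \<le> 2 ^ 19 * real J ^ 3 * \<mu>"
  shows "\<exists>C c. C > 0 \<and> c > 0 \<and>
           (\<forall>A :: real set. finite A \<and> A \<noteq> {} \<and> 0 \<notin> A \<longrightarrow>
              real (card A) powr e
                \<le> C * real (max (card (diffset A)) (card (Q A)))
                    * (ln (2 + real (card A))) powr c)"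
proof (intro exI conjI allI impI)
  fix A :: "real set" assume A: "finite A \<and> A \<noteq> {} \<and> 0 \<notin> A"
  then obtain B where B: "finite B" "B \<noteq> {}" "\<forall>b\<in>B. 0 < b" "card B \<le> card A" "card A \<le> 2 * card B"
    "diffset B \<subseteq> diffset A" "Q B \<subseteq> Q A" using half[of A] by auto
  let ?l = "ln (2 + real (card A))"
  let ?\<mu> = "\<lambda>A. real (max (card (diffset A)) (card (Q A)))"
  have l0: "0 < ?l" by simp
  have B1: "1 \<le> card B" using B by (simp add: Suc_le_eq card_gt_0_iff)
  then obtain J where J: "0 < J" "(card B)\<^sup>2 < 2 ^ J" "real J \<le> 6 * ln (2 + real (card B))"
    using exists_dyadic_bound by blast
  have "ln (2 + real (card B)) \<le> ?l" using B by simp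
  then have Jl: "real J \<le> 6 * ?l" using J by linarith
  have "0 < card (Q B)" using B Q by (simp add: card_gt_0_iff)
  then have "0 < ?\<mu> B" by simp
  then have le: "real (card B) powr e \<le> 2 ^ 19 * real J ^ 3 * ?\<mu> B"
    using B J by (intro main) auto
  have \<mu>: "?\<mu> B \<le> ?\<mu> A"
  proof -
    have "card (diffset B) \<le> card (diffset A)" "card (Q B) \<le> card (Q A)"
      using A B Q finite_diffset by (auto intro: card_mono)
    then show ?thesis by linarith
  qed
  have "real (card A) powr e \<le> (2 * real (card B)) powr e"
    using e of_nat_mono[OF B(5), where ?'a = real] by (intro powr_mono2) auto
  also have "\<dots> = 2 powr e * real (card B) powr e" by (simp add: powr_mult)
  also have "\<dots> \<le> 2 powr 2 * (2 ^ 19 * real J ^ 3 * ?\<mu> B)"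
    using e le by (intro mult_mono powr_mono) auto
  also have "\<dots> \<le> 4 * (2 ^ 19 * (6 * ?l) ^ 3 * ?\<mu> A)"
  proof -
    have "real J ^ 3 \<le> (6 * ?l) ^ 3" using Jl by (intro power_mono) auto
    then have "real J ^ 3 * ?\<mu> B \<le> (6 * ?l) ^ 3 * ?\<mu> A" using \<mu> l0 by (intro mult_mono) auto
    then show ?thesis by (simp add: mult_ac)
  qed
  also have "\<dots> = (4 * 2 ^ 19 * 6 ^ 3) * ?\<mu> A * ?l powr 3"
  proof -
    have "?l powr 3 = ?l ^ 3" using powr_realpow[OF l0, of 3] by simp
    then show ?thesis by (simp add: power_mult_distrib)
  qed
  finally show "real (card A) powr e \<le> (4 * 2 ^ 19 * 6 ^ 3) * ?\<mu> A * ?l powr 3" .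
qed auto

theorem mainTheorem8:
  shows "(\<exists>C c. C > 0 \<and> c > 0 \<and>
           (\<forall>A :: real set. finite A \<and> A \<noteq> {} \<and> 0 \<notin> A \<longrightarrow>
              real (card A) powr (1 + 105/347)
                \<le> C * real (max (card (diffset A)) (card (prodset A)))
                    * (ln (2 + real (card A))) powr c))
       \<and> (\<exists>C c. C > 0 \<and> c > 0 \<and>
           (\<forall>A :: real set. finite A \<and> A \<noteq> {} \<and> 0 \<notin> A \<longrightarrow>
              real (card A) powr (1 + 15/49)
                \<le> C * real (max (card (diffset A)) (card (quotset A)))
                    * (ln (2 + real (card A))) powr c))"
proof
  show "\<exists>C c. C > 0 \<and> c > 0 \<and>
           (\<forall>A :: real set. finite A \<and> A \<noteq> {} \<and> 0 \<notin> A \<longrightarrow>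
              real (card A) powr (1 + 105/347)
                \<le> C * real (max (card (diffset A)) (card (prodset A)))
                    * (ln (2 + real (card A))) powr c)"
  proof (rule card_powr_le_max[OF _ _ finite_prodset])
    fix A :: "real set" and J \<mu>
    assume A: "finite A" "A \<noteq> {}" "\<And>a. a \<in> A \<Longrightarrow> 0 < a" and J: "(card A)\<^sup>2 < 2 ^ J" "0 < J"
      and \<mu>: "\<mu> = real (max (card (diffset A)) (card (prodset A)))" "0 < \<mu>"
    let ?n = "real (card A)" and ?q = "real (card (prodset A))" and ?d = "real (card (diffset A))"
    have n1: "1 \<le> ?n" using A by (simp add: Suc_le_eq card_gt_0_iff)
    have J1: "1 \<le> real J" using J by simp
    have q: "?q \<le> \<mu>" "?d \<le> \<mu>" using \<mu> by auto
    from power86_le_product[OF A J] show "?n powr (1 + 105/347) \<le> 2 ^ 19 * real J ^ 3 * \<mu>"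
    proof
      assume "?n ^ 22 \<le> 2 ^ 260 * real J ^ 41 * ?q ^ 14"
      also have "\<dots> \<le> 2 ^ 260 * real J ^ 41 * \<mu> ^ 14" using q by (intro mult_left_mono power_mono) auto
      finally show ?thesis by (rule powr_le_of_power_le[OF _ n1 J1 \<mu>(2)]) auto
    next
      assume "?n ^ 86 \<le> 2 ^ 716 * real J ^ 85 * ?q ^ 26 * ?d ^ 40"
      also have "\<dots> \<le> 2 ^ 716 * real J ^ 85 * \<mu> ^ 26 * \<mu> ^ 40"
        using q \<mu>(2) by (intro mult_mono mult_left_mono power_mono) auto
      also have "\<dots> = 2 ^ 716 * real J ^ 85 * \<mu> ^ 66" by (simp only: mult.assoc flip: power_add) simp
      finally show ?thesis by (rule powr_le_of_power_le[OF _ n1 J1 \<mu>(2)]) auto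
    qed
  next
    fix A :: "real set" assume "finite A" "A \<noteq> {}" "0 \<notin> A"
    then show "\<exists>B. finite B \<and> B \<noteq> {} \<and> (\<forall>b\<in>B. 0 < b) \<and> card B \<le> card A \<and> card A \<le> 2 * card B \<and>
          diffset B \<subseteq> diffset A \<and> prodset B \<subseteq> prodset A"
      by (rule positive_half) blast
  qed (auto simp: prodset_def)
  show "\<exists>C c. C > 0 \<and> c > 0 \<and>
           (\<forall>A :: real set. finite A \<and> A \<noteq> {} \<and> 0 \<notin> A \<longrightarrow>
              real (card A) powr (1 + 15/49)
                \<le> C * real (max (card (diffset A)) (card (quotset A)))
                    * (ln (2 + real (card A))) powr c)"
  proof (rule card_powr_le_max[OF _ _ finite_quotset])
    fix A :: "real set" and J \<mu>
    assume A: "finite A" "A \<noteq> {}" "\<And>a. a \<in> A \<Longrightarrow> 0 < a" and J: "(card A)\<^sup>2 < 2 ^ J" "0 < J"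
      and \<mu>: "\<mu> = real (max (card (diffset A)) (card (quotset A)))" "0 < \<mu>"
    let ?n = "real (card A)" and ?q = "real (card (quotset A))" and ?d = "real (card (diffset A))"
    have n1: "1 \<le> ?n" using A by (simp add: Suc_le_eq card_gt_0_iff)
    have J1: "1 \<le> real J" using J by simp
    have q: "?q \<le> \<mu>" "?d \<le> \<mu>" using \<mu> by auto
    from power64_le_quotient[OF A J] show "?n powr (1 + 15/49) \<le> 2 ^ 19 * real J ^ 3 * \<mu>"
    proof
      assume "?n ^ 8 \<le> 2 ^ 81 * real J ^ 13 * ?q ^ 5"
      also have "\<dots> \<le> 2 ^ 81 * real J ^ 13 * \<mu> ^ 5" using q by (intro mult_left_mono power_mono) auto
      finally show ?thesis by (rule powr_le_of_power_le[OF _ n1 J1 \<mu>(2)]) auto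
    next
      assume "?n ^ 64 \<le> 2 ^ 504 * real J ^ 59 * ?q ^ 19 * ?d ^ 30"
      also have "\<dots> \<le> 2 ^ 504 * real J ^ 59 * \<mu> ^ 19 * \<mu> ^ 30"
        using q \<mu>(2) by (intro mult_mono mult_left_mono power_mono) auto
      also have "\<dots> = 2 ^ 504 * real J ^ 59 * \<mu> ^ 49" by (simp only: mult.assoc flip: power_add) simp
      finally show ?thesis by (rule powr_le_of_power_le[OF _ n1 J1 \<mu>(2)]) auto
    qed
  next
    fix A :: "real set" assume "finite A" "A \<noteq> {}" "0 \<notin> A"
    then show "\<exists>B. finite B \<and> B \<noteq> {} \<and> (\<forall>b\<in>B. 0 < b) \<and> card B \<le> card A \<and> card A \<le> 2 * card B \<and>
          diffset B \<subseteq> diffset A \<and> quotset B \<subseteq> quotset A"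
      by (rule positive_half) blast
  qed (auto simp: quotset_def)
qed

end
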